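(* Let $\varepsilon\in\{0,1\}$ and $t\in\mathbb{N}$. a) There exists a polynomial $P_{\varepsilon,t}\in\mathbb{Q}[T]$ of degree $\left[\frac{t}{2}\right]$ with positive dominant (leading) coefficient such that $F_{2n+\varepsilon,\,n+1-t}=P_{\varepsilon,t}(n)$ for all sufficiently large $n$. b) There exists a polynomial $P_t\in\mathbb{Q}[T]$ of degree $\left[\frac{t}{2}\right]$ with positive dominant (leading) coefficient such that $\widetilde{F}_{n,\,n+1-t}=P_t(n)$ for all sufficiently large $n$.
   Context: $\Bbbk$ is an algebraically closed field of characteristic zero; $\mathbb{N}=\{0,1,2,\dots\}$, $\mathbb{N}^*=\mathbb{N}\setminus\{0\}$; $[x]$ denotes the integer part of $x$. For $n\in\mathbb{N}^*$, a composition of $n$ is a finite sequence $\mathbf{a}=(a_1,\dots,a_r)$ with $r\in\mathbb{N}^*$, $a_i\in\mathbb{N}^*$ and $a_1+\cdots+a_r=n$; $\mathcal{C}_n$ is the set of compositions of $n$, and $p(\mathbf{a})=r$ is the number of parts of $\mathbf{a}$. For $\mathbf{a}\in\mathcal{C}_n$, the standard parabolic subalgebra $\mathfrak{p}_{\mathbf{a}}\subset \mathrm{sl}_n(\Bbbk)$ is the Lie algebra of trace-zero $n\times n$ matrices that are block upper triangular with diagonal blocks of successive sizes $a_1,\dots,a_r$. For a pair $(\mathbf{a}^+,\mathbf{a}^-)\in\mathcal{C}_n\times\mathcal{C}_n$, the standard seaweed subalgebra is $\mathfrak{p}_{(\mathbf{a}^+,\mathbf{a}^-)}=\mathfrak{p}_{\mathbf{a}^+}\cap{}^{t}\mathfrak{p}_{\mathbf{a}^-}$,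 where ${}^{t}\mathfrak{p}_{\mathbf{a}^-}$ is the set of transposes of elements of $\mathfrak{p}_{\mathbf{a}^-}$. The index of a finite-dimensional Lie algebra $\mathfrak{g}$ is $\mathrm{ind}(\mathfrak{g})=\min\{\dim\mathfrak{g}^f : f\in\mathfrak{g}^*\}$, where $\mathfrak{g}^f=\{x\in\mathfrak{g}: f([x,y])=0\ \text{for all } y\in\mathfrak{g}\}$. A Lie algebra is Frobenius if its index is $0$. $F_{n,p}$ is the number of Frobenius standard parabolic subalgebras $\mathfrak{p}_{\mathbf{a}}$ of $\mathrm{sl}_n(\Bbbk)$ with $\mathbf{a}\in\mathcal{C}_n$ and $p(\mathbf{a})=p$. $\widetilde{F}_{n,p}$ is the number of Frobenius standard seaweed subalgebras $\mathfrak{p}_{(\mathbf{a}^+,\mathbf{a}^-)}$ of $\mathrm{sl}_n(\Bbbk)$ with $(\mathbf{a}^+,\mathbf{a}^-)\in\mathcal{C}_n\times\mathcal{C}_n$ and $p(\mathbf{a}^+)+p(\mathbf{a}^-)=p$. *)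

theory Defs
  imports
    "Jordan_Normal_Form.VS_Connect"
    "HOL-Computational_Algebra.Polynomial"
begin

text \<open>Matrices of size \<open>n\<close> are the elements of \<^term>\<open>carrier_mat n n\<close>, with rows and columns
  indexed from 0. A Lie algebra of such matrices is given by its underlying set \<open>g\<close>; the bracket
  is the commutator.\<close>

definition compositions :: "nat \<Rightarrow> nat list set" where
  "compositions n = {a. a \<noteq> [] \<and> (\<forall>x\<in>set a. 0 < x) \<and> sum_list a = n}"

definition trace :: "'k::comm_ring_1 mat \<Rightarrow> 'k" where
  "trace A = (\<Sum>i<dim_row A. A $$ (i, i))"

definition sl :: "nat \<Rightarrow> 'k::comm_ring_1 mat set" where
  "sl n = {A \<in> carrier_mat n n. trace A = 0}"

definition lie_bracket :: "'k::comm_ring_1 mat \<Rightarrow> 'k mat \<Rightarrow> 'k mat" where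
  "lie_bracket A B = A * B - B * A"

text \<open>The number (counted from 0) of the diagonal block containing row \<open>i\<close> when the rows are split
  into consecutive blocks of sizes \<open>a ! 0, a ! 1, \<dots>\<close>; meaningful for \<open>i < sum_list a\<close>.\<close>

definition block_of :: "nat list \<Rightarrow> nat \<Rightarrow> nat" where
  "block_of a i = (LEAST k. i < sum_list (take (Suc k) a))"

definition parabolic :: "nat list \<Rightarrow> 'k::comm_ring_1 mat set" where
  "parabolic a = {A \<in> sl (sum_list a). \<forall>i<sum_list a. \<forall>j<sum_list a.
     block_of a j < block_of a i \<longrightarrow> A $$ (i, j) = 0}"

definition seaweed :: "nat list \<Rightarrow> nat list \<Rightarrow> 'k::comm_ring_1 mat set" where
  "seaweed a b = parabolic a \<inter> transpose_mat ` parabolic b"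

definition sub_dim :: "nat \<Rightarrow> 'k::field mat set \<Rightarrow> nat" where
  "sub_dim n W = vectorspace.dim class_ring (module_mat TYPE('k) n n\<lparr>carrier := W\<rparr>)"

text \<open>The elements of the dual of \<open>g\<close> are represented by functions on all matrices; only the values
  on \<open>g\<close> are constrained, and only those matter below.\<close>

definition linear_form :: "'k::field mat set \<Rightarrow> ('k mat \<Rightarrow> 'k) \<Rightarrow> bool" where
  "linear_form g f \<longleftrightarrow> (\<forall>A\<in>g. \<forall>B\<in>g. f (A + B) = f A + f B) \<and> (\<forall>c. \<forall>A\<in>g. f (c \<cdot>\<^sub>m A) = c * f A)"

definition form_stabilizer :: "'k::field mat set \<Rightarrow> ('k mat \<Rightarrow> 'k) \<Rightarrow> 'k mat set" where
  "form_stabilizer g f = {A \<in> g. \<forall>B\<in>g. f (lie_bracket A B) = 0}"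

definition lie_index :: "nat \<Rightarrow> 'k::field mat set \<Rightarrow> nat" where
  "lie_index n g = (LEAST d. \<exists>f. linear_form g f \<and> d = sub_dim n (form_stabilizer g f))"

definition frobenius :: "nat \<Rightarrow> 'k::field mat set \<Rightarrow> bool" where
  "frobenius n g \<longleftrightarrow> lie_index n g = 0"

text \<open>Both numbers count subalgebras, that is, sets of matrices.\<close>

definition F_parabolic :: "'k::field itself \<Rightarrow> nat \<Rightarrow> nat \<Rightarrow> nat" where
  "F_parabolic ty n p = card {g :: 'k mat set.
     frobenius n g \<and> (\<exists>a\<in>compositions n. length a = p \<and> g = parabolic a)}"

definition F_seaweed :: "'k::field itself \<Rightarrow> nat \<Rightarrow> nat \<Rightarrow> nat" where
  "F_seaweed ty n p = card {g :: 'k mat set.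
     frobenius n g \<and> (\<exists>a\<in>compositions n. \<exists>b\<in>compositions n.
       length a + length b = p \<and> g = seaweed a b)}"

text \<open>Well-formedness: the objects above are subspaces and Lie subalgebras, so \<^const>\<open>sub_dim\<close> is
  a dimension of a vector space, and the minimum in \<^const>\<open>lie_index\<close> is attained.\<close>

lemma subspace_matI:
  fixes W :: "'k::field mat set"
  assumes "W \<subseteq> carrier_mat n n" "0\<^sub>m n n \<in> W"
    and "\<And>A B. A \<in> W \<Longrightarrow> B \<in> W \<Longrightarrow> A + B \<in> W"
    and "\<And>c A. A \<in> W \<Longrightarrow> c \<cdot>\<^sub>m A \<in> W"
  shows "VectorSpace.subspace class_ring W (module_mat TYPE('k) n n)"
proof -
  interpret V: vectorspace "class_ring :: 'k ring" "module_mat TYPE('k) n n" by (rule matrix_vs)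
  show ?thesis
    by (intro VectorSpace.subspace.intro V.vectorspace_axioms submodule.intro V.module_axioms)
      (use assms in \<open>auto simp: module_mat_simps\<close>)
qed

lemma trace_add: "A \<in> carrier_mat n n \<Longrightarrow> B \<in> carrier_mat n n \<Longrightarrow> trace (A + B) = trace A + trace B"
  by (auto simp: trace_def sum.distrib)

lemma trace_minus: "A \<in> carrier_mat n n \<Longrightarrow> B \<in> carrier_mat n n \<Longrightarrow> trace (A - B) = trace A - trace B"
  by (auto simp: trace_def sum_subtractf)

lemma trace_smult: "A \<in> carrier_mat n n \<Longrightarrow> trace (c \<cdot>\<^sub>m A) = c * trace A"
  by (auto simp: trace_def sum_distrib_left)

lemma trace_mult_commute:
  assumes "A \<in> carrier_mat n n" "B \<in> carrier_mat n n"
  shows "trace (A * B) = trace (B * A)"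
proof -
  have "trace (A * B) = (\<Sum>i<n. \<Sum>j<n. A $$ (i, j) * B $$ (j, i))"
    using assms by (auto simp: trace_def scalar_prod_def atLeast0LessThan)
  also have "\<dots> = (\<Sum>j<n. \<Sum>i<n. A $$ (i, j) * B $$ (j, i))"
    by (rule sum.swap)
  also have "\<dots> = trace (B * A)"
    using assms by (auto simp: trace_def scalar_prod_def atLeast0LessThan mult.commute)
  finally show ?thesis .
qed

lemma parabolic_carrier: "parabolic a \<subseteq> carrier_mat (sum_list a) (sum_list a)"
  by (auto simp: parabolic_def sl_def)

lemma parabolic_zero: "0\<^sub>m (sum_list a) (sum_list a) \<in> parabolic a"
  by (auto simp: parabolic_def sl_def trace_def)

lemma parabolic_add: "A \<in> parabolic a \<Longrightarrow> B \<in> parabolic a \<Longrightarrow> A + B \<in> parabolic a"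
  by (auto simp: parabolic_def sl_def trace_add)

lemma parabolic_smult: "A \<in> parabolic a \<Longrightarrow> c \<cdot>\<^sub>m A \<in> parabolic a"
  by (auto simp: parabolic_def sl_def trace_smult)

lemma parabolic_mult_entry:
  assumes A: "A \<in> parabolic a" and B: "B \<in> parabolic a"
    and ij: "i < sum_list a" "j < sum_list a" "block_of a j < block_of a i"
  shows "(A * B) $$ (i, j) = 0"
proof -
  have "A $$ (i, k) * B $$ (k, j) = 0" if "k < sum_list a" for k
    using A B ij that by (cases "block_of a k < block_of a i") (auto simp: parabolic_def)
  moreover have "A \<in> carrier_mat (sum_list a) (sum_list a)" "B \<in> carrier_mat (sum_list a) (sum_list a)"
    using parabolic_carrier A B by auto
  ultimately show ?thesis
    using ij by (auto simp: scalar_prod_def intro!: sum.neutral)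
qed

lemma parabolic_bracket:
  assumes A: "A \<in> parabolic a" and B: "B \<in> parabolic a"
  shows "lie_bracket A B \<in> parabolic a"
proof -
  let ?n = "sum_list a"
  have c: "A \<in> carrier_mat ?n ?n" "B \<in> carrier_mat ?n ?n"
    using assms parabolic_carrier by auto
  have m: "A * B \<in> carrier_mat ?n ?n" "B * A \<in> carrier_mat ?n ?n"
    using c by auto
  have "lie_bracket A B $$ (i, j) = 0"
    if "i < ?n" "j < ?n" "block_of a j < block_of a i" for i j
    using parabolic_mult_entry[OF A B that] parabolic_mult_entry[OF B A that]
      carrier_matD[OF m(1)] carrier_matD[OF m(2)] that
    by (simp add: lie_bracket_def del: index_mult_mat(1))
  moreover have "trace (lie_bracket A B) = 0"
    using trace_minus[OF m] trace_mult_commute[OF c] by (simp add: lie_bracket_def)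
  moreover have "lie_bracket A B \<in> carrier_mat ?n ?n"
    using minus_carrier_mat[OF m(2)] by (simp add: lie_bracket_def)
  ultimately show ?thesis
    by (auto simp: parabolic_def sl_def)
qed

lemma lie_bracket_transpose:
  assumes "A \<in> carrier_mat n n" "B \<in> carrier_mat n n"
  shows "transpose_mat (lie_bracket A B) = lie_bracket (transpose_mat B) (transpose_mat A)"
proof -
  have "transpose_mat (lie_bracket A B) = transpose_mat (A * B) - transpose_mat (B * A)"
    unfolding lie_bracket_def by (rule transpose_minus[of _ n n]) (use assms in auto)
  then show ?thesis
    using assms by (simp add: lie_bracket_def transpose_mult[of _ n n])
qed

lemma mem_seaweed_iff: "A \<in> seaweed a b \<longleftrightarrow> A \<in> parabolic a \<and> transpose_mat A \<in> parabolic b"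
proof
  show "A \<in> parabolic a \<and> transpose_mat A \<in> parabolic b" if "A \<in> seaweed a b"
    using that by (auto simp: seaweed_def)
  show "A \<in> seaweed a b" if "A \<in> parabolic a \<and> transpose_mat A \<in> parabolic b"
    using that by (auto simp: seaweed_def intro!: image_eqI[of A _ "transpose_mat A"])
qed

lemma seaweed_bracket:
  assumes "A \<in> seaweed a b" "B \<in> seaweed a b"
  shows "lie_bracket A B \<in> seaweed a b"
proof -
  have "A \<in> carrier_mat (sum_list a) (sum_list a)" "B \<in> carrier_mat (sum_list a) (sum_list a)"
    using assms parabolic_carrier by (auto simp: mem_seaweed_iff)
  from lie_bracket_transpose[OF this] show ?thesis
    using assms by (simp add: mem_seaweed_iff parabolic_bracket)
qed

lemma subspace_parabolic:
  "VectorSpace.subspace class_ring (parabolic a)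
     (module_mat TYPE('k::field) (sum_list a) (sum_list a))"
  by (intro subspace_matI parabolic_carrier parabolic_zero parabolic_add parabolic_smult)

lemma subspace_seaweed:
  assumes "a \<in> compositions n" "b \<in> compositions n"
  shows "VectorSpace.subspace class_ring (seaweed a b) (module_mat TYPE('k::field) n n)"
proof (rule subspace_matI)
  have n: "sum_list a = n" "sum_list b = n"
    using assms by (auto simp: compositions_def)
  show "seaweed a b \<subseteq> carrier_mat n n"
    using parabolic_carrier[of a] n by (auto simp: seaweed_def)
  show "0\<^sub>m n n \<in> seaweed a b"
    using parabolic_zero[of a] parabolic_zero[of b] n by (simp add: mem_seaweed_iff)
  show "A + B \<in> seaweed a b" if AB: "A \<in> seaweed a b" "B \<in> seaweed a b" for A B :: "'k mat"
  proof -
    have "A \<in> carrier_mat n n" "B \<in> carrier_mat n n"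
      using AB n parabolic_carrier[of a] by (auto simp: mem_seaweed_iff)
    from transpose_add[OF this] show ?thesis
      using AB by (simp add: mem_seaweed_iff parabolic_add)
  qed
  show "c \<cdot>\<^sub>m A \<in> seaweed a b" if A: "A \<in> seaweed a b" for c and A :: "'k mat"
  proof -
    have "transpose_mat (c \<cdot>\<^sub>m A) = c \<cdot>\<^sub>m transpose_mat A"
      by (rule eq_matI) auto
    then show ?thesis
      using A by (simp add: mem_seaweed_iff parabolic_smult)
  qed
qed

lemma mat_add_diff_add:
  fixes P :: "'k::comm_ring_1 mat"
  assumes "P \<in> carrier_mat n n" "Q \<in> carrier_mat n n" "R \<in> carrier_mat n n" "S \<in> carrier_mat n n"
  shows "(P + Q) - (R + S) = (P - R) + (Q - S)"
  by (rule eq_matI) (use assms in auto)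

lemma mat_smult_diff:
  fixes P :: "'k::comm_ring_1 mat"
  assumes "P \<in> carrier_mat n n" "Q \<in> carrier_mat n n"
  shows "c \<cdot>\<^sub>m P - c \<cdot>\<^sub>m Q = c \<cdot>\<^sub>m (P - Q)"
  by (rule eq_matI) (use assms in \<open>auto simp: right_diff_distrib\<close>)

lemma lie_bracket_add_left:
  assumes "A \<in> carrier_mat n n" "B \<in> carrier_mat n n" "C \<in> carrier_mat n n"
  shows "lie_bracket (A + B) C = lie_bracket A C + lie_bracket B C"
proof -
  have "(A + B) * C = A * C + B * C"
    using assms by (rule add_mult_distrib_mat)
  moreover have "C * (A + B) = C * A + C * B"
    using assms(3,1,2) by (rule mult_add_distrib_mat)
  moreover have "A * C \<in> carrier_mat n n" "B * C \<in> carrier_mat n n"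
      "C * A \<in> carrier_mat n n" "C * B \<in> carrier_mat n n"
    using assms by auto
  ultimately show ?thesis
    by (simp add: lie_bracket_def mat_add_diff_add)
qed

lemma lie_bracket_smult_left:
  assumes "A \<in> carrier_mat n n" "C \<in> carrier_mat n n"
  shows "lie_bracket (c \<cdot>\<^sub>m A) C = c \<cdot>\<^sub>m lie_bracket A C"
proof -
  have "(c \<cdot>\<^sub>m A) * C = c \<cdot>\<^sub>m (A * C)"
    using assms by (rule mult_smult_assoc_mat)
  moreover have "C * (c \<cdot>\<^sub>m A) = c \<cdot>\<^sub>m (C * A)"
    using assms(2,1) by (rule mult_smult_distrib)
  moreover have "A * C \<in> carrier_mat n n" "C * A \<in> carrier_mat n n"
    using assms by auto
  ultimately show ?thesis
    by (simp add: lie_bracket_def mat_smult_diff)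
qed

lemma subspace_form_stabilizer:
  fixes g :: "'k::field mat set"
  assumes g: "VectorSpace.subspace class_ring g (module_mat TYPE('k) n n)"
    and br: "\<And>A B. A \<in> g \<Longrightarrow> B \<in> g \<Longrightarrow> lie_bracket A B \<in> g"
    and f: "linear_form g f"
  shows "VectorSpace.subspace class_ring (form_stabilizer g f) (module_mat TYPE('k) n n)"
proof -
  interpret g: submodule "class_ring :: 'k ring" g "module_mat TYPE('k) n n"
    using g by (rule VectorSpace.subspace.submod)
  have car: "A \<in> carrier_mat n n" if "A \<in> g" for A
    using g.subset that by (auto simp: module_mat_simps)
  have add: "A + B \<in> g" if "A \<in> g" "B \<in> g" for A B
    using g.m_closed that by (auto simp: module_mat_simps)
  have smult: "c \<cdot>\<^sub>m A \<in> g" if "A \<in> g" for c A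
    using g.smult_closed that by (auto simp: module_mat_simps)
  have zero: "0\<^sub>m n n \<in> g"
    using g.zero_closed by (auto simp: module_mat_simps)
  have "f (0 \<cdot>\<^sub>m 0\<^sub>m n n) = 0"
    using f zero unfolding linear_form_def by (metis mult_zero_left)
  then have f0: "f (0\<^sub>m n n) = 0"
    by simp
  show ?thesis
  proof (rule subspace_matI)
    show "form_stabilizer g f \<subseteq> carrier_mat n n"
      using car by (auto simp: form_stabilizer_def)
    have "lie_bracket (0\<^sub>m n n) B = 0\<^sub>m n n" if "B \<in> g" for B
      using car[OF that] by (simp add: lie_bracket_def)
    then show "0\<^sub>m n n \<in> form_stabilizer g f"
      using zero f0 by (auto simp: form_stabilizer_def)
    show "A + B \<in> form_stabilizer g f"
      if A: "A \<in> form_stabilizer g f" and B: "B \<in> form_stabilizer g f" for A B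
    proof -
      have AB: "A \<in> g" "B \<in> g"
        using A B by (auto simp: form_stabilizer_def)
      have "f (lie_bracket (A + B) C) = 0" if C: "C \<in> g" for C
      proof -
        have "f (lie_bracket (A + B) C) = f (lie_bracket A C + lie_bracket B C)"
          using lie_bracket_add_left[OF car[OF AB(1)] car[OF AB(2)] car[OF C]] by simp
        also have "\<dots> = f (lie_bracket A C) + f (lie_bracket B C)"
          using f br[OF AB(1) C] br[OF AB(2) C] unfolding linear_form_def by blast
        also have "\<dots> = 0"
          using A B C by (simp add: form_stabilizer_def)
        finally show ?thesis .
      qed
      then show ?thesis
        using add[OF AB] by (simp add: form_stabilizer_def)
    qed
    show "c \<cdot>\<^sub>m A \<in> form_stabilizer g f" if A: "A \<in> form_stabilizer g f" for c A
    proof -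
      have Ag: "A \<in> g"
        using A by (auto simp: form_stabilizer_def)
      have "f (lie_bracket (c \<cdot>\<^sub>m A) C) = 0" if C: "C \<in> g" for C
      proof -
        have "f (lie_bracket (c \<cdot>\<^sub>m A) C) = f (c \<cdot>\<^sub>m lie_bracket A C)"
          using lie_bracket_smult_left[OF car[OF Ag] car[OF C]] by simp
        also have "\<dots> = c * f (lie_bracket A C)"
          using f br[OF Ag C] unfolding linear_form_def by blast
        also have "\<dots> = 0"
          using A C by (simp add: form_stabilizer_def)
        finally show ?thesis .
      qed
      then show ?thesis
        using smult[OF Ag] by (simp add: form_stabilizer_def)
    qed
  qed
qed

lemma lie_index_attained: "\<exists>f. linear_form g f \<and> lie_index n g = sub_dim n (form_stabilizer g f)"
proof -
  have "linear_form g (\<lambda>_. 0)"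
    by (simp add: linear_form_def)
  then have "\<exists>d f. linear_form g f \<and> d = sub_dim n (form_stabilizer g f)"
    by blast
  from LeastI_ex[OF this] show ?thesis
    unfolding lie_index_def .
qed

lemma lie_index_le: "linear_form g f \<Longrightarrow> lie_index n g \<le> sub_dim n (form_stabilizer g f)"
  unfolding lie_index_def by (rule Least_le) blast

end

theory Submission
  imports Defs "HOL-Library.Function_Algebras"
begin

text \<open>Together with the scalar matrices, a seaweed subalgebra of \<open>sl n\<close> is an associative algebra
\<open>A\<close>, spanned by the matrix units \<open>E i j\<close> with \<open>(i, j)\<close> in a preorder on \<open>{..<n}\<close>. It is a
Frobenius Lie algebra iff some linear form \<open>f\<close> on \<open>A\<close> makes \<open>f (x y - y x)\<close> nondegenerate modulo
the scalars. The proof has a part about such algebras and a purely combinatorial part.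

\<^bold>\<open>Contraction of a pair of compositions.\<close> Let the two compositions of \<open>n\<close> start with parts
\<open>x < y\<close>. The matrices with rows in the first \<open>x\<close> positions and columns in the next \<open>y - x\<close>
positions form an abelian ideal \<open>N\<close>. It is isotropic for the commutator form of \<open>f\<close>, so a
nondegenerate form stays nondegenerate modulo \<open>N\<close> on the orthogonal space of \<open>N\<close>. After a
perturbation of \<open>f\<close> and a conjugation by an invertible element of \<open>A\<close>, the restriction of \<open>f\<close> to
\<open>N\<close> is a fixed partial permutation; then the orthogonal space modulo \<open>N\<close> is the algebra of a
smaller pair, which is obtained by a step of the Euclidean algorithm (\<open>frob_contract\<close>). This
rule, the invariance under swapping and reversing both compositions, the remark that a boundary
common to both compositions gives a central idempotent, hence an obstruction, and the trivial cases
in which both compositions have a single part are what the locale \<open>frobenius_pairs\<close>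
keeps of the Lie algebras.

\<^bold>\<open>One composition instead of two.\<close> By contraction, a pair \<open>(p, q)\<close> of compositions of
\<open>n\<close> is Frobenius iff the composition \<open>p @ rev q\<close> of \<open>2 n\<close> is so together with the composition
that has the single part \<open>2 n\<close>. Hence both halves of the theorem count compositions \<open>a\<close> of
\<open>2 n + e\<close> that are Frobenius against a single part, in the case
of seaweeds with a boundary in the middle. Contraction preserves the number of odd parts, so a
Frobenius pair has exactly two of them; consequently a composition with \<open>n + 1 - t\<close> parts has
excess \<open>t\<close>, where a part \<open>x\<close> has excess \<open>(x - 1) div 2\<close> (\<open>excess_length\<close>). For fixed \<open>t\<close> and
large \<open>n\<close> almost all parts are equal to 2.

\<^bold>\<open>Cutting.\<close> If a part 2 has its centre at distance \<open>m\<close> from one end and there is a boundary at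
distance \<open>m\<close> from the other end, then the composition can be cut there into an outer piece and an
inner composition that starts with 1, and it is Frobenius iff both are (\<open>cut_single\<close>). Since two
parts 2 cannot face each other, a composition without a cut has size bounded in terms of \<open>t\<close>
(\<open>uncut_comps_bound\<close>). Cutting at the first cut gives a recursion for the number \<open>g t n\<close> of inner
compositions (\<open>card_tails\<close>), whose coefficients \<open>mid m s\<close> count the outer pieces of size \<open>m\<close> and
excess \<open>s\<close> that start with 1. There is one such piece of excess 0, of size 1; none of excess 1; and at
least one of excess 2. So for large \<open>n\<close> the difference \<open>g t (n + 1) - g t n\<close> is a
nonnegative combination of shifts of
\<open>g (t - 2), g (t - 3), \<dots>\<close> in which \<open>g (t - 2)\<close> occurs: two units of excess raise the degree by
one, and \<open>g t\<close> is eventually a polynomial of degree \<open>t div 2\<close> (\<open>ev_poly_tails\<close>).\<close>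

section \<open>Square linear systems depending on a parameter\<close>

text \<open>The index set is arbitrary, because the unknowns will be the entries of a matrix whose zero pattern
is prescribed.\<close>

definition nonsing :: "'i set \<Rightarrow> ('i \<Rightarrow> 'i \<Rightarrow> 'k::field) \<Rightarrow> bool" where
  "nonsing I M \<longleftrightarrow> (\<forall>x. (\<forall>i\<in>I. (\<Sum>j\<in>I. M i j * x j) = 0) \<longrightarrow> (\<forall>j\<in>I. x j = 0))"

lemma nonsing_iff_det:
  assumes e: "bij_betw e {..<n} I"
  shows "nonsing I M \<longleftrightarrow> det (mat n n (\<lambda>(i, j). M (e i) (e j))) \<noteq> 0"
proof -
  let ?A = "mat n n (\<lambda>(i, j). M (e i) (e j))"
  have sum: "(\<Sum>j\<in>I. M i j * x j) = (\<Sum>j<n. M i (e j) * x (e j))" for i x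
    using sum.reindex_bij_betw[OF e, of "\<lambda>j. M i j * x j"] by simp
  have ij: "(?A *\<^sub>v v) $ i = (\<Sum>j<n. M (e i) (e j) * v $ j)" if "i < n" "v \<in> carrier_vec n" for i v
    using that by (auto simp: scalar_prod_def atLeast0LessThan)
  have I: "I = e ` {..<n}" using e by (auto simp: bij_betw_def)
  have inj: "inj_on e {..<n}" using e by (auto simp: bij_betw_def)
  have "det ?A = 0 \<longleftrightarrow> (\<exists>v. v \<in> carrier_vec n \<and> v \<noteq> 0\<^sub>v n \<and> ?A *\<^sub>v v = 0\<^sub>v n)"
    by (rule det_0_iff_vec_prod_zero) auto
  also have "\<dots> \<longleftrightarrow> \<not> nonsing I M"
  proof
    assume "\<exists>v. v \<in> carrier_vec n \<and> v \<noteq> 0\<^sub>v n \<and> ?A *\<^sub>v v = 0\<^sub>v n"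
    then obtain v where v: "v \<in> carrier_vec n" "v \<noteq> 0\<^sub>v n" "?A *\<^sub>v v = 0\<^sub>v n" by blast
    let ?x = "\<lambda>i. v $ (the_inv_into {..<n} e i)"
    have x: "?x (e j) = v $ j" if "j < n" for j
      using the_inv_into_f_f[OF inj] that by auto
    have "(\<Sum>j<n. M (e i) (e j) * v $ j) = 0" if "i < n" for i
      using ij[OF that v(1)] v(3) that by simp
    then have "\<forall>i\<in>I. (\<Sum>j\<in>I. M i j * ?x j) = 0"
      unfolding sum unfolding I using x by auto
    moreover have "\<exists>j\<in>I. ?x j \<noteq> 0"
    proof -
      obtain j where "j < n" "v $ j \<noteq> 0"
        using v(1,2) by (metis carrier_vecD eq_vecI index_zero_vec)
      then show ?thesis using x I by auto
    qed
    ultimately show "\<not> nonsing I M" by (auto simp: nonsing_def)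
  next
    assume "\<not> nonsing I M"
    then obtain x j where x: "\<forall>i\<in>I. (\<Sum>j\<in>I. M i j * x j) = 0" and j: "j \<in> I" "x j \<noteq> 0"
      by (auto simp: nonsing_def)
    let ?v = "vec n (\<lambda>j. x (e j))"
    have "?A *\<^sub>v ?v = 0\<^sub>v n"
    proof (rule eq_vecI)
      fix i assume "i < dim_vec (0\<^sub>v n :: 'b vec)"
      then have i: "i < n" by simp
      have "(?A *\<^sub>v ?v) $ i = (\<Sum>j<n. M (e i) (e j) * ?v $ j)" by (rule ij) (use i in auto)
      also have "\<dots> = (\<Sum>j\<in>I. M (e i) j * x j)" unfolding sum by auto
      also have "\<dots> = 0" using x I i by auto
      finally show "(?A *\<^sub>v ?v) $ i = 0\<^sub>v n $ i" using i by simp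
    qed auto
    moreover obtain k where "k < n" "e k = j" using j I by auto
    then have "?v $ k \<noteq> 0\<^sub>v n $ k" using j by simp
    then have "?v \<noteq> 0\<^sub>v n" by metis
    ultimately show "\<exists>v. v \<in> carrier_vec n \<and> v \<noteq> 0\<^sub>v n \<and> ?A *\<^sub>v v = 0\<^sub>v n" by (intro exI[of _ ?v]) auto
  qed
  finally show ?thesis by blast
qed

text \<open>The determinant of the pencil is a polynomial in \<open>s\<close> that does not vanish at 0.\<close>

lemma finite_singular_pencil:
  fixes M0 M1 :: "'i \<Rightarrow> 'i \<Rightarrow> 'k::field"
  assumes "finite I" "nonsing I M0"
  shows "finite {s. \<not> nonsing I (\<lambda>i j. M0 i j + s * M1 i j)}"
proof -
  obtain e where e: "bij_betw e {..<card I} I"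
    using assms(1) ex_bij_betw_nat_finite[of I] by (auto simp: atLeast0LessThan)
  let ?n = "card I"
  define A :: "'k poly mat" where "A = mat ?n ?n (\<lambda>(i, j). [: M0 (e i) (e j), M1 (e i) (e j) :])"
  have ev: "poly (det A) s = det (mat ?n ?n (\<lambda>(i, j). M0 (e i) (e j) + s * M1 (e i) (e j)))" for s
  proof -
    interpret h: comm_ring_hom "\<lambda>p. poly p s" by (unfold_locales) auto
    have "poly (det A) s = det (map_mat (\<lambda>p. poly p s) A)" by simp
    also have "map_mat (\<lambda>p. poly p s) A = mat ?n ?n (\<lambda>(i, j). M0 (e i) (e j) + s * M1 (e i) (e j))"
      by (rule eq_matI) (auto simp: A_def)
    finally show ?thesis .
  qed
  have "poly (det A) 0 \<noteq> 0"
    unfolding ev using assms(2) nonsing_iff_det[OF e, of M0] by simp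
  then have "finite {s. poly (det A) s = 0}" by (intro poly_roots_finite) auto
  then show ?thesis unfolding nonsing_iff_det[OF e] ev by simp
qed

lemma nonsing_inverse:
  fixes M :: "'i \<Rightarrow> 'i \<Rightarrow> 'k::field"
  assumes "finite I" "nonsing I M"
  obtains N where "\<And>i j. i \<in> I \<Longrightarrow> j \<in> I \<Longrightarrow> (\<Sum>k\<in>I. M i k * N k j) = (if i = j then 1 else 0)"
    and "\<And>i j. i \<in> I \<Longrightarrow> j \<in> I \<Longrightarrow> (\<Sum>k\<in>I. N i k * M k j) = (if i = j then 1 else 0)"
proof -
  obtain e where e: "bij_betw e {..<card I} I"
    using assms(1) ex_bij_betw_nat_finite[of I] by (auto simp: atLeast0LessThan)
  let ?n = "card I"
  let ?A = "mat ?n ?n (\<lambda>(i, j). M (e i) (e j))"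
  let ?g = "the_inv_into {..<?n} e"
  have inj: "inj_on e {..<?n}" and I: "I = e ` {..<?n}" using e by (auto simp: bij_betw_def)
  have g: "?g (e j) = j" if "j < ?n" for j using the_inv_into_f_f[OF inj] that by auto
  have "det ?A \<noteq> 0" using assms(2) nonsing_iff_det[OF e, of M] by simp
  then have "?A \<in> Units (ring_mat TYPE('k) ?n ?n)"
    by (intro det_non_zero_imp_unit) auto
  then obtain B where B: "B \<in> carrier_mat ?n ?n" "B * ?A = 1\<^sub>m ?n" "?A * B = 1\<^sub>m ?n"
    unfolding Units_def by (auto simp: ring_mat_def)
  let ?N = "\<lambda>i j. B $$ (?g i, ?g j)"
  have s: "(\<Sum>k\<in>I. f k) = (\<Sum>k<?n. f (e k))" for f :: "'i \<Rightarrow> 'k"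
    using sum.reindex_bij_betw[OF e, of f] by simp
  have 1: "(\<Sum>k\<in>I. M i k * ?N k j) = (if i = j then 1 else 0)" if ij: "i \<in> I" "j \<in> I" for i j
  proof -
    obtain i' j' where i': "i' < ?n" "e i' = i" and j': "j' < ?n" "e j' = j" using ij I by (metis imageE lessThan_iff)
    have "(\<Sum>k\<in>I. M i k * ?N k j) = (?A * B) $$ (i', j')"
      unfolding s using i' j' B(1) g by (auto simp: scalar_prod_def atLeast0LessThan)
    also have "\<dots> = (if i = j then 1 else 0)"
      unfolding B(3) using i' j' inj by (auto simp: inj_on_def)
    finally show ?thesis .
  qed
  have 2: "(\<Sum>k\<in>I. ?N i k * M k j) = (if i = j then 1 else 0)" if ij: "i \<in> I" "j \<in> I" for i j
  proof -
    obtain i' j' where i': "i' < ?n" "e i' = i" and j': "j' < ?n" "e j' = j" using ij I by (metis imageE lessThan_iff)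
    have "(\<Sum>k\<in>I. ?N i k * M k j) = (B * ?A) $$ (i', j')"
      unfolding s using i' j' B(1) g by (auto simp: scalar_prod_def atLeast0LessThan)
    also have "\<dots> = (if i = j then 1 else 0)"
      unfolding B(2) using i' j' inj by (auto simp: inj_on_def)
    finally show ?thesis .
  qed
  show thesis using 1 2 that[of ?N] by simp
qed

section \<open>Commutator forms on matrix algebras given by a preorder\<close>

text \<open>Matrices are functions here: the index sets of the contracted algebras are not initial segments of
the naturals, and no size has to be carried along.\<close>

type_synonym 'k kmat = "nat \<Rightarrow> nat \<Rightarrow> 'k"

definition mmul :: "nat set \<Rightarrow> 'k::comm_ring_1 kmat \<Rightarrow> 'k kmat \<Rightarrow> 'k kmat" where
  "mmul P x y = (\<lambda>i j. \<Sum>k\<in>P. x i k * y k j)"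

definition mtrace :: "nat set \<Rightarrow> 'k::comm_ring_1 kmat \<Rightarrow> 'k" where
  "mtrace P x = (\<Sum>i\<in>P. x i i)"

definition mcomm :: "nat set \<Rightarrow> 'k::comm_ring_1 kmat \<Rightarrow> 'k kmat \<Rightarrow> 'k kmat" where
  "mcomm P x y = mmul P x y - mmul P y x"

definition supported :: "(nat \<times> nat) set \<Rightarrow> 'k::comm_ring_1 kmat \<Rightarrow> bool" where
  "supported R x \<longleftrightarrow> (\<forall>i j. (i, j) \<notin> R \<longrightarrow> x i j = 0)"

definition munit :: "nat \<Rightarrow> nat \<Rightarrow> 'k::comm_ring_1 kmat" where
  "munit k l = (\<lambda>i j. if i = k \<and> j = l then 1 else 0)"

definition mscalar :: "nat set \<Rightarrow> 'k::comm_ring_1 \<Rightarrow> 'k kmat" where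
  "mscalar P c = (\<lambda>i j. if i = j \<and> i \<in> P then c else 0)"

text \<open>The form \<open>f (x y - y x)\<close> for \<open>f z = tr (H z)\<close>. Every linear form on a subspace of the matrix
algebra is given by some \<open>H\<close>.\<close>

definition bform :: "nat set \<Rightarrow> 'k::comm_ring_1 kmat \<Rightarrow> 'k kmat \<Rightarrow> 'k kmat \<Rightarrow> 'k" where
  "bform P H x y = mtrace P (mmul P H (mcomm P x y))"

definition radical :: "nat set \<Rightarrow> (nat \<times> nat) set \<Rightarrow> 'k::comm_ring_1 kmat \<Rightarrow> 'k kmat set" where
  "radical P R H = {x. supported R x \<and> (\<forall>y. supported R y \<longrightarrow> bform P H x y = 0)}"

text \<open>The scalar matrices always lie in the radical, so this is nondegeneracy modulo scalars.\<close>

definition nondeg :: "nat set \<Rightarrow> (nat \<times> nat) set \<Rightarrow> 'k::comm_ring_1 kmat \<Rightarrow> bool" where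
  "nondeg P R H \<longleftrightarrow> (\<forall>x\<in>radical P R H. \<exists>c. x = mscalar P c)"

definition frob_pattern :: "'k::field itself \<Rightarrow> nat set \<Rightarrow> (nat \<times> nat) set \<Rightarrow> bool" where
  "frob_pattern ty P R \<longleftrightarrow> (\<exists>H :: 'k kmat. nondeg P R H)"

lemma mmul_assoc: "mmul P (mmul P x y) z = mmul P x (mmul P y z)"
  unfolding mmul_def
  apply (intro ext)
  apply (simp add: sum_distrib_left sum_distrib_right mult.assoc)
  apply (rule sum.swap)
  done

lemma mmul_diff_left: "mmul P (x - y) z = mmul P x z - mmul P y z"
  by (intro ext) (simp add: mmul_def algebra_simps sum_subtractf)

lemma mmul_diff_right: "mmul P z (x - y) = mmul P z x - mmul P z y"
  by (intro ext) (simp add: mmul_def algebra_simps sum_subtractf)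

lemma mmul_add_left: "mmul P (x + y) z = mmul P x z + mmul P y z"
  by (intro ext) (simp add: mmul_def algebra_simps sum.distrib)

lemma mmul_add_right: "mmul P z (x + y) = mmul P z x + mmul P z y"
  by (intro ext) (simp add: mmul_def algebra_simps sum.distrib)

lemma mtrace_diff: "mtrace P (x - y) = mtrace P x - mtrace P y"
  by (simp add: mtrace_def sum_subtractf)

lemma mtrace_add: "mtrace P (x + y) = mtrace P x + mtrace P y"
  by (simp add: mtrace_def sum.distrib)

lemma mtrace_mmul_commute: "mtrace P (mmul P x y) = mtrace P (mmul P y x)"
  unfolding mtrace_def mmul_def by (subst sum.swap) (simp add: mult.commute)

text \<open>Invariance of the trace. It turns membership of \<open>x\<close> in the radical into the vanishing of certain
entries of \<open>H x - x H\<close>.\<close>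

lemma bform_mcomm: "bform P H x y = mtrace P (mmul P (mcomm P H x) y)"
proof -
  have "mtrace P (mmul P H (mmul P y x)) = mtrace P (mmul P (mmul P x H) y)"
    by (metis mmul_assoc mtrace_mmul_commute)
  then show ?thesis
    by (simp add: bform_def mcomm_def mmul_diff_right mmul_diff_left mtrace_diff mmul_assoc)
qed

lemma bform_sum: "bform P H x y = (\<Sum>i\<in>P. \<Sum>j\<in>P. mcomm P H x j i * y i j)"
  unfolding bform_mcomm mtrace_def mmul_def by (rule sum.swap)

lemma bform_commute: "bform P H y x = - bform P H x y"
  by (simp add: bform_def mcomm_def mmul_diff_right mtrace_diff)

lemma mcomm_add_right: "mcomm P H (x + y) = mcomm P H x + mcomm P H y"
  by (simp add: mcomm_def mmul_add_left mmul_add_right)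

lemma bform_add_left: "bform P H (x + y) z = bform P H x z + bform P H y z"
  by (simp add: bform_mcomm mcomm_add_right mmul_add_left mtrace_add)

lemma bform_add_right: "bform P H z (x + y) = bform P H z x + bform P H z y"
  by (simp add: bform_mcomm mmul_add_right mtrace_add)

lemma bform_munit:
  assumes "finite P" "k \<in> P" "l \<in> P"
  shows "bform P H x (munit k l) = mcomm P H x l k"
proof -
  have "bform P H x (munit k l) = (\<Sum>i\<in>P. if i = k then (\<Sum>j\<in>P. if j = l then mcomm P H x j i else 0) else 0)"
    unfolding bform_sum munit_def by (intro sum.cong refl) (auto intro!: sum.cong)
  then show ?thesis using assms by simp
qed

lemma bform_zero_if_entries:
  assumes "supported S y" "\<And>k l. (k, l) \<in> S \<Longrightarrow> mcomm P H x l k = 0"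
  shows "bform P H x y = 0"
proof -
  have "mcomm P H x j i * y i j = 0" for i j using assms by (cases "(i, j) \<in> S") (auto simp: supported_def)
  then show ?thesis unfolding bform_sum by simp
qed

lemma supported_munit: "(k, l) \<in> R \<Longrightarrow> supported R (munit k l)"
  by (auto simp: supported_def munit_def)

lemma radical_iff:
  assumes "finite P" "R \<subseteq> P \<times> P"
  shows "x \<in> radical P R H \<longleftrightarrow> supported R x \<and> (\<forall>k l. (k, l) \<in> R \<longrightarrow> mcomm P H x l k = 0)"
proof
  assume x: "x \<in> radical P R H"
  have "mcomm P H x l k = 0" if "(k, l) \<in> R" for k l
  proof -
    have "bform P H x (munit k l) = 0" using x supported_munit[OF that] by (auto simp: radical_def)
    moreover have "k \<in> P" "l \<in> P" using assms(2) that by auto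
    ultimately show ?thesis using bform_munit[OF assms(1)] by metis
  qed
  then show "supported R x \<and> (\<forall>k l. (k, l) \<in> R \<longrightarrow> mcomm P H x l k = 0)"
    using x by (auto simp: radical_def)
qed (auto simp: radical_def intro: bform_zero_if_entries)

lemma supported_add: "supported R x \<Longrightarrow> supported R y \<Longrightarrow> supported R (x + y)"
  and supported_diff: "supported R x \<Longrightarrow> supported R y \<Longrightarrow> supported R (x - y)"
  by (auto simp: supported_def)

lemma supported_mono: "supported R x \<Longrightarrow> R \<subseteq> S \<Longrightarrow> supported S x"
  by (auto simp: supported_def)

lemma mmul_mscalar_left:
  assumes "finite P" "supported (P \<times> P) x"
  shows "mmul P (mscalar P c) x = (\<lambda>i j. c * x i j)"
proof (intro ext)
  fix i j
  have "(\<Sum>k\<in>P. mscalar P c i k * x k j) = (\<Sum>k\<in>P. if k = i then c * x i j else 0)"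
    by (intro sum.cong) (auto simp: mscalar_def)
  then show "mmul P (mscalar P c) x i j = c * x i j"
    using assms by (auto simp: mmul_def supported_def)
qed

lemma mmul_mscalar_right:
  assumes "finite P" "supported (P \<times> P) x"
  shows "mmul P x (mscalar P c) = (\<lambda>i j. c * x i j)"
proof (intro ext)
  fix i j
  have "(\<Sum>k\<in>P. x i k * mscalar P c k j) = (\<Sum>k\<in>P. if k = j then c * x i j else 0)"
    by (intro sum.cong) (auto simp: mscalar_def)
  then show "mmul P x (mscalar P c) i j = c * x i j"
    using assms by (auto simp: mmul_def supported_def)
qed

lemma mcomm_mscalar_entry:
  assumes "finite P" "i \<in> P" "j \<in> P"
  shows "mcomm P H (mscalar P c) i j = 0"
proof -
  have "(\<Sum>k\<in>P. H i k * mscalar P c k j) = (\<Sum>k\<in>P. if k = j then H i j * c else 0)"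
    by (intro sum.cong) (auto simp: mscalar_def)
  moreover have "(\<Sum>k\<in>P. mscalar P c i k * H k j) = (\<Sum>k\<in>P. if k = i then H i j * c else 0)"
    using assms by (intro sum.cong) (auto simp: mscalar_def)
  ultimately show ?thesis using assms by (simp add: mcomm_def mmul_def)
qed

lemma mcomm_expand:
  assumes "finite P" "I \<subseteq> P \<times> P" "supported I x" "l \<in> P" "k \<in> P"
  shows "mcomm P H x l k = (\<Sum>q\<in>I. mcomm P H (munit (fst q) (snd q)) l k * x (fst q) (snd q))"
proof -
  have e: "mcomm P H (munit i j) l k = (if j = k then H l i else 0) - (if i = l then H j k else 0)"
    if "i \<in> P" "j \<in> P" for i j
  proof -
    have "(\<Sum>m\<in>P. H l m * munit i j m k) = (\<Sum>m\<in>P. if m = i then (if j = k then H l i else 0) else 0)"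
      by (intro sum.cong) (auto simp: munit_def)
    moreover have "(\<Sum>m\<in>P. munit i j l m * H m k) = (\<Sum>m\<in>P. if m = j then (if i = l then H j k else 0) else 0)"
      by (intro sum.cong) (auto simp: munit_def)
    ultimately show ?thesis using assms(1) that by (simp add: mcomm_def mmul_def)
  qed
  have "(\<Sum>q\<in>I. mcomm P H (munit (fst q) (snd q)) l k * x (fst q) (snd q))
      = (\<Sum>q\<in>P \<times> P. mcomm P H (munit (fst q) (snd q)) l k * x (fst q) (snd q))"
    by (rule sum.mono_neutral_left) (use assms in \<open>auto simp: supported_def\<close>)
  also have "\<dots> = (\<Sum>i\<in>P. \<Sum>j\<in>P. mcomm P H (munit i j) l k * x i j)"
    by (simp add: sum.cartesian_product case_prod_unfold)
  also have "\<dots> = (\<Sum>i\<in>P. \<Sum>j\<in>P. (if j = k then H l i * x i j else 0) - (if i = l then x i j * H j k else 0))"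
    by (intro sum.cong refl) (auto simp: e algebra_simps)
  also have "\<dots> = (\<Sum>i\<in>P. \<Sum>j\<in>P. if j = k then H l i * x i j else 0)
      - (\<Sum>i\<in>P. \<Sum>j\<in>P. if i = l then x i j * H j k else 0)"
    by (simp add: sum_subtractf)
  also have "(\<Sum>i\<in>P. \<Sum>j\<in>P. if j = k then H l i * x i j else 0) = (\<Sum>i\<in>P. H l i * x i k)"
    using assms by (intro sum.cong refl) simp
  also have "(\<Sum>i\<in>P. \<Sum>j\<in>P. if i = l then x i j * H j k else 0) = (\<Sum>j\<in>P. x l j * H j k)"
    using assms by (subst sum.swap) (simp cong: if_cong)
  finally show ?thesis by (simp add: mcomm_def mmul_def)
qed

lemma mscalar_in_radical:
  assumes "finite P" "R \<subseteq> P \<times> P" "\<forall>i\<in>P. (i, i) \<in> R"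
  shows "mscalar P c \<in> radical P R H"
proof -
  have "supported R (mscalar P c)" using assms(3) by (auto simp: supported_def mscalar_def)
  moreover have "mcomm P H (mscalar P c) l k = 0" if "(k, l) \<in> R" for k l
  proof -
    have "k \<in> P" "l \<in> P" using that assms(2) by auto
    then show ?thesis by (simp add: mcomm_mscalar_entry assms(1))
  qed
  ultimately show ?thesis using radical_iff[OF assms(1,2), of "mscalar P c" H] by simp
qed

text \<open>Subtracting a scalar matrix one may assume that \<open>x\<close> vanishes at \<open>(p, p)\<close>. The equation at that
position can be dropped as well, because \<open>H x - x H\<close> has trace zero; what remains is a square
system.\<close>

lemma nondeg_iff_nonsing:
  fixes H :: "'k::field kmat"
  assumes P: "finite P" "R \<subseteq> P \<times> P" "\<forall>i\<in>P. (i, i) \<in> R" and p: "p \<in> P"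
  shows "nondeg P R H \<longleftrightarrow>
    nonsing (R - {(p, p)}) (\<lambda>q q'. mcomm P H (munit (fst q') (snd q')) (snd q) (fst q))"
    (is "_ \<longleftrightarrow> nonsing ?I ?M")
proof -
  have I: "?I \<subseteq> P \<times> P" using P by auto
  have R: "finite R" using P finite_subset by blast
  show ?thesis
  proof
    assume nd: "nondeg P R H"
    show "nonsing ?I ?M" unfolding nonsing_def
    proof (intro allI impI ballI)
      fix x q assume x: "\<forall>q\<in>?I. (\<Sum>q'\<in>?I. ?M q q' * x q') = 0" and q: "q \<in> ?I"
      define X where X: "X i j = (if (i, j) \<in> ?I then x (i, j) else 0)" for i j
      have sX: "supported ?I X" unfolding supported_def by (intro allI impI) (simp only: X if_False)
      have XX: "X (fst q) (snd q) = x q" if "q \<in> ?I" for q using that unfolding X by simp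
      have c0: "mcomm P H X l k = 0" if "(k, l) \<in> ?I" for k l
      proof -
        have "mcomm P H X l k = (\<Sum>q'\<in>?I. ?M (k, l) q' * x q')"
        proof -
          have "mcomm P H X l k = (\<Sum>q'\<in>?I. ?M (k, l) q' * X (fst q') (snd q'))"
            using that I by (subst mcomm_expand[OF P(1) I sX]) auto
          also have "\<dots> = (\<Sum>q'\<in>?I. ?M (k, l) q' * x q')"
            by (intro sum.cong refl) (simp only: XX)
          finally show ?thesis .
        qed
        then show ?thesis using bspec[OF x that] by simp
      qed
      have "mtrace P (mcomm P H X) = 0"
        by (simp add: mcomm_def mtrace_diff mtrace_mmul_commute)
      then have "mcomm P H X p p = - (\<Sum>i\<in>P - {p}. mcomm P H X i i)"
        using P(1) p by (simp add: mtrace_def sum.remove[of P p] eq_neg_iff_add_eq_0)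
      also have "\<dots> = 0" using c0 P(3) by (auto intro!: sum.neutral)
      finally have "mcomm P H X p p = 0" .
      with c0 have "mcomm P H X l k = 0" if "(k, l) \<in> R" for k l
        using that by (cases "(k, l) = (p, p)") auto
      then have "X \<in> radical P R H"
        using radical_iff[OF P(1,2), of X H] supported_mono[OF sX Diff_subset] by simp
      then obtain c where c: "X = mscalar P c" using nd by (auto simp: nondeg_def)
      have "c = X p p" using c p by (simp add: mscalar_def)
      then have "c = 0" by (simp add: X)
      then have "X (fst q) (snd q) = 0" using c by (simp add: mscalar_def)
      moreover have "X (fst q) (snd q) = x q" using q unfolding X by simp
      ultimately show "x q = 0" by simp
    qed
  next
    assume ns: "nonsing ?I ?M"
    show "nondeg P R H" unfolding nondeg_def
    proof
      fix x assume x: "x \<in> radical P R H"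
      define y where "y = x + mscalar P (- x p p)"
      have "y \<in> radical P R H"
        using x mscalar_in_radical[OF P, of "- x p p" H]
        by (auto simp: radical_def y_def bform_add_left intro: supported_add)
      then have sy: "supported R y" and cy: "\<And>k l. (k, l) \<in> R \<Longrightarrow> mcomm P H y l k = 0"
        using radical_iff[OF P(1,2), of y H] by auto
      have "y p p = 0" using p by (simp add: y_def mscalar_def)
      then have sI: "supported ?I y" using sy by (auto simp: supported_def)
      have "\<forall>q\<in>?I. (\<Sum>q'\<in>?I. ?M q q' * y (fst q') (snd q')) = 0"
      proof
        fix q assume q: "q \<in> ?I"
        then have "mcomm P H y (snd q) (fst q) = (\<Sum>q'\<in>?I. ?M q q' * y (fst q') (snd q'))"
          using I by (subst mcomm_expand[OF P(1) I sI]) (auto intro!: sum.cong)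
        then show "(\<Sum>q'\<in>?I. ?M q q' * y (fst q') (snd q')) = 0" using cy q by (cases q) auto
      qed
      then have yI: "\<forall>q'\<in>?I. y (fst q') (snd q') = 0"
        by (rule ns[unfolded nonsing_def, THEN spec, of "\<lambda>q. y (fst q) (snd q)", THEN mp])
      have "y i j = 0" if "(i, j) \<in> ?I" for i j using bspec[OF yI that] by (simp only: fst_conv snd_conv)
      then have y0: "y i j = 0" for i j using sI unfolding supported_def by blast
      have "x i j = mscalar P (x p p) i j" for i j
        using y0[of i j] by (auto simp: y_def mscalar_def split: if_splits)
      then have "x = mscalar P (x p p)" by (intro ext)
      then show "\<exists>c. x = mscalar P c" by blast
    qed
  qed
qed

text \<open>Nondegeneracy is an open condition: on a line of forms it fails at finitely many points only.\<close>

lemma nondeg_perturb: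
  fixes H :: "'k::field kmat"
  assumes P: "finite P" "R \<subseteq> P \<times> P" "\<forall>i\<in>P. (i, i) \<in> R" and nd: "nondeg P R H"
  shows "finite {s. \<not> nondeg P R (\<lambda>i j. H i j + s * H1 i j)}"
proof (cases "P = {}")
  case True
  have "x = mscalar P c" if "x \<in> radical P R G" for x c and G :: "'k kmat"
  proof (intro ext)
    fix i j show "x i j = mscalar P c i j"
      using that P(2) True by (auto simp: radical_def supported_def mscalar_def)
  qed
  then have "nondeg P R G" for G :: "'k kmat" by (auto simp: nondeg_def)
  then show ?thesis by simp
next
  case False
  then obtain p where p: "p \<in> P" by blast
  let ?I = "R - {(p, p)}"
  have "mcomm P (\<lambda>i j. H i j + s * H1 i j) x l k = mcomm P H x l k + s * mcomm P H1 x l k" for s x l k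
    by (simp add: mcomm_def mmul_def algebra_simps sum.distrib sum_distrib_left)
  moreover have "finite {s. \<not> nonsing ?I (\<lambda>q q'. mcomm P H (munit (fst q') (snd q')) (snd q) (fst q)
      + s * mcomm P H1 (munit (fst q') (snd q')) (snd q) (fst q))}"
    by (rule finite_singular_pencil) (use nd nondeg_iff_nonsing[OF P p] P finite_subset[OF P(2)] in auto)
  ultimately show ?thesis unfolding nondeg_iff_nonsing[OF P p] by simp
qed

lemma supported_mmul:
  assumes "trans R" "supported R x" "supported R y"
  shows "supported R (mmul P x y)"
  unfolding supported_def mmul_def
proof (intro allI impI sum.neutral ballI)
  fix i j k assume "(i, j) \<notin> R"
  then have "(i, k) \<notin> R \<or> (k, j) \<notin> R" using assms(1) by (meson transD)
  then show "x i k * y k j = 0" using assms(2,3) by (auto simp: supported_def)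
qed

lemma nondeg_conjugate:
  fixes H :: "'k::field kmat"
  assumes P: "finite P" "R \<subseteq> P \<times> P" "trans R"
    and u: "supported R u" and v: "supported R v"
    and uv: "mmul P u v = mscalar P 1" and vu: "mmul P v u = mscalar P 1"
    and nd: "nondeg P R H"
  shows "nondeg P R (mmul P v (mmul P H u))"
  unfolding nondeg_def
proof
  fix x assume x: "x \<in> radical P R (mmul P v (mmul P H u))"
  have s: "supported R x" using x by (simp add: radical_def)
  have PP: "supported (P \<times> P) y" if "supported R y" for y :: "'k kmat"
    using supported_mono[OF that P(2)] .
  have l: "mmul P (mscalar P 1) y = y" and r: "mmul P y (mscalar P 1) = y" if "supported R y" for y :: "'k kmat"
    using mmul_mscalar_left[OF P(1) PP[OF that], of 1] mmul_mscalar_right[OF P(1) PP[OF that], of 1] by simp_all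
  let ?x = "mmul P u (mmul P x v)"
  have sx: "supported R ?x" by (intro supported_mmul P s u v)
  have "bform P H ?x y = 0" if y: "supported R y" for y
  proof -
    let ?y = "mmul P v (mmul P y u)"
    have sy: "supported R ?y" by (intro supported_mmul P u v y)
    have "mmul P u (mmul P (mcomm P x ?y) v) = mcomm P ?x y"
    proof -
      have "mmul P u (mmul P (mmul P x ?y) v) = mmul P u (mmul P x (mmul P v (mmul P y (mmul P u v))))"
        by (simp add: mmul_assoc)
      also have "\<dots> = mmul P ?x y" using uv r[OF y] by (simp add: mmul_assoc)
      finally have 1: "mmul P u (mmul P (mmul P x ?y) v) = mmul P ?x y" .
      have "mmul P u (mmul P (mmul P ?y x) v) = mmul P (mmul P u v) (mmul P y (mmul P u (mmul P x v)))"
        by (simp add: mmul_assoc)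
      also have "\<dots> = mmul P y ?x" using uv l[OF supported_mmul[OF P(3) y sx]] by simp
      finally have 2: "mmul P u (mmul P (mmul P ?y x) v) = mmul P y ?x" .
      show ?thesis using 1 2 by (simp add: mcomm_def mmul_diff_left mmul_diff_right)
    qed
    then have "bform P H ?x y = mtrace P (mmul P H (mmul P u (mmul P (mcomm P x ?y) v)))"
      by (simp add: bform_def)
    also have "\<dots> = mtrace P (mmul P (mmul P H (mmul P u (mcomm P x ?y))) v)" by (simp add: mmul_assoc)
    also have "\<dots> = mtrace P (mmul P v (mmul P H (mmul P u (mcomm P x ?y))))" by (rule mtrace_mmul_commute)
    also have "\<dots> = bform P (mmul P v (mmul P H u)) x ?y" by (simp add: bform_def mmul_assoc)
    also have "\<dots> = 0" using x sy by (simp add: radical_def)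
    finally show ?thesis .
  qed
  then have "?x \<in> radical P R H" using sx by (simp add: radical_def)
  then obtain c where c: "?x = mscalar P c" using nd by (auto simp: nondeg_def)
  have "x = mmul P (mmul P v u) (mmul P x (mmul P v u))" using l[OF s] r[OF s] vu by simp
  also have "\<dots> = mmul P v (mmul P ?x u)" by (simp add: mmul_assoc)
  also have "\<dots> = mscalar P c"
  proof (intro ext)
    fix i j
    have "mmul P v (mmul P ?x u) i j = (\<Sum>k\<in>P. v i k * (c * u k j))"
      unfolding c mmul_mscalar_left[OF P(1) PP[OF u]] by (simp add: mmul_def)
    also have "\<dots> = c * mmul P v u i j"
      by (simp add: mmul_def sum_distrib_left mult.left_commute)
    also have "\<dots> = mscalar P c i j" unfolding vu by (cases "i = j \<and> i \<in> P") (auto simp: mscalar_def)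
    finally show "mmul P v (mmul P ?x u) i j = mscalar P c i j" .
  qed
  finally show "\<exists>c. x = mscalar P c" by blast
qed

lemma nondeg_cong:
  assumes P: "finite P" "R \<subseteq> P \<times> P" "trans R" and eq: "\<And>i j. (i, j) \<in> R \<Longrightarrow> H j i = G j i"
  shows "nondeg P R H = nondeg P R G"
proof -
  have "bform P H x y = bform P G x y" if "supported R x" "supported R y" for x y
  proof -
    have s: "supported R (mcomm P x y)"
      unfolding mcomm_def by (intro supported_diff supported_mmul P that)
    have "H j i * mcomm P x y i j = G j i * mcomm P x y i j" for i j
      using s eq by (cases "(i, j) \<in> R") (auto simp: supported_def)
    then show ?thesis by (simp add: bform_def mtrace_def mmul_def)
  qed
  then have "radical P R H = radical P R G" by (auto simp: radical_def)
  then show ?thesis by (simp add: nondeg_def)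
qed

section \<open>Contraction along an abelian ideal\<close>

text \<open>The positions of the first part of the composition with the smaller first part are \<open>V0 \<union> V1\<close>, those of
the first part of the other composition are \<open>V0 \<union> V1 \<union> W0 \<union> W1\<close>, and \<open>Z\<close> are the remaining ones.
The matrices with support in \<open>(V0 \<union> V1) \<times> (W0 \<union> W1)\<close> form the abelian ideal. The form on it
will be the pairing of \<open>V1\<close> with \<open>W1\<close> along \<open>\<tau>\<close>; this has maximal rank because one of
\<open>V0\<close> and \<open>W0\<close> is empty. The contracted algebra has the positions of \<open>V1\<close> removed, and it has lost
the entries in \<open>W0 \<times> W1\<close>.\<close>

locale ideal_contraction =
  fixes P :: "nat set" and R :: "(nat \<times> nat) set" and V0 V1 W0 W1 Z :: "nat set" and \<tau> :: "nat \<Rightarrow> nat"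
  assumes fin: "finite P"
    and part: "P = V0 \<union> V1 \<union> W0 \<union> W1 \<union> Z"
    and disj: "V0 \<inter> V1 = {}" "V0 \<inter> W0 = {}" "V0 \<inter> W1 = {}" "V0 \<inter> Z = {}" "V1 \<inter> W0 = {}"
      "V1 \<inter> W1 = {}" "V1 \<inter> Z = {}" "W0 \<inter> W1 = {}" "W0 \<inter> Z = {}" "W1 \<inter> Z = {}"
    and RP: "R \<subseteq> P \<times> P" and Rrefl: "\<forall>i\<in>P. (i, i) \<in> R" and Rtrans: "trans R"
    and \<tau>: "bij_betw \<tau> V1 W1"
    and VV: "(V0 \<union> V1) \<times> (V0 \<union> V1) \<subseteq> R"
    and VW: "(V0 \<union> V1) \<times> (W0 \<union> W1) \<subseteq> R"
    and WW: "W0 \<times> W1 \<subseteq> R"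
    and noYV: "((W0 \<union> W1 \<union> Z) \<times> (V0 \<union> V1)) \<inter> R = {}"
    and noVZ: "((V0 \<union> V1) \<times> Z) \<inter> R = {}"
    and noWZ: "((W0 \<union> W1) \<times> Z) \<inter> R = {}"
    and V0W0: "V0 = {} \<or> W0 = {}"
begin

abbreviation "V \<equiv> V0 \<union> V1"
abbreviation "W \<equiv> W0 \<union> W1"
abbreviation "Y \<equiv> W0 \<union> W1 \<union> Z"

definition \<sigma> where "\<sigma> = inv_into V1 \<tau>"

lemma \<tau>_W1: "r \<in> V1 \<Longrightarrow> \<tau> r \<in> W1"
  using \<tau> by (auto simp: bij_betw_def)

lemma \<sigma>_\<tau>: "r \<in> V1 \<Longrightarrow> \<sigma> (\<tau> r) = r"
  using \<tau> unfolding \<sigma>_def by (metis bij_betw_def inv_into_f_f)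

lemma \<tau>_\<sigma>: "w \<in> W1 \<Longrightarrow> \<tau> (\<sigma> w) = w"
  using \<tau> unfolding \<sigma>_def by (metis bij_betw_def f_inv_into_f)

lemma \<sigma>_V1: "w \<in> W1 \<Longrightarrow> \<sigma> w \<in> V1"
  using \<tau> unfolding \<sigma>_def by (metis bij_betw_def inv_into_into)

definition "P' = V0 \<union> W0 \<union> W1 \<union> Z"
definition "R' = (R \<inter> P' \<times> P') - W0 \<times> W1"

text \<open>A matrix that is orthogonal to the ideal has equal blocks at \<open>V1\<close> and \<open>W1\<close>, so these positions are
identified.\<close>

definition merge :: "nat \<Rightarrow> nat" where "merge i = (if i \<in> V1 then \<tau> i else i)"
definition unmerge :: "nat \<Rightarrow> nat" where "unmerge i = (if i \<in> W1 then \<sigma> i else i)"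

lemma merge_simps: "i \<in> V1 \<Longrightarrow> merge i = \<tau> i" "i \<in> V0 \<Longrightarrow> merge i = i" "i \<in> Y \<Longrightarrow> merge i = i"
  using disj by (auto simp: merge_def)

lemma bij_merge: "bij_betw merge V (V0 \<union> W1)"
  by (rule bij_betwI[of _ _ _ unmerge])
    (use disj in \<open>auto simp: merge_def unmerge_def \<tau>_W1 \<sigma>_V1 \<tau>_\<sigma> \<sigma>_\<tau>\<close>)

lemma unmerge_merge: "i \<in> V \<Longrightarrow> unmerge (merge i) = i"
  using disj by (auto simp: merge_def unmerge_def \<tau>_W1 \<sigma>_V1 \<tau>_\<sigma> \<sigma>_\<tau>)

lemma merge_V: "i \<in> V \<Longrightarrow> merge i \<in> V0 \<union> W1"
  using disj by (auto simp: merge_def \<tau>_W1)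

lemmas P'_eq = P'_def

lemma P'_P: "P' \<subseteq> P" "V \<subseteq> P" "Y \<subseteq> P" "P' = P - V1"
  unfolding P'_def using part disj by blast+

lemma fin': "finite V0" "finite V1" "finite W0" "finite W1" "finite Z" "finite P'"
  using fin part unfolding P'_def by simp_all

lemma R'_P': "R' \<subseteq> P' \<times> P'" and R'_R: "R' \<subseteq> R"
  by (auto simp: R'_def)

lemma R'_refl: "\<forall>i\<in>P'. (i, i) \<in> R'"
proof
  fix i assume i: "i \<in> P'"
  then have "(i, i) \<in> R" using Rrefl P'_P(1) by blast
  moreover have "(i, i) \<notin> W0 \<times> W1" using disj(8) by blast
  ultimately show "(i, i) \<in> R'" using i unfolding R'_def by blast
qed

lemma R'_cases:
  assumes "(i, j) \<in> R'"
  shows "(i \<in> V0 \<and> j \<in> V0 \<union> W1) \<or> (i \<in> V0 \<and> j \<in> W0 \<and> W0 \<noteq> {}) \<or> (i \<in> Y \<and> j \<in> Y \<and> (i, j) \<notin> W0 \<times> W1)"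
proof -
  have ij: "i \<in> P'" "j \<in> P'" "(i, j) \<in> R" "(i, j) \<notin> W0 \<times> W1" using assms unfolding R'_def by blast+
  then have "\<not> (i \<in> Y \<and> j \<in> V0)" "\<not> (i \<in> V0 \<and> j \<in> Z)" using noYV noVZ by blast+
  then show ?thesis using ij(1,2,4) unfolding P'_eq by (metis Un_iff empty_iff)
qed

lemma R'_cases':
  assumes "(i, j) \<in> R'"
  shows "(i \<in> V0 \<and> j \<in> V0 \<union> W1) \<or> (i \<in> Y \<and> j \<in> Y \<and> (i, j) \<notin> W0 \<times> W1)"
  using R'_cases[OF assms] V0W0 by blast

lemma trans_R': "trans R'"
proof (rule transI)
  fix i j k assume ij: "(i, j) \<in> R'" and jk: "(j, k) \<in> R'"
  then have "(i, k) \<in> R" "i \<in> P'" "k \<in> P'" using Rtrans by (auto simp: R'_def dest: transD)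
  moreover have "(i, k) \<notin> W0 \<times> W1"
  proof
    assume ik: "(i, k) \<in> W0 \<times> W1"
    then have "i \<in> Y" "i \<notin> V0" using disj by blast+
    then have j: "j \<in> Y" "(i, j) \<notin> W0 \<times> W1" using R'_cases'[OF ij] by blast+
    then have "(j, k) \<notin> W0 \<times> W1" using R'_cases'[OF jk] disj by blast
    then have "j \<in> Z" using j ik by blast
    then show False using ij R'_R noWZ ik by blast
  qed
  ultimately show "(i, k) \<in> R'" by (auto simp: R'_def)
qed

text \<open>The embedding of the contracted algebra as a complement of the ideal in its orthogonal space: a
matrix goes to the block diagonal matrix formed by its compressions to \<open>V0 \<union> W1\<close>, carried over
to \<open>V0 \<union> V1\<close>, and to \<open>W0 \<union> W1 \<union> Z\<close>.\<close>

definition lift :: "'k::field kmat \<Rightarrow> 'k kmat" where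
  "lift z = (\<lambda>i j. if i \<in> V \<and> j \<in> V \<or> i \<in> Y \<and> j \<in> Y then z (merge i) (merge j) else 0)"

lemma lift_VV: "i \<in> V \<Longrightarrow> j \<in> V \<Longrightarrow> lift z i j = z (merge i) (merge j)"
  and lift_YY: "i \<in> Y \<Longrightarrow> j \<in> Y \<Longrightarrow> lift z i j = z i j"
  and lift_VY: "i \<in> V \<Longrightarrow> j \<in> Y \<Longrightarrow> lift z i j = 0"
  and lift_YV: "i \<in> Y \<Longrightarrow> j \<in> V \<Longrightarrow> lift z i j = 0"
  using disj merge_simps by (auto simp: lift_def)

lemma lift_outside: "i \<notin> P \<or> j \<notin> P \<Longrightarrow> lift z i j = 0"
  by (auto simp: lift_def part)

lemma lift_supported:
  assumes "supported R' z"
  shows "supported R (lift z)"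
  unfolding supported_def
proof (intro allI impI)
  fix i j assume ij: "(i, j) \<notin> R"
  then have "\<not> (i \<in> V \<and> j \<in> V)" using VV by blast
  moreover have "z (merge i) (merge j) = 0" if "i \<in> Y" "j \<in> Y"
    using that ij assms R'_R merge_simps(3) by (auto simp: supported_def)
  ultimately show "lift z i j = 0" by (auto simp: lift_def)
qed

lemma sum_P: "(\<Sum>k\<in>P. f k) = (\<Sum>k\<in>V. f k) + (\<Sum>k\<in>Y. f k)" for f :: "nat \<Rightarrow> 'a::comm_monoid_add"
proof -
  have "P = V \<union> Y" using part by blast
  moreover have "V \<inter> Y = {}" using disj by blast
  ultimately show ?thesis using fin' by (simp add: sum.union_disjoint)
qed

text \<open>Compression to \<open>V0 \<union> W1\<close> is multiplicative because no path of the contracted preorder leaves and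
re-enters this set; the removal of \<open>W0 \<times> W1\<close> is needed for that. The same holds for the other
block.\<close>

lemma lift_mmul:
  assumes y: "supported R' y" and z: "supported R' z"
  shows "lift (mmul P' y z) = mmul P (lift y) (lift z)"
proof (intro ext)
  fix i j
  consider "i \<notin> P \<or> j \<notin> P" | "i \<in> V" "j \<in> V" | "i \<in> Y" "j \<in> Y" | "i \<in> V" "j \<in> Y" | "i \<in> Y" "j \<in> V"
    using part by blast
  then show "lift (mmul P' y z) i j = mmul P (lift y) (lift z) i j"
  proof cases
    case 1
    then show ?thesis by (auto simp: lift_outside mmul_def)
  next
    case 2
    have "mmul P (lift y) (lift z) i j = (\<Sum>k\<in>V. y (merge i) (merge k) * z (merge k) (merge j))"
      using 2 unfolding mmul_def sum_P
      by (simp add: lift_VV lift_VY del: Un_iff)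
    also have "\<dots> = (\<Sum>k\<in>V0 \<union> W1. y (merge i) k * z k (merge j))"
      using sum.reindex_bij_betw[OF bij_merge, of "\<lambda>k. y (merge i) k * z k (merge j)"] by simp
    also have "\<dots> = (\<Sum>k\<in>P'. y (merge i) k * z k (merge j))"
    proof (rule sum.mono_neutral_left)
      show "\<forall>k\<in>P' - (V0 \<union> W1). y (merge i) k * z k (merge j) = 0"
      proof
        fix k assume "k \<in> P' - (V0 \<union> W1)"
        then have k: "k \<in> W0 \<union> Z" unfolding P'_eq by blast
        have "(merge i, k) \<notin> R' \<or> (k, merge j) \<notin> R'"
        proof (cases "k \<in> Z")
          case True
          then have "(merge i, k) \<notin> R" using merge_V[OF 2(1)] noVZ noWZ by blast
          then show ?thesis using R'_R by blast
        next
          case False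
          then have "k \<in> W0" using k by blast
          then have "(k, merge j) \<notin> R'" using merge_V[OF 2(2)] noYV by (auto simp: R'_def)
          then show ?thesis by blast
        qed
        then show "y (merge i) k * z k (merge j) = 0" using y z by (auto simp: supported_def)
      qed
    qed (use fin' P'_eq in auto)
    finally show ?thesis using 2 by (simp add: lift_VV mmul_def del: Un_iff)
  next
    case 3
    have "mmul P (lift y) (lift z) i j = (\<Sum>k\<in>Y. y i k * z k j)"
      using 3 unfolding mmul_def sum_P
      by (simp add: lift_YY lift_YV del: Un_iff)
    also have "\<dots> = (\<Sum>k\<in>P'. y i k * z k j)"
    proof (rule sum.mono_neutral_left)
      show "\<forall>k\<in>P' - Y. y i k * z k j = 0"
      proof
        fix k assume "k \<in> P' - Y"
        then have "k \<in> V0" unfolding P'_eq by blast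
        then have "(i, k) \<notin> R" using 3 noYV by blast
        then show "y i k * z k j = 0" using y R'_R by (auto simp: supported_def)
      qed
    qed (use fin' P'_eq in auto)
    finally show ?thesis using 3 by (simp add: lift_YY mmul_def del: Un_iff)
  next
    case 4
    then show ?thesis unfolding mmul_def sum_P
      by (simp add: lift_VY lift_YY lift_VV del: Un_iff)
  next
    case 5
    then show ?thesis unfolding mmul_def sum_P
      by (simp add: lift_YV lift_YY lift_VV del: Un_iff)
  qed
qed

lemma lift_mcomm:
  assumes "supported R' y" "supported R' z"
  shows "lift (mcomm P' y z) = mcomm P (lift y) (lift z)"
proof -
  have "lift (mcomm P' y z) = lift (mmul P' y z) - lift (mmul P' z y)"
    by (auto simp: lift_def mcomm_def fun_eq_iff)
  then show ?thesis using assms by (simp add: lift_mmul mcomm_def)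
qed

text \<open>The pull-back of a linear form along \<^term>\<open>lift\<close>.\<close>

definition contract :: "'k::field kmat \<Rightarrow> 'k kmat" where
  "contract H = (\<lambda>j i. (if i \<in> Y \<and> j \<in> Y then H j i else 0)
     + (if i \<in> V0 \<union> W1 \<and> j \<in> V0 \<union> W1 then H (unmerge j) (unmerge i) else 0))"

lemma mtrace_lift: "mtrace P (mmul P H (lift z)) = mtrace P' (mmul P' (contract H) z)"
proof -
  have "mtrace P (mmul P H (lift z)) = (\<Sum>j\<in>V. \<Sum>i\<in>V. H j i * z (merge i) (merge j)) + (\<Sum>j\<in>Y. \<Sum>i\<in>Y. H j i * z i j)"
    unfolding mtrace_def mmul_def sum_P
    by (simp add: lift_YV lift_YY lift_VV lift_VY del: Un_iff)
  also have "(\<Sum>j\<in>V. \<Sum>i\<in>V. H j i * z (merge i) (merge j))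
      = (\<Sum>j\<in>V0 \<union> W1. \<Sum>i\<in>V0 \<union> W1. H (unmerge j) (unmerge i) * z i j)"
  proof -
    have "(\<Sum>j\<in>V. \<Sum>i\<in>V. H j i * z (merge i) (merge j)) = (\<Sum>j\<in>V. \<Sum>i\<in>V. H (unmerge (merge j)) (unmerge (merge i)) * z (merge i) (merge j))"
      by (intro sum.cong[OF refl]) (simp only: unmerge_merge)
    also have "\<dots> = (\<Sum>j\<in>V. \<Sum>i\<in>V0 \<union> W1. H (unmerge (merge j)) (unmerge i) * z i (merge j))"
      using sum.reindex_bij_betw[OF bij_merge, of "\<lambda>i. H (unmerge (merge j)) (unmerge i) * z i (merge j)" for j] by simp
    also have "\<dots> = (\<Sum>j\<in>V0 \<union> W1. \<Sum>i\<in>V0 \<union> W1. H (unmerge j) (unmerge i) * z i j)"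
      by (rule sum.reindex_bij_betw[OF bij_merge, of "\<lambda>j. \<Sum>i\<in>V0 \<union> W1. H (unmerge j) (unmerge i) * z i j"])
    finally show ?thesis .
  qed
  also have "\<dots> = (\<Sum>j\<in>P'. \<Sum>i\<in>P'. (if i \<in> V0 \<union> W1 \<and> j \<in> V0 \<union> W1 then H (unmerge j) (unmerge i) else 0) * z i j)"
  proof -
    have "(\<Sum>i\<in>V0 \<union> W1. H (unmerge j) (unmerge i) * z i j)
        = (\<Sum>i\<in>P'. (if i \<in> V0 \<union> W1 \<and> j \<in> V0 \<union> W1 then H (unmerge j) (unmerge i) else 0) * z i j)" if "j \<in> V0 \<union> W1" for j
      using that by (intro sum.mono_neutral_cong_left) (use fin' P'_eq in auto)
    then show ?thesis
      by (intro sum.mono_neutral_cong_left) (use fin' P'_eq in \<open>auto intro!: sum.neutral\<close>)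
  qed
  also have "(\<Sum>j\<in>Y. \<Sum>i\<in>Y. H j i * z i j) = (\<Sum>j\<in>P'. \<Sum>i\<in>P'. (if i \<in> Y \<and> j \<in> Y then H j i else 0) * z i j)"
  proof -
    have "(\<Sum>i\<in>Y. H j i * z i j)
        = (\<Sum>i\<in>P'. (if i \<in> Y \<and> j \<in> Y then H j i else 0) * z i j)" if "j \<in> Y" for j
      using that by (intro sum.mono_neutral_cong_left) (use fin' P'_eq in auto)
    then show ?thesis
      by (intro sum.mono_neutral_cong_left) (use fin' P'_eq in \<open>auto intro!: sum.neutral\<close>)
  qed
  finally show ?thesis
    by (simp add: mtrace_def mmul_def contract_def distrib_right sum.distrib add.commute)
qed

lemma bform_lift:
  assumes "supported R' y" "supported R' z"
  shows "bform P H (lift y) (lift z) = bform P' (contract H) y z"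
  using assms by (simp add: bform_def flip: lift_mcomm mtrace_lift)

text \<open>The form restricted to the ideal is the standard pairing along \<open>\<tau>\<close>.\<close>

definition normalized :: "'k::field kmat \<Rightarrow> bool" where
  "normalized H \<longleftrightarrow> (\<forall>w\<in>W. \<forall>v\<in>V. H w v = (if v \<in> V1 \<and> w = \<tau> v then 1 else 0))"

text \<open>The matrices orthogonal to the ideal with respect to a normalized form; see \<open>aligned_iff\<close>.\<close>

definition aligned :: "'k::field kmat \<Rightarrow> bool" where
  "aligned x \<longleftrightarrow> (\<forall>r\<in>V1. \<forall>s\<in>V1. x (\<tau> r) (\<tau> s) = x r s) \<and> (\<forall>r\<in>V1. \<forall>v\<in>V0. x r v = 0) \<and>
     (\<forall>w\<in>W0. \<forall>r\<in>V1. x w (\<tau> r) = 0)"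

lemma V_W: "V \<inter> W = {}" "V \<inter> Y = {}" "W0 \<inter> V = {}" "W1 \<inter> V = {}"
  using disj by blast+

lemma V_P: "v \<in> V \<Longrightarrow> v \<in> P" "w \<in> W \<Longrightarrow> w \<in> P" "y \<in> Y \<Longrightarrow> y \<in> P"
  using P'_P by blast+

lemma mcomm_WV:
  assumes H: "normalized H" and x: "supported R x" and w: "w \<in> W" and v: "v \<in> V"
  shows "mcomm P H x w v = (if w \<in> W1 then x (\<sigma> w) v else 0) - (if v \<in> V1 then x w (\<tau> v) else 0)"
proof -
  have "H w i * x i v = (if i = \<sigma> w \<and> w \<in> W1 then x i v else 0)" if "i \<in> P" for i
  proof (cases "i \<in> V")
    case True
    have "(i \<in> V1 \<and> w = \<tau> i) \<longleftrightarrow> (i = \<sigma> w \<and> w \<in> W1)"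
      using \<sigma>_\<tau> \<tau>_\<sigma> \<tau>_W1 \<sigma>_V1 by auto
    then show ?thesis using H w True by (auto simp: normalized_def)
  next
    case False
    then have "(i, v) \<notin> R" using that part noYV v by blast
    then have "x i v = 0" using x by (auto simp: supported_def)
    then show ?thesis by auto
  qed
  then have "(\<Sum>i\<in>P. H w i * x i v) = (\<Sum>i\<in>P. if i = \<sigma> w \<and> w \<in> W1 then x i v else 0)"
    by (intro sum.cong) auto
  also have "\<dots> = (if w \<in> W1 then x (\<sigma> w) v else 0)"
    using fin \<sigma>_V1 part by auto
  finally have 1: "(\<Sum>i\<in>P. H w i * x i v) = \<dots>" .
  have "x w i * H i v = (if i = \<tau> v \<and> v \<in> V1 then x w i else 0)" if "i \<in> P" for i
  proof (cases "i \<in> W")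
    case True
    then show ?thesis using H v by (auto simp: normalized_def)
  next
    case False
    then have "(w, i) \<notin> R" using that part noYV noWZ w by blast
    then have "x w i = 0" using x by (auto simp: supported_def)
    then show ?thesis by auto
  qed
  then have "(\<Sum>i\<in>P. x w i * H i v) = (\<Sum>i\<in>P. if i = \<tau> v \<and> v \<in> V1 then x w i else 0)"
    by (intro sum.cong) auto
  also have "\<dots> = (if v \<in> V1 then x w (\<tau> v) else 0)"
    using fin \<tau>_W1 part by auto
  finally have 2: "(\<Sum>i\<in>P. x w i * H i v) = \<dots>" .
  show ?thesis using 1 2 by (simp add: mcomm_def mmul_def)
qed

lemma aligned_iff:
  assumes H: "normalized H" and x: "supported R x"
  shows "aligned x \<longleftrightarrow> (\<forall>v\<in>V. \<forall>w\<in>W. mcomm P H x w v = 0)"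
proof
  assume a: "aligned x"
  show "\<forall>v\<in>V. \<forall>w\<in>W. mcomm P H x w v = 0"
  proof (intro ballI)
    fix v w assume v: "v \<in> V" and w: "w \<in> W"
    have e: "mcomm P H x w v = (if w \<in> W1 then x (\<sigma> w) v else 0) - (if v \<in> V1 then x w (\<tau> v) else 0)"
      by (rule mcomm_WV[OF H x w v])
    show "mcomm P H x w v = 0"
    proof (cases "w \<in> W1")
      case True
      then have s: "\<sigma> w \<in> V1" "\<tau> (\<sigma> w) = w" using \<sigma>_V1 \<tau>_\<sigma> by auto
      show ?thesis
      proof (cases "v \<in> V1")
        case v1: True
        have "x (\<tau> (\<sigma> w)) (\<tau> v) = x (\<sigma> w) v" using a s(1) v1 unfolding aligned_def by blast
        then show ?thesis using e True v1 s by simp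
      next
        case False
        then have "x (\<sigma> w) v = 0" using a s(1) v unfolding aligned_def by blast
        then show ?thesis using e False by simp
      qed
    next
      case False
      then have "v \<in> V1 \<Longrightarrow> x w (\<tau> v) = 0" using a w unfolding aligned_def by blast
      then show ?thesis using e False by simp
    qed
  qed
next
  assume c: "\<forall>v\<in>V. \<forall>w\<in>W. mcomm P H x w v = 0"
  have e: "(if w \<in> W1 then x (\<sigma> w) v else 0) = (if v \<in> V1 then x w (\<tau> v) else 0)" if "v \<in> V" "w \<in> W" for v w
    using mcomm_WV[OF H x that(2,1)] c that by simp
  show "aligned x" unfolding aligned_def
  proof (intro conjI ballI)
    fix r s assume r: "r \<in> V1" and s: "s \<in> V1"
    show "x (\<tau> r) (\<tau> s) = x r s"
      using e[of s "\<tau> r"] r s \<tau>_W1[OF r] \<sigma>_\<tau>[OF r] by auto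
  next
    fix r v assume r: "r \<in> V1" and v: "v \<in> V0"
    have "v \<notin> V1" using v disj by blast
    then show "x r v = 0" using e[of v "\<tau> r"] r v \<tau>_W1[OF r] \<sigma>_\<tau>[OF r] by auto
  next
    fix w r assume w: "w \<in> W0" and r: "r \<in> V1"
    have "w \<notin> W1" using w disj by blast
    then show "x w (\<tau> r) = 0" using e[of r w] r w by auto
  qed
qed

lemma class_disj:
  "i \<in> V0 \<Longrightarrow> i \<notin> V1 \<and> i \<notin> W0 \<and> i \<notin> W1 \<and> i \<notin> Z"
  "i \<in> V1 \<Longrightarrow> i \<notin> V0 \<and> i \<notin> W0 \<and> i \<notin> W1 \<and> i \<notin> Z"
  "i \<in> W0 \<Longrightarrow> i \<notin> V0 \<and> i \<notin> V1 \<and> i \<notin> W1 \<and> i \<notin> Z"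
  "i \<in> W1 \<Longrightarrow> i \<notin> V0 \<and> i \<notin> V1 \<and> i \<notin> W0 \<and> i \<notin> Z"
  "i \<in> Z \<Longrightarrow> i \<notin> V0 \<and> i \<notin> V1 \<and> i \<notin> W0 \<and> i \<notin> W1"
  using disj unfolding disjoint_iff by metis+

lemma aligned_VW: "supported (V \<times> W) n \<Longrightarrow> aligned n"
proof -
  assume n: "supported (V \<times> W) n"
  have z: "n i j = 0" if "i \<notin> V \<or> j \<notin> W" for i j using n that unfolding supported_def by blast
  have "r \<in> V1 \<Longrightarrow> r \<notin> W" "v \<in> V0 \<Longrightarrow> v \<notin> W" "w \<in> W0 \<Longrightarrow> w \<notin> V" "r \<in> V1 \<Longrightarrow> \<tau> r \<notin> V" for r v w
    using class_disj \<tau>_W1 unfolding Un_iff by metis+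
  then show ?thesis unfolding aligned_def using z by metis
qed

lemma lift_aligned:
  assumes "supported R' z"
  shows "aligned (lift z)"
  unfolding aligned_def
proof (intro conjI ballI)
  fix r s assume r: "r \<in> V1" and s: "s \<in> V1"
  have "lift z (\<tau> r) (\<tau> s) = z (\<tau> r) (\<tau> s)" using \<tau>_W1[OF r] \<tau>_W1[OF s] by (intro lift_YY) blast+
  moreover have "lift z r s = z (\<tau> r) (\<tau> s)" using lift_VV[of r s z] r s merge_simps(1) by simp
  ultimately show "lift z (\<tau> r) (\<tau> s) = lift z r s" by simp
next
  fix r v assume r: "r \<in> V1" and v: "v \<in> V0"
  have "(\<tau> r, v) \<notin> R'" using \<tau>_W1[OF r] v noYV R'_R by blast
  then show "lift z r v = 0" using lift_VV[of r v z] r v merge_simps(1,2) assms by (simp add: supported_def)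
next
  fix w r assume w: "w \<in> W0" and r: "r \<in> V1"
  have "(w, \<tau> r) \<notin> R'" using \<tau>_W1[OF r] w unfolding R'_def by blast
  moreover have "lift z w (\<tau> r) = z w (\<tau> r)" using \<tau>_W1[OF r] w by (intro lift_YY) blast+
  ultimately show "lift z w (\<tau> r) = 0" using assms by (simp add: supported_def)
qed

lemma aligned_bform:
  assumes "normalized H" "supported R x" "aligned x" "supported (V \<times> W) n"
  shows "bform P H x n = 0" "bform P H n x = 0"
proof -
  show "bform P H x n = 0"
    by (rule bform_zero_if_entries[OF assms(4)]) (use aligned_iff[OF assms(1,2)] assms(3) in blast)
  then show "bform P H n x = 0" by (simp add: bform_commute[of P H n x])
qed

text \<open>The orthogonal space of the ideal is the lifted contracted algebra plus the ideal.\<close>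

lemma aligned_decomp:
  assumes x: "supported R x" "aligned x"
  obtains z n where "supported R' z" "supported (V \<times> W) n" "x = lift z + n"
proof -
  define z where "z i j = (if i \<in> V0 \<and> j \<in> W1 then x i (\<sigma> j)
     else if (i \<in> V0 \<and> j \<in> V0 \<or> i \<in> Y \<and> j \<in> Y) \<and> (i, j) \<in> R' then x i j else 0)" for i j
  define n where "n i j = (if i \<in> V \<and> j \<in> W then x i j else 0)" for i j
  have "(i, j) \<in> R'" if "i \<in> V0" "j \<in> W1" for i j
    using that VW disj unfolding R'_def P'_def by blast
  then have z: "supported R' z" by (auto simp: supported_def z_def)
  have n: "supported (V \<times> W) n" by (auto simp: supported_def n_def)
  have "x i j = lift z i j + n i j" for i j
  proof -
    consider "i \<notin> P \<or> j \<notin> P" | "i \<in> V" "j \<in> V" | "i \<in> Y" "j \<in> Y" | "i \<in> V" "j \<in> W" | "i \<in> V" "j \<in> Z" | "i \<in> Y" "j \<in> V"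
      using part by blast
    then show ?thesis
    proof cases
      case 1
      then have "(i, j) \<notin> R" "\<not> (i \<in> V \<and> j \<in> W)" using RP P'_P by blast+
      then show ?thesis using x 1 lift_outside[OF 1, of z] by (auto simp: supported_def n_def)
    next
      case 2
      have nj: "n i j = 0" using 2 V_W by (auto simp: n_def)
      have l: "lift z i j = z (merge i) (merge j)" using 2 by (rule lift_VV)
      have R': "(a, b) \<in> R'" if "a \<in> V0" "b \<in> V0" for a b
        using that VV disj unfolding R'_def P'_def by blast
      consider "i \<in> V0" "j \<in> V0" | "i \<in> V0" "j \<in> V1" | "i \<in> V1" "j \<in> V0" | "i \<in> V1" "j \<in> V1"
        using 2 by blast
      then have "z (merge i) (merge j) = x i j"
      proof cases
        case 1
        then have "j \<notin> W1" using disj by blast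
        then show ?thesis using 1 R' by (simp add: merge_simps z_def)
      next
        case 2
        then show ?thesis using \<tau>_W1 \<sigma>_\<tau> by (simp add: merge_simps z_def)
      next
        case 3
        then have "\<tau> i \<notin> V0" "j \<notin> Y" using \<tau>_W1[of i] disj by blast+
        moreover have "x i j = 0" using 3 x(2) unfolding aligned_def by blast
        ultimately show ?thesis using 3 by (simp add: merge_simps z_def)
      next
        case 4
        then have t: "\<tau> i \<in> W1" "\<tau> j \<in> W1" using \<tau>_W1 by blast+
        then have "\<tau> i \<notin> V0" "\<tau> i \<in> Y" "\<tau> j \<in> Y" using disj by blast+
        moreover have "x (\<tau> i) (\<tau> j) = x i j" using 4 x(2) unfolding aligned_def by blast
        moreover have "x (\<tau> i) (\<tau> j) = 0" if "(\<tau> i, \<tau> j) \<notin> R'"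
        proof -
          have "(\<tau> i, \<tau> j) \<notin> R" using that t disj unfolding R'_def P'_def by blast
          then show ?thesis using x by (simp add: supported_def)
        qed
        ultimately show ?thesis using 4 by (auto simp: merge_simps z_def)
      qed
      then show ?thesis using l nj by simp
    next
      case 3
      have nj: "n i j = 0" using 3 V_W by (auto simp: n_def)
      have l: "lift z i j = z i j" using 3 by (rule lift_YY)
      have "i \<notin> V0" using 3 disj by blast
      moreover have "x i j = 0" if "(i, j) \<notin> R'"
      proof (cases "(i, j) \<in> W0 \<times> W1")
        case True
        then have "x i (\<tau> (\<sigma> j)) = 0" using x(2) \<sigma>_V1 unfolding aligned_def by blast
        then show ?thesis using True \<tau>_\<sigma> by simp
      next
        case False
        then have "(i, j) \<notin> R" using that 3 unfolding R'_def P'_def by blast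
        then show ?thesis using x by (simp add: supported_def)
      qed
      ultimately show ?thesis using 3 l nj by (auto simp: z_def)
    next
      case 4
      have "lift z i j = 0" using 4 by (intro lift_VY) auto
      then show ?thesis using 4 by (simp add: n_def)
    next
      case 5
      have "lift z i j = 0" using 5 by (intro lift_VY) auto
      moreover have "(i, j) \<notin> R" using 5 noVZ by blast
      moreover have "j \<notin> W" using 5 class_disj(5)[of j] by simp
      ultimately show ?thesis using x by (simp add: n_def supported_def)
    next
      case 6
      have "lift z i j = 0" using 6 by (intro lift_YV) auto
      moreover have "(i, j) \<notin> R" using 6 noYV by blast
      moreover have "j \<notin> W" using 6 class_disj(1,2)[of j] by auto
      ultimately show ?thesis using x by (simp add: n_def supported_def)
    qed
  qed
  then have "x = lift z + n" by (simp add: fun_eq_iff)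
  then show thesis using that z n by blast
qed

text \<open>The support of a complement of the orthogonal space of the ideal. Its matrix units are, up to sign, a
dual basis of the matrix units of the ideal (\<open>mcomm_ideal_VV\<close> and \<open>mcomm_ideal_WW\<close>).\<close>

definition transversal where "transversal = V1 \<times> V \<union> W0 \<times> W1"

lemma transversal_R: "transversal \<subseteq> R"
  unfolding transversal_def using VV WW by blast

lemma mcomm_ideal_VV:
  assumes H: "normalized H" and n: "supported (V \<times> W) n" and v: "v \<in> V" and r: "r \<in> V1"
  shows "mcomm P H n v r = - n v (\<tau> r)"
proof -
  have "r \<notin> W" using r class_disj(2)[of r] by simp
  then have 1: "n i r = 0" for i using n by (simp add: supported_def)
  have "n v i * H i r = (if i = \<tau> r then n v i else 0)" if "i \<in> P" for i
    using H n r \<tau>_W1[OF r] by (cases "i \<in> W") (auto simp: normalized_def supported_def)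
  then have "(\<Sum>i\<in>P. n v i * H i r) = (\<Sum>i\<in>P. if i = \<tau> r then n v i else 0)"
    by (intro sum.cong) auto
  also have "\<dots> = n v (\<tau> r)" using fin \<tau>_W1[OF r] part by auto
  finally show ?thesis by (simp add: mcomm_def mmul_def 1)
qed

lemma mcomm_ideal_WW:
  assumes H: "normalized H" and n: "supported (V \<times> W) n" and w: "w \<in> W0" and r: "r \<in> V1"
  shows "mcomm P H n (\<tau> r) w = n r w"
proof -
  have "\<tau> r \<notin> V" using \<tau>_W1[OF r] class_disj(4)[of "\<tau> r"] by simp
  then have 1: "n (\<tau> r) i = 0" for i using n by (simp add: supported_def)
  have "H (\<tau> r) i * n i w = (if i = r then n i w else 0)" if "i \<in> P" for i
  proof (cases "i \<in> V")
    case True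
    have "(i \<in> V1 \<and> \<tau> r = \<tau> i) \<longleftrightarrow> i = r" using r \<sigma>_\<tau> by metis
    then show ?thesis using H True \<tau>_W1[OF r] by (simp add: normalized_def)
  next
    case False
    then show ?thesis using n by (auto simp: supported_def)
  qed
  then have "(\<Sum>i\<in>P. H (\<tau> r) i * n i w) = (\<Sum>i\<in>P. if i = r then n i w else 0)"
    by (intro sum.cong) auto
  also have "\<dots> = n r w" using fin r part by auto
  finally show ?thesis by (simp add: mcomm_def mmul_def 1)
qed

lemma complement_decomp:
  assumes y: "supported R (y :: 'k::field kmat)"
  obtains c z n where "supported transversal c" "supported R' z" "supported (V \<times> W) n" "y = c + lift z + n"
proof -
  define c where "c i j = (if i \<in> V1 \<and> j \<in> V1 then y i j - y (\<tau> i) (\<tau> j)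
     else if i \<in> V1 \<and> j \<in> V0 \<or> i \<in> W0 \<and> j \<in> W1 then y i j else 0)" for i j
  have c: "supported transversal c" by (auto simp: supported_def c_def transversal_def)
  have s: "supported R (y - c)" using supported_diff[OF y supported_mono[OF c transversal_R]] .
  have "aligned (y - c)"
    unfolding aligned_def
  proof (intro conjI ballI)
    fix r s assume r: "r \<in> V1" and s: "s \<in> V1"
    have "\<tau> r \<notin> V1" "\<tau> r \<notin> W0" using \<tau>_W1[OF r] class_disj(4) by blast+
    then show "(y - c) (\<tau> r) (\<tau> s) = (y - c) r s" using r s by (simp add: c_def)
  next
    fix r v assume r: "r \<in> V1" and v: "v \<in> V0"
    have "v \<notin> V1" using v class_disj(1) by blast
    then show "(y - c) r v = 0" using r v by (simp add: c_def)
  next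
    fix w r assume w: "w \<in> W0" and r: "r \<in> V1"
    have "w \<notin> V1" using w class_disj(3) by blast
    then show "(y - c) w (\<tau> r) = 0" using w \<tau>_W1[OF r] by (simp add: c_def)
  qed
  then obtain z n where "supported R' z" "supported (V \<times> W) n" "y - c = lift z + n"
    using aligned_decomp[OF s] by blast
  then have "supported R' z" "supported (V \<times> W) n" "y = c + lift z + n" by (simp_all add: algebra_simps)
  then show thesis using that c by blast
qed

lemma ideal_zeroI:
  assumes n: "supported (V \<times> W) n"
    and 1: "\<And>v r. v \<in> V \<Longrightarrow> r \<in> V1 \<Longrightarrow> n v (\<tau> r) = 0" and 2: "\<And>w r. w \<in> W0 \<Longrightarrow> r \<in> V1 \<Longrightarrow> n r w = 0"
  shows "n = 0"
proof (intro ext)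
  fix i j
  show "n i j = 0 i j"
  proof (cases "i \<in> V \<and> j \<in> W")
    case False
    then show ?thesis using n by (auto simp: supported_def)
  next
    case True
    show ?thesis
    proof (cases "j \<in> W1")
      case j: True
      then show ?thesis using 1[of i "\<sigma> j"] True \<sigma>_V1 \<tau>_\<sigma> by simp
    next
      case False
      then have "j \<in> W0" "i \<in> V1" using True V0W0 by blast+
      then show ?thesis using 2 by simp
    qed
  qed
qed

lemma lift_mscalar: "lift (mscalar P' c) = mscalar P c"
proof (intro ext)
  fix i j
  consider "i \<notin> P \<or> j \<notin> P" | "i \<in> V" "j \<in> V" | "i \<in> Y" "j \<in> Y" | "i \<in> V" "j \<in> Y" | "i \<in> Y" "j \<in> V"
    using part by blast
  then show "lift (mscalar P' c) i j = mscalar P c i j"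
  proof cases
    case 1
    then show ?thesis using lift_outside by (auto simp: mscalar_def)
  next
    case 2
    have "merge i = merge j \<longleftrightarrow> i = j" using 2 unmerge_merge by metis
    moreover have "merge i \<in> P'" using merge_V[OF 2(1)] unfolding P'_def by blast
    moreover have "i \<in> P" using 2 V_P by blast
    ultimately show ?thesis using 2 by (simp add: lift_VV mscalar_def del: Un_iff)
  next
    case 3
    have "i \<in> P'" "i \<in> P" using 3 V_P unfolding P'_def by blast+
    then show ?thesis using 3 by (simp add: lift_YY mscalar_def del: Un_iff)
  next
    case 4
    then have "i \<noteq> j" using V_W by blast
    then show ?thesis using 4 by (simp add: lift_VY mscalar_def del: Un_iff)
  next
    case 5
    then have "i \<noteq> j" using V_W by blast
    then show ?thesis using 5 by (simp add: lift_YV mscalar_def del: Un_iff)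
  qed
qed

lemma supported_ideal_R: "supported (V \<times> W) n \<Longrightarrow> supported R n"
  using supported_mono VW by blast

lemma radical_entry: "x \<in> radical P R H \<Longrightarrow> (k, l) \<in> R \<Longrightarrow> mcomm P H x l k = 0"
  using radical_iff[OF fin RP, of x H] by blast

lemma bform_mscalar: "supported R y \<Longrightarrow> bform P H (mscalar P c) y = 0"
  using mscalar_in_radical[OF fin RP Rrefl] by (auto simp: radical_def)

text \<open>An element of the radical is orthogonal to the ideal, so it is a lifted element plus an element of the
ideal. The first is in the radical of the contracted form, hence scalar, and the second is
orthogonal to the complement, hence zero.\<close>

theorem nondeg_contract_imp:
  fixes H :: "'k::field kmat"
  assumes H: "normalized H" and nd: "nondeg P' R' (contract H)"
  shows "nondeg P R H"
  unfolding nondeg_def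
proof
  fix x assume x: "x \<in> radical P R H"
  have sx: "supported R x" using x by (simp add: radical_def)
  have "aligned x" unfolding aligned_iff[OF H sx] using radical_entry[OF x] VW by blast
  then obtain z n where z: "supported R' z" and n: "supported (V \<times> W) n" and xe: "x = lift z + n"
    using aligned_decomp[OF sx] by blast
  have "bform P' (contract H) z y = 0" if y: "supported R' y" for y
  proof -
    have "bform P H x (lift y) = 0" using x lift_supported[OF y] by (simp add: radical_def)
    moreover have "bform P H n (lift y) = 0"
      by (rule aligned_bform[OF H lift_supported[OF y] lift_aligned[OF y] n])
    ultimately show ?thesis by (simp add: xe bform_add_left bform_lift[OF z y])
  qed
  then have "z \<in> radical P' R' (contract H)" using z by (simp add: radical_def)
  then obtain c where c: "z = mscalar P' c" using nd by (auto simp: nondeg_def)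
  then have xe': "x = mscalar P c + n" using xe lift_mscalar by simp
  have "bform P H n y = 0" if "supported R y" for y
  proof -
    have "bform P H (mscalar P c + n) y = 0" using x that unfolding xe' by (simp add: radical_def)
    then show ?thesis using bform_mscalar[OF that, of H c] by (simp add: bform_add_left)
  qed
  then have nr: "n \<in> radical P R H" using supported_ideal_R[OF n] by (simp add: radical_def)
  have "n = 0"
  proof (rule ideal_zeroI[OF n])
    fix v r assume vr: "v \<in> V" "r \<in> V1"
    then have "(r, v) \<in> R" using transversal_R unfolding transversal_def by blast
    then show "n v (\<tau> r) = 0" using mcomm_ideal_VV[OF H n vr] radical_entry[OF nr] by simp
  next
    fix w r assume wr: "w \<in> W0" "r \<in> V1"
    then have "(w, \<tau> r) \<in> R" using WW \<tau>_W1 by blast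
    then show "n r w = 0" using mcomm_ideal_WW[OF H n wr] radical_entry[OF nr] by simp
  qed
  then show "\<exists>c. x = mscalar P c" using xe' by auto
qed

text \<open>Given \<open>z\<close> in the radical of the contracted form, its lift is orthogonal to all aligned matrices.
By duality it can be corrected by an element \<open>n\<close> of the ideal so that it becomes orthogonal to the
complement too.\<close>

theorem nondeg_imp_contract:
  fixes H :: "'k::field kmat"
  assumes H: "normalized H" and nd: "nondeg P R H"
  shows "nondeg P' R' (contract H)"
  unfolding nondeg_def
proof
  fix z assume zr: "z \<in> radical P' R' (contract H)"
  then have z: "supported R' z" by (simp add: radical_def)
  let ?x = "lift z"
  have sx: "supported R ?x" by (rule lift_supported[OF z])
  \<comment> \<open>The entries of \<open>n\<close> are forced by orthogonality of \<open>lift z + n\<close> to the dual basis.\<close>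
  define n where "n v w = (if v \<in> V \<and> w \<in> W1 then mcomm P H ?x v (\<sigma> w)
     else if v \<in> V1 \<and> w \<in> W0 then - mcomm P H ?x (\<tau> v) w else 0)" for v w
  have n: "supported (V \<times> W) n" by (auto simp: supported_def n_def)
  have c0: "mcomm P H (?x + n) l k = 0" if "(k, l) \<in> transversal" for k l
  proof (cases "k \<in> V1 \<and> l \<in> V")
    case True
    then have "mcomm P H n l k = - n l (\<tau> k)" by (intro mcomm_ideal_VV[OF H n]) auto
    also have "\<dots> = - mcomm P H ?x l k" using True \<tau>_W1 \<sigma>_\<tau> by (simp add: n_def)
    finally show ?thesis by (simp add: mcomm_add_right)
  next
    case False
    then have kl: "k \<in> W0" "l \<in> W1" using that unfolding transversal_def by blast+
    define r where "r = \<sigma> l"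
    have r: "r \<in> V1" "\<tau> r = l" using kl \<sigma>_V1 \<tau>_\<sigma> by (auto simp: r_def)
    have "mcomm P H n l k = n r k" using mcomm_ideal_WW[OF H n kl(1) r(1)] r by simp
    also have "\<dots> = - mcomm P H ?x l k" using kl r class_disj(3)[of k] by (simp add: n_def)
    finally show ?thesis by (simp add: mcomm_add_right)
  qed
  have "bform P H (?x + n) y = 0" if y: "supported R y" for y
  proof -
    obtain c z' n' where c: "supported transversal c" and z': "supported R' z'" and n': "supported (V \<times> W) n'"
      and ye: "y = c + lift z' + n'"
      using complement_decomp[OF y] by metis
    have "bform P H (?x + n) c = 0" by (rule bform_zero_if_entries[OF c c0])
    moreover have "bform P H ?x (lift z') = 0"
      using zr z' by (simp add: bform_lift[OF z z'] radical_def)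
    moreover have "bform P H n (lift z') = 0"
      by (rule aligned_bform[OF H lift_supported[OF z'] lift_aligned[OF z'] n])
    moreover have "bform P H ?x n' = 0"
      by (rule aligned_bform[OF H sx lift_aligned[OF z] n'])
    moreover have "bform P H n n' = 0"
      by (rule aligned_bform[OF H supported_ideal_R[OF n] aligned_VW[OF n] n'])
    ultimately show ?thesis by (simp add: ye bform_add_right bform_add_left)
  qed
  then have "?x + n \<in> radical P R H"
    using supported_add[OF sx supported_ideal_R[OF n]] by (simp add: radical_def)
  then obtain c where c: "?x + n = mscalar P c" using nd by (auto simp: nondeg_def)
  have e: "lift z i j + n i j = mscalar P c i j" for i j using c by (metis plus_fun_apply)
  have "z i j = mscalar P' c i j" for i j
  proof (cases "(i, j) \<in> R'")
    case False
    then have "z i j = 0" using z by (simp add: supported_def)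
    moreover have "mscalar P' c i j = 0" using False R'_refl by (auto simp: mscalar_def)
    ultimately show ?thesis by simp
  next
    case True
    then consider "i \<in> V0" "j \<in> V0" | "i \<in> V0" "j \<in> W1" | "i \<in> Y" "j \<in> Y"
      using R'_cases' by blast
    then show ?thesis
    proof cases
      case 1
      then have "n i j = 0" using class_disj(1)[of j] by (simp add: n_def)
      moreover have "lift z i j = z i j" using lift_VV[of i j z] 1 by (simp add: merge_simps)
      moreover have "i \<in> P" "i \<in> P'" using 1 unfolding part P'_def by blast+
      ultimately show ?thesis using e[of i j] by (simp add: mscalar_def)
    next
      case 2
      define r where "r = \<sigma> j"
      have r: "r \<in> V1" "\<tau> r = j" using 2 \<sigma>_V1 \<tau>_\<sigma> by (auto simp: r_def)
      have ne: "i \<noteq> r" "i \<noteq> j" using 2 r class_disj(1)[of i] by auto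
      have "n i r = 0" using class_disj(2)[OF r(1)] by (simp add: n_def)
      moreover have "lift z i r = z i j" using lift_VV[of i r z] 2 r by (simp add: merge_simps)
      ultimately show ?thesis using e[of i r] ne by (simp add: mscalar_def)
    next
      case 3
      then have "i \<notin> V" using V_W by blast
      then have "n i j = 0" by (simp add: n_def)
      moreover have "lift z i j = z i j" using lift_YY[of i j z] 3 by simp
      moreover have "i \<in> P" "i \<in> P'" using 3 V_P unfolding P'_def by blast+
      ultimately show ?thesis using e[of i j] by (simp add: mscalar_def)
    qed
  qed
  then have "z = mscalar P' c" by (intro ext)
  then show "\<exists>c. z = mscalar P' c" by blast
qed

lemma mscalar_unit:
  assumes "supported R x"
  shows "mmul P (mscalar P 1) x = x" "mmul P x (mscalar P 1) = x"
  using mmul_mscalar_left[OF fin supported_mono[OF assms RP], of 1] mmul_mscalar_right[OF fin supported_mono[OF assms RP], of 1]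
  by simp_all

text \<open>Conjugation by the inverse of the block of \<open>H\<close> at \<open>W1 \<times> V1\<close>, placed at \<open>V1 \<times> V1\<close>.\<close>

lemma nondeg_unit_block:
  fixes H :: "'k::field kmat"
  assumes nd: "nondeg P R H" and ns: "nonsing V1 (\<lambda>r s. H (\<tau> r) s)"
  obtains G :: "'k kmat" where "nondeg P R G" "\<And>r s. r \<in> V1 \<Longrightarrow> s \<in> V1 \<Longrightarrow> G (\<tau> r) s = (if r = s then 1 else 0)"
proof -
  obtain N where N1: "\<And>i j. i \<in> V1 \<Longrightarrow> j \<in> V1 \<Longrightarrow> (\<Sum>k\<in>V1. H (\<tau> i) k * N k j) = (if i = j then 1 else 0)"
    and N2: "\<And>i j. i \<in> V1 \<Longrightarrow> j \<in> V1 \<Longrightarrow> (\<Sum>k\<in>V1. N i k * H (\<tau> k) j) = (if i = j then 1 else 0)"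
    by (rule nonsing_inverse[OF fin'(2) ns], rule that, assumption+)
  define blk where "blk M = (\<lambda>i j. if i \<in> V1 \<and> j \<in> V1 then M i j else mscalar P 1 i j)" for M :: "'k kmat"
  let ?transversal = "\<lambda>r s. H (\<tau> r) s"
  have V1P: "V1 \<subseteq> P" using P'_P(2) by simp
  have blk_mmul: "mmul P (blk M) x i j = (if i \<in> V1 then (\<Sum>k\<in>V1. M i k * x k j) else x i j)"
    if "i \<in> P" for M x i j
  proof (cases "i \<in> V1")
    case True
    have "mmul P (blk M) x i j = (\<Sum>k\<in>V1. M i k * x k j)"
      unfolding mmul_def using True
      by (intro sum.mono_neutral_cong_right fin V1P) (auto simp: blk_def mscalar_def)
    then show ?thesis using True by simp
  next
    case False
    then have "mmul P (blk M) x i j = (\<Sum>k\<in>P. if k = i then x k j else 0)"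
      unfolding mmul_def using that by (intro sum.cong) (auto simp: blk_def mscalar_def)
    then show ?thesis using False that fin by simp
  qed
  have mmul_blk: "mmul P x (blk M) i j = (\<Sum>k\<in>V1. x i k * M k j)"
    if "j \<in> V1" for M x i j
    unfolding mmul_def using that
    by (intro sum.mono_neutral_cong_right fin V1P) (auto simp: blk_def mscalar_def)
  have sb: "supported R (blk M)" for M
    using VV Rrefl by (auto simp: supported_def blk_def mscalar_def)
  have sPP: "supported (P \<times> P) (mmul P (blk M) (blk M'))" for M M'
    using supported_mono[OF supported_mmul[OF Rtrans sb sb] RP] .
  have prod: "mmul P (blk M) (blk M') = mscalar P 1"
    if "\<And>i j. i \<in> V1 \<Longrightarrow> j \<in> V1 \<Longrightarrow> (\<Sum>k\<in>V1. M i k * M' k j) = (if i = j then 1 else 0)" for M M'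
  proof (intro ext)
    fix i j
    show "mmul P (blk M) (blk M') i j = mscalar P 1 i j"
    proof (cases "i \<in> P \<and> j \<in> P")
      case False
      then show ?thesis using sPP[of M M'] by (auto simp: supported_def mscalar_def)
    next
      case ij: True
      show ?thesis
      proof (cases "i \<in> V1")
        case i: True
        show ?thesis
        proof (cases "j \<in> V1")
          case True
          have "mmul P (blk M) (blk M') i j = (\<Sum>k\<in>V1. M i k * blk M' k j)" using ij i by (simp add: blk_mmul)
          also have "\<dots> = (\<Sum>k\<in>V1. M i k * M' k j)" using True by (intro sum.cong) (simp_all add: blk_def)
          finally show ?thesis using ij that[OF i True] by (simp add: mscalar_def)
        next
          case False
          then have "(\<Sum>k\<in>V1. M i k * blk M' k j) = 0" by (auto simp: blk_def mscalar_def intro!: sum.neutral)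
          then show ?thesis using ij i False by (auto simp: blk_mmul mscalar_def)
        qed
      next
        case False
        then show ?thesis using ij by (simp add: blk_mmul) (simp add: blk_def)
      qed
    qed
  qed
  let ?G = "mmul P (blk ?transversal) (mmul P H (blk N))"
  have "nondeg P R ?G"
    by (rule nondeg_conjugate[OF fin RP Rtrans sb sb _ _ nd]) (use prod N1 N2 in simp_all)
  moreover have "?G (\<tau> r) s = (if r = s then 1 else 0)" if r: "r \<in> V1" and s: "s \<in> V1" for r s
  proof -
    have "\<tau> r \<in> P" "\<tau> r \<notin> V1" using \<tau>_W1[OF r] V_P class_disj(4) by blast+
    then have "?G (\<tau> r) s = mmul P H (blk N) (\<tau> r) s" by (simp add: blk_mmul)
    also have "\<dots> = (\<Sum>k\<in>V1. H (\<tau> r) k * N k s)" using s by (rule mmul_blk)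
    finally show ?thesis using N1[OF r s] by simp
  qed
  ultimately show thesis using that by blast
qed

text \<open>Once the block at \<open>W1 \<times> V1\<close> is the identity, the rows in \<open>W0\<close> and the columns in \<open>V0\<close> are
cleared by elimination, that is, by conjugation with \<open>1 + X\<close> where \<open>X\<close> has square zero.\<close>

lemma nondeg_normalize:
  fixes G :: "'k::field kmat"
  assumes nd: "nondeg P R G" and G: "\<And>r s. r \<in> V1 \<Longrightarrow> s \<in> V1 \<Longrightarrow> G (\<tau> r) s = (if r = s then 1 else 0)"
  obtains F :: "'k kmat" where "nondeg P R F" "normalized F"
proof -
  define X where "X i j = (if i \<in> W0 \<and> j \<in> W1 then G i (\<sigma> j) else if i \<in> V1 \<and> j \<in> V0 then - G (\<tau> i) j else 0)" for i j
  have sX: "supported R X" using WW VV by (auto simp: supported_def X_def)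
  have XX: "mmul P X X = 0"
  proof (intro ext)
    fix i j
    have "X i k * X k j = 0" for k
      using class_disj(4)[of k] class_disj(1)[of k] by (auto simp: X_def)
    then show "mmul P X X i j = 0 i j" by (simp add: mmul_def)
  qed
  have ss: "supported R (mscalar P 1)" using Rrefl by (auto simp: supported_def mscalar_def)
  let ?u = "mscalar P 1 + X" and ?v = "mscalar P 1 - X"
  have uv: "mmul P ?u ?v = mscalar P 1" and vu: "mmul P ?v ?u = mscalar P 1"
    by (simp_all add: mmul_add_left mmul_add_right mmul_diff_left mmul_diff_right mscalar_unit[OF ss] mscalar_unit[OF sX] XX)
  let ?F = "mmul P ?v (mmul P G ?u)"
  have "nondeg P R ?F"
    by (rule nondeg_conjugate[OF fin RP Rtrans supported_add[OF ss sX] supported_diff[OF ss sX] uv vu nd])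
  moreover have "normalized ?F"
    unfolding normalized_def
  proof (intro ballI)
    fix w v assume w: "w \<in> W" and v: "v \<in> V"
    have wP: "w \<in> P" and vP: "v \<in> P" using w v V_P by blast+
    have s1: "mmul P (mscalar P 1) x w v = x w v" for x :: "'k kmat"
    proof -
      have "mmul P (mscalar P 1) x w v = (\<Sum>k\<in>P. if k = w then x k v else 0)"
        unfolding mmul_def using wP by (intro sum.cong) (auto simp: mscalar_def)
      then show ?thesis using fin wP by simp
    qed
    have s2: "mmul P x (mscalar P 1) i v = x i v" for x :: "'k kmat" and i
    proof -
      have "mmul P x (mscalar P 1) i v = (\<Sum>k\<in>P. if k = v then x i k else 0)"
        unfolding mmul_def using vP by (intro sum.cong) (auto simp: mscalar_def)
      then show ?thesis using fin vP by simp
    qed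
    have s2': "mmul P X (mmul P G (mscalar P 1)) w v = mmul P X G w v"
      by (simp add: mmul_def[of P X] s2)
    have e: "?F w v = G w v + mmul P G X w v - mmul P X G w v - mmul P X (mmul P G X) w v"
      by (simp add: mmul_diff_left mmul_add_right s1 s2 s2')
    have GX: "mmul P G X w v = (if w \<in> W1 \<and> v \<in> V0 then - G w v else 0)"
    proof (cases "v \<in> V0")
      case False
      then have "v \<in> V1" using v by blast
      then have "X k v = 0" for k using False class_disj(2)[of v] by (auto simp: X_def)
      then show ?thesis using False by (simp add: mmul_def)
    next
      case True
      then have "w \<in> W1" using w V0W0 by blast
      then obtain r where r: "r \<in> V1" "w = \<tau> r" using \<sigma>_V1 \<tau>_\<sigma> by metis
      have "G w k * X k v = (if k = r then - G w v else 0)" if "k \<in> P" for k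
        using True r G[OF r(1)] class_disj(1)[of v] by (auto simp: X_def)
      then have "mmul P G X w v = (\<Sum>k\<in>P. if k = r then - G w v else 0)"
        unfolding mmul_def by (intro sum.cong) auto
      moreover have "r \<in> P" using r V_P by blast
      ultimately show ?thesis using True \<open>w \<in> W1\<close> fin by simp
    qed
    have XG: "mmul P X G w v = (if w \<in> W0 \<and> v \<in> V1 then G w v else 0)"
    proof (cases "w \<in> W0")
      case False
      then have "X w k = 0" for k using w class_disj(4)[of w] by (auto simp: X_def)
      then show ?thesis using False by (simp add: mmul_def)
    next
      case True
      then have v1: "v \<in> V1" using v V0W0 by blast
      have "X w k * G k v = (if k = \<tau> v then G w v else 0)" if "k \<in> P" for k
      proof (cases "k \<in> W1")
        case k: True
        then obtain r where r: "r \<in> V1" "k = \<tau> r" using \<sigma>_V1 \<tau>_\<sigma> by metis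
        have "k = \<tau> v \<longleftrightarrow> r = v" using r v1 \<sigma>_\<tau> by metis
        then show ?thesis using True k r G[OF r(1) v1] \<sigma>_\<tau> by (auto simp: X_def)
      next
        case False
        then have "k \<noteq> \<tau> v" using \<tau>_W1[OF v1] by blast
        then show ?thesis using False True class_disj(3)[of w] by (auto simp: X_def)
      qed
      then have "mmul P X G w v = (\<Sum>k\<in>P. if k = \<tau> v then G w v else 0)"
        unfolding mmul_def by (intro sum.cong) auto
      moreover have "\<tau> v \<in> P" using \<tau>_W1[OF v1] V_P by blast
      ultimately show ?thesis using True v1 fin by simp
    qed
    have XGX: "mmul P X (mmul P G X) w v = 0"
    proof (cases "w \<in> W0")
      case False
      then have "X w k = 0" for k using w class_disj(4)[of w] by (auto simp: X_def)
      then show ?thesis by (simp add: mmul_def)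
    next
      case True
      then have "v \<in> V1" using v V0W0 by blast
      then have "X k v = 0" for k using class_disj(2)[of v] by (auto simp: X_def)
      then show ?thesis by (simp add: mmul_def)
    qed
    show "?F w v = (if v \<in> V1 \<and> w = \<tau> v then 1 else 0)"
    proof (cases "w \<in> W1")
      case True
      then obtain r where r: "r \<in> V1" "w = \<tau> r" using \<sigma>_V1 \<tau>_\<sigma> by metis
      have w0: "w \<notin> W0" using True class_disj(4) by blast
      show ?thesis
      proof (cases "v \<in> V0")
        case v0: True
        then show ?thesis using class_disj(1)[OF v0] w0 True by (simp add: e GX XG XGX)
      next
        case False
        then have v1: "v \<in> V1" using v by blast
        have "w = \<tau> v \<longleftrightarrow> r = v" using r v1 \<sigma>_\<tau> by metis
        then show ?thesis unfolding e GX XG XGX using v1 False w0 True r G[OF r(1) v1] by simp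
      qed
    next
      case False
      then have w0: "w \<in> W0" using w by blast
      then have v1: "v \<in> V1" using v V0W0 by blast
      have "w \<noteq> \<tau> v" using \<tau>_W1[OF v1] False by blast
      then show ?thesis using w0 v1 False by (simp add: e GX XG XGX)
    qed
  qed
  ultimately show thesis using that by blast
qed

text \<open>A nondegenerate form need not have an invertible block at \<open>W1 \<times> V1\<close>, but a generic form on the
line through it in the direction of the pairing along \<open>\<tau>\<close> has one, and it is still
nondegenerate.\<close>

lemma nondeg_normalized_exists:
  fixes H :: "'k::field_char_0 kmat"
  assumes nd: "nondeg P R H"
  obtains F :: "'k kmat" where "nondeg P R F" "normalized F"
proof -
  define E :: "'k kmat" where "E i j = (if j \<in> V1 \<and> i = \<tau> j then 1 else 0)" for i j
  have E: "E (\<tau> r) s = (if r = s then 1 else 0)" if "r \<in> V1" "s \<in> V1" for r s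
    using that \<sigma>_\<tau> unfolding E_def by metis
  let ?B1 = "{s. \<not> nondeg P R (\<lambda>i j. H i j + s * E i j)}"
  let ?B2 = "{s. \<not> nonsing V1 (\<lambda>i j. E (\<tau> i) j + s * H (\<tau> i) j)}"
  have "nonsing V1 (\<lambda>i j. E (\<tau> i) j)"
    unfolding nonsing_def
  proof (intro allI impI ballI)
    fix x j assume x: "\<forall>i\<in>V1. (\<Sum>j\<in>V1. E (\<tau> i) j * x j) = 0" and j: "j \<in> V1"
    have "(\<Sum>k\<in>V1. E (\<tau> j) k * x k) = (\<Sum>k\<in>V1. if k = j then x k else 0)"
      using E[OF j] by (intro sum.cong) auto
    then show "x j = 0" using x j fin' by simp
  qed
  then have "finite ?B2" by (rule finite_singular_pencil[OF fin'(2)])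
  moreover have "finite ?B1" by (rule nondeg_perturb[OF fin RP Rrefl nd])
  ultimately have "finite (?B1 \<union> inverse ` ?B2 \<union> {0})" by blast
  \<comment> \<open>The block of \<open>H + s E\<close> at \<open>W1 \<times> V1\<close> is \<open>s\<close> times that of \<open>E + H / s\<close>, a pencil which is
    nonsingular at its origin.\<close>
  then obtain s where s: "s \<notin> ?B1" "s \<notin> inverse ` ?B2" "s \<noteq> 0"
    using ex_new_if_finite[OF infinite_UNIV_char_0, of "?B1 \<union> inverse ` ?B2 \<union> {0}"] by blast
  have "inverse s \<notin> ?B2"
  proof
    assume "inverse s \<in> ?B2"
    then have "inverse (inverse s) \<in> inverse ` ?B2" by (rule imageI)
    then show False using s(2) by (simp only: inverse_inverse_eq)
  qed
  then have "nonsing V1 (\<lambda>i j. E (\<tau> i) j + inverse s * H (\<tau> i) j)" by simp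
  moreover have "H (\<tau> i) j + s * E (\<tau> i) j = s * (E (\<tau> i) j + inverse s * H (\<tau> i) j)" for i j
    using s(3) by (simp add: field_simps)
  ultimately have "nonsing V1 (\<lambda>i j. H (\<tau> i) j + s * E (\<tau> i) j)"
    using s(3) by (simp add: nonsing_def mult.assoc flip: sum_distrib_left)
  moreover have "nondeg P R (\<lambda>i j. H i j + s * E i j)" using s(1) by simp
  ultimately obtain G :: "'k kmat" where "nondeg P R G" "\<And>r s. r \<in> V1 \<Longrightarrow> s \<in> V1 \<Longrightarrow> G (\<tau> r) s = (if r = s then 1 else 0)"
    using nondeg_unit_block by blast
  then show thesis using nondeg_normalize that by blast
qed

text \<open>For the converse, a form on the contracted algebra is extended to a normalized one that induces it.\<close>

theorem frob_pattern_contract: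
  "frob_pattern TYPE('k::field_char_0) P R \<longleftrightarrow> frob_pattern TYPE('k) P' R'"
proof
  assume "frob_pattern TYPE('k) P R"
  then obtain H :: "'k kmat" where "nondeg P R H" by (auto simp: frob_pattern_def)
  then obtain F :: "'k kmat" where "nondeg P R F" "normalized F"
    using nondeg_normalized_exists by blast
  then show "frob_pattern TYPE('k) P' R'"
    unfolding frob_pattern_def using nondeg_imp_contract by blast
next
  assume "frob_pattern TYPE('k) P' R'"
  then obtain H' :: "'k kmat" where nd: "nondeg P' R' H'" by (auto simp: frob_pattern_def)
  define H :: "'k kmat" where "H j i = (if j \<in> W \<and> i \<in> V then (if i \<in> V1 \<and> j = \<tau> i then 1 else 0)
    else if i \<in> V1 \<and> j \<in> V1 then 0 else H' (merge j) (merge i))" for j i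
  have n: "normalized H" by (simp add: normalized_def H_def)
  have "contract H j i = H' j i" if ij: "(i, j) \<in> R'" for i j
  proof -
    consider "i \<in> V0" "j \<in> V0" | "i \<in> V0" "j \<in> W1" | "i \<in> Y" "j \<in> Y"
      using R'_cases'[OF ij] by blast
    then show ?thesis
    proof cases
      case 1
      then have "i \<notin> Y" "j \<notin> W1" "i \<notin> W1" "i \<notin> V1" "j \<notin> W" using class_disj(1) by blast+
      then show ?thesis using 1 by (simp add: contract_def H_def unmerge_def merge_simps)
    next
      case 2
      then have n: "i \<notin> Y" "i \<notin> W1" "i \<notin> V1" using class_disj(1) by blast+
      define r where "r = \<sigma> j"
      have r: "r \<in> V1" "\<tau> r = j" using 2 \<sigma>_V1 \<tau>_\<sigma> by (auto simp: r_def)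
      have "r \<notin> W" using class_disj(2)[OF r(1)] by blast
      then have "H r i = H' j i" using n 2 r by (simp add: H_def merge_simps)
      then show ?thesis using n 2 by (simp add: contract_def unmerge_def r_def)
    next
      case 3
      then have n: "i \<notin> V0" "j \<notin> V0" "i \<notin> V" "i \<notin> V1" "j \<notin> V1" using V_W by blast+
      have 1: "H j i = H' j i" using n 3 by (simp add: H_def merge_simps)
      have 2: "H (unmerge j) (unmerge i) = 0" if "i \<in> W1" "j \<in> W1"
      proof -
        have "\<sigma> i \<in> V1" "\<sigma> j \<in> V1" using that \<sigma>_V1 by blast+
        then show ?thesis using that class_disj(2) by (auto simp: H_def unmerge_def)
      qed
      show ?thesis using 1 2 n 3 by (auto simp: contract_def)
    qed
  qed
  then have "nondeg P' R' (contract H) = nondeg P' R' H'"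
    by (intro nondeg_cong) (use fin' R'_P' trans_R' in auto)
  then show "frob_pattern TYPE('k) P R"
    using nondeg_contract_imp[OF n] nd by (auto simp: frob_pattern_def)
qed

end

section \<open>Relabelling and transposing patterns\<close>

lemma frob_pattern_iso_imp:
  assumes h: "bij_betw h P Q" and P: "finite P" "R \<subseteq> P \<times> P" and S: "S \<subseteq> Q \<times> Q"
    and RS: "\<And>i j. i \<in> P \<Longrightarrow> j \<in> P \<Longrightarrow> (i, j) \<in> R \<longleftrightarrow> (h i, h j) \<in> S"
    and fr: "frob_pattern TYPE('k::field) P R"
  shows "frob_pattern TYPE('k) Q S"
proof -
  obtain H :: "'k kmat" where nd: "nondeg P R H" using fr by (auto simp: frob_pattern_def)
  define g where "g = the_inv_into P h"
  have inj: "inj_on h P" and Q: "Q = h ` P" using h by (auto simp: bij_betw_def)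
  have gh: "g (h i) = i" if "i \<in> P" for i using that inj by (simp add: g_def the_inv_into_f_f)
  have fQ: "finite Q" using P Q by simp
  define G where "G a b = H (g a) (g b)" for a b
  have "nondeg Q S G"
    unfolding nondeg_def
  proof
    fix x assume "x \<in> radical Q S G"
    then have sx: "supported S x" and cx: "\<And>k l. (k, l) \<in> S \<Longrightarrow> mcomm Q G x l k = 0"
      using radical_iff[OF fQ S, of x G] by blast+
    define y where "y i j = (if i \<in> P \<and> j \<in> P then x (h i) (h j) else 0)" for i j
    have sy: "supported R y" using sx RS by (auto simp: supported_def y_def)
    have "mcomm P H y l k = mcomm Q G x (h l) (h k)" if "l \<in> P" "k \<in> P" for l k
    proof -
      have "(\<Sum>m\<in>Q. G (h l) m * x m (h k)) = (\<Sum>m\<in>P. H l m * y m k)"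
        using sum.reindex_bij_betw[OF h, of "\<lambda>m. G (h l) m * x m (h k)"] that
        by (simp add: G_def y_def gh)
      moreover have "(\<Sum>m\<in>Q. x (h l) m * G m (h k)) = (\<Sum>m\<in>P. y l m * H m k)"
        using sum.reindex_bij_betw[OF h, of "\<lambda>m. x (h l) m * G m (h k)"] that
        by (simp add: G_def y_def gh)
      ultimately show ?thesis by (simp add: mcomm_def mmul_def)
    qed
    then have "mcomm P H y l k = 0" if "(k, l) \<in> R" for k l using that P cx RS by auto
    then have "y \<in> radical P R H" using radical_iff[OF P, of y H] sy by blast
    then obtain c where c: "y = mscalar P c" using nd by (auto simp: nondeg_def)
    have "x a b = mscalar Q c a b" for a b
    proof (cases "a \<in> Q \<and> b \<in> Q")
      case True
      then obtain i j where ij: "i \<in> P" "j \<in> P" "a = h i" "b = h j" using Q by auto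
      then have "x a b = y i j" by (simp add: y_def)
      also have "\<dots> = mscalar Q c a b" using ij inj Q by (auto simp: c mscalar_def inj_on_def)
      finally show ?thesis .
    next
      case False
      then have "(a, b) \<notin> S" using S by blast
      then show ?thesis using sx False by (auto simp: supported_def mscalar_def)
    qed
    then show "\<exists>c. x = mscalar Q c" by (intro exI[of _ c] ext)
  qed
  then show ?thesis by (auto simp: frob_pattern_def)
qed

lemma frob_pattern_iso:
  assumes h: "bij_betw h P Q" and P: "finite P" "R \<subseteq> P \<times> P" and S: "S \<subseteq> Q \<times> Q"
    and RS: "\<And>i j. i \<in> P \<Longrightarrow> j \<in> P \<Longrightarrow> (i, j) \<in> R \<longleftrightarrow> (h i, h j) \<in> S"
  shows "frob_pattern TYPE('k::field) P R \<longleftrightarrow> frob_pattern TYPE('k) Q S"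
proof
  assume "frob_pattern TYPE('k) P R"
  then show "frob_pattern TYPE('k) Q S"
    by (intro frob_pattern_iso_imp[OF h P S]) (use RS in auto)
next
  let ?g = "the_inv_into P h"
  have inj: "inj_on h P" and Q: "Q = h ` P" using h by (auto simp: bij_betw_def)
  have g: "bij_betw ?g Q P" by (rule bij_betw_the_inv_into[OF h])
  have e: "(a, b) \<in> S \<longleftrightarrow> (?g a, ?g b) \<in> R" if ab: "a \<in> Q" "b \<in> Q" for a b
  proof -
    obtain i j where ij: "i \<in> P" "j \<in> P" "a = h i" "b = h j" using ab Q by auto
    then show ?thesis using RS[of i j] inj by (simp add: the_inv_into_f_f)
  qed
  assume "frob_pattern TYPE('k) Q S"
  then show "frob_pattern TYPE('k) P R"
    by (intro frob_pattern_iso_imp[OF g _ S P(2) e]) (use P Q in auto)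
qed

lemma frob_pattern_converse_imp:
  assumes P: "finite P" "R \<subseteq> P \<times> P" and fr: "frob_pattern TYPE('k::field) P R"
  shows "frob_pattern TYPE('k) P (R\<inverse>)"
proof -
  obtain H :: "'k kmat" where nd: "nondeg P R H" using fr by (auto simp: frob_pattern_def)
  let ?t = "\<lambda>x i j. x j i :: 'k"
  have P': "R\<inverse> \<subseteq> P \<times> P" using P by blast
  have "nondeg P (R\<inverse>) (?t H)"
    unfolding nondeg_def
  proof
    fix x assume "x \<in> radical P (R\<inverse>) (?t H)"
    then have sx: "supported (R\<inverse>) x" and cx: "\<And>k l. (k, l) \<in> R\<inverse> \<Longrightarrow> mcomm P (?t H) x l k = 0"
      using radical_iff[OF P(1) P', of x "?t H"] by blast+
    have "mcomm P H (?t x) l k = - mcomm P (?t H) x k l" for k l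
      by (simp add: mcomm_def mmul_def mult.commute)
    then have "mcomm P H (?t x) l k = 0" if "(k, l) \<in> R" for k l using cx[of l k] that by simp
    moreover have "supported R (?t x)" using sx by (auto simp: supported_def)
    ultimately have "?t x \<in> radical P R H" using radical_iff[OF P, of "?t x" H] by blast
    then obtain c where c: "?t x = mscalar P c" using nd by (auto simp: nondeg_def)
    have "x i j = mscalar P c i j" for i j using fun_cong[OF fun_cong[OF c, of j], of i] by (auto simp: mscalar_def)
    then show "\<exists>c. x = mscalar P c" by (intro exI[of _ c] ext)
  qed
  then show ?thesis by (auto simp: frob_pattern_def)
qed

lemma frob_pattern_converse:
  assumes P: "finite P" "R \<subseteq> P \<times> P"
  shows "frob_pattern TYPE('k::field) P (R\<inverse>) \<longleftrightarrow> frob_pattern TYPE('k) P R"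
  using frob_pattern_converse_imp[OF P] frob_pattern_converse_imp[OF P(1), of "R\<inverse>"] P by (metis converse_converse converse_mono converse_Times)

section \<open>The pattern of a pair of compositions\<close>

text \<open>The boundaries between the parts, together with 0 and the sum. A part 0, as contraction may
produce it, adds no boundary.\<close>

definition prefix_sum :: "nat list \<Rightarrow> nat \<Rightarrow> bool" where
  "prefix_sum l s \<longleftrightarrow> (\<exists>u v. l = u @ v \<and> sum_list u = s)"

lemma prefix_sum_Nil [simp]: "prefix_sum [] s \<longleftrightarrow> s = 0"
  by (auto simp: prefix_sum_def)

lemma prefix_sum_0 [simp]: "prefix_sum l 0"
  unfolding prefix_sum_def by (metis append_Nil sum_list.Nil)

lemma prefix_sum_sum [simp]: "prefix_sum l (sum_list l)"
  unfolding prefix_sum_def by (metis append_Nil2)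

lemma prefix_sum_Cons: "prefix_sum (x # l) s \<longleftrightarrow> s = 0 \<or> (\<exists>t. prefix_sum l t \<and> s = x + t)"
proof
  assume "prefix_sum (x # l) s"
  then obtain u v where "x # l = u @ v" "sum_list u = s" by (auto simp: prefix_sum_def)
  then show "s = 0 \<or> (\<exists>t. prefix_sum l t \<and> s = x + t)" by (cases u) (auto simp: prefix_sum_def)
next
  assume "s = 0 \<or> (\<exists>t. prefix_sum l t \<and> s = x + t)"
  then consider "s = 0" | t u v where "l = u @ v" "sum_list u = t" "s = x + t" by (auto simp: prefix_sum_def)
  then show "prefix_sum (x # l) s"
  proof cases
    case 2
    then have "x # l = (x # u) @ v" "sum_list (x # u) = s" by auto
    then show ?thesis unfolding prefix_sum_def by blast
  qed simp
qed

lemma prefix_sum_append: "prefix_sum (u @ v) s \<longleftrightarrow> prefix_sum u s \<or> (\<exists>t. prefix_sum v t \<and> s = sum_list u + t)"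
proof (induction u arbitrary: s)
  case Nil
  then show ?case by auto
next
  case (Cons x u)
  show ?case by (auto simp: prefix_sum_Cons Cons)
qed

lemma prefix_sum_le: "prefix_sum l s \<Longrightarrow> s \<le> sum_list l"
  by (auto simp: prefix_sum_def)

lemma prefix_sum_rev: "prefix_sum (rev l) s \<longleftrightarrow> s \<le> sum_list l \<and> prefix_sum l (sum_list l - s)"
proof -
  have "prefix_sum (rev l) s \<Longrightarrow> s \<le> sum_list l \<and> prefix_sum l (sum_list l - s)" for l s
  proof -
    assume "prefix_sum (rev l) s"
    then obtain u v where uv: "rev l = u @ v" "sum_list u = s" by (auto simp: prefix_sum_def)
    then have "l = rev v @ rev u" by (metis rev_append rev_rev_ident)
    then show "s \<le> sum_list l \<and> prefix_sum l (sum_list l - s)" using uv by (auto simp: prefix_sum_append)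
  qed
  from this[of l s] this[of "rev l" "sum_list l - s"] show ?thesis by auto
qed

definition separated :: "nat list \<Rightarrow> nat \<Rightarrow> nat \<Rightarrow> bool" where
  "separated l i j \<longleftrightarrow> (\<exists>s. prefix_sum l s \<and> i < s \<and> s \<le> j)"

lemma separated_trans: "separated l i k \<Longrightarrow> separated l i j \<or> separated l j k"
  unfolding separated_def by (meson linorder_not_le)

lemma separated_less: "separated l i j \<Longrightarrow> i < j"
  by (auto simp: separated_def)

lemma separated_Cons_le: "separated (x # l) i j \<Longrightarrow> x \<le> j"
  by (auto simp: separated_def prefix_sum_Cons)

lemma not_separated_first: "j < x \<Longrightarrow> \<not> separated (x # l) i j"
  using separated_Cons_le by fastforce

lemma not_separated_ge: "j \<le> i \<Longrightarrow> \<not> separated l i j"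
  using separated_less by fastforce

lemma separated_ConsI: "i < x \<Longrightarrow> x \<le> j \<Longrightarrow> separated (x # l) i j"
  unfolding separated_def prefix_sum_Cons by (intro exI[of _ x]) auto

text \<open>The pairs \<open>(i, j)\<close> such that the entry at row \<open>i\<close> and column \<open>j\<close> may be nonzero: a
boundary of \<open>a\<close> forbids entries below the diagonal, and a boundary of \<open>b\<close> those above.\<close>

definition pattern :: "nat list \<Rightarrow> nat list \<Rightarrow> (nat \<times> nat) set" where
  "pattern a b = {(i, j). i < sum_list a \<and> j < sum_list a \<and> \<not> separated b i j \<and> \<not> separated a j i}"

lemma pattern_subset: "pattern a b \<subseteq> {..<sum_list a} \<times> {..<sum_list a}"
  by (auto simp: pattern_def)

lemma pattern_refl: "\<forall>i\<in>{..<sum_list a}. (i, i) \<in> pattern a b"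
  by (auto simp: pattern_def dest: separated_less)

lemma pattern_trans: "trans (pattern a b)"
  by (rule transI) (auto simp: pattern_def dest: separated_trans)

definition frob :: "'k::field itself \<Rightarrow> nat list \<Rightarrow> nat list \<Rightarrow> bool" where
  "frob ty a b \<longleftrightarrow> frob_pattern ty {..<sum_list a} (pattern a b)"

lemma frob_swap:
  assumes "sum_list a = sum_list b"
  shows "frob TYPE('k::field) a b \<longleftrightarrow> frob TYPE('k) b a"
proof -
  have "pattern b a = (pattern a b)\<inverse>" using assms by (auto simp: pattern_def)
  then show ?thesis unfolding frob_def using assms frob_pattern_converse[OF finite_lessThan pattern_subset, of a b, where 'k = 'k] by simp
qed

lemma separated_rev:
  assumes "i < sum_list l" "j < sum_list l"
  shows "separated (rev l) (sum_list l - 1 - i) (sum_list l - 1 - j) \<longleftrightarrow> separated l j i"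
proof
  assume "separated (rev l) (sum_list l - 1 - i) (sum_list l - 1 - j)"
  then obtain s where "s \<le> sum_list l" "prefix_sum l (sum_list l - s)" "sum_list l - 1 - i < s" "s \<le> sum_list l - 1 - j"
    by (auto simp: separated_def prefix_sum_rev)
  then show "separated l j i" unfolding separated_def by (intro exI[of _ "sum_list l - s"]) (use assms in auto)
next
  assume "separated l j i"
  then obtain s where "prefix_sum l s" "j < s" "s \<le> i" by (auto simp: separated_def)
  then show "separated (rev l) (sum_list l - 1 - i) (sum_list l - 1 - j)"
    unfolding separated_def prefix_sum_rev by (intro exI[of _ "sum_list l - s"]) (use assms prefix_sum_le[of l s] in auto)
qed

text \<open>Reversing the order of the positions exchanges upper and lower entries, so it yields the reversed
compositions with exchanged roles; this is undone by transposing.\<close>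

lemma frob_rev:
  assumes "sum_list a = sum_list b"
  shows "frob TYPE('k::field) (rev a) (rev b) \<longleftrightarrow> frob TYPE('k) a b"
proof -
  let ?n = "sum_list a"
  have "frob_pattern TYPE('k) {..<?n} (pattern b a) \<longleftrightarrow> frob_pattern TYPE('k) {..<?n} (pattern (rev a) (rev b))"
  proof (rule frob_pattern_iso[where h = "\<lambda>i. ?n - 1 - i"])
    show "bij_betw (\<lambda>i. ?n - 1 - i) {..<?n} {..<?n}"
      by (rule bij_betwI[of _ _ _ "\<lambda>i. ?n - 1 - i"]) auto
    show "pattern b a \<subseteq> {..<?n} \<times> {..<?n}" using pattern_subset[of b a] assms by simp
    show "pattern (rev a) (rev b) \<subseteq> {..<?n} \<times> {..<?n}" using pattern_subset[of "rev a" "rev b"] by simp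
    show "((i, j) \<in> pattern b a) = ((?n - 1 - i, ?n - 1 - j) \<in> pattern (rev a) (rev b))"
      if "i \<in> {..<?n}" "j \<in> {..<?n}" for i j
      using that separated_rev[of i b j] separated_rev[of j a i] assms by (auto simp: pattern_def)
  qed simp
  then show ?thesis using frob_swap[OF assms, where 'k = 'k] assms by (simp add: frob_def)
qed

lemma frob_zero: "frob TYPE('k::field) a (0 # b) \<longleftrightarrow> frob TYPE('k) a b"
proof -
  have "separated (0 # b) = separated b" by (auto simp: separated_def prefix_sum_Cons fun_eq_iff)
  then show ?thesis by (simp add: frob_def pattern_def)
qed

lemma frob_zero': "frob TYPE('k::field) (0 # a) b \<longleftrightarrow> frob TYPE('k) a b"
proof -
  have "separated (0 # a) = separated a" by (auto simp: separated_def prefix_sum_Cons fun_eq_iff)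
  then show ?thesis by (simp add: frob_def pattern_def)
qed

text \<open>The diagonal idempotent of the first \<open>m\<close> positions is central, hence in every radical.\<close>

lemma not_frob_common_boundary:
  assumes "prefix_sum a m" "prefix_sum b m" "0 < m" "m < sum_list a"
  shows "\<not> frob TYPE('k::field) a b"
proof
  assume "frob TYPE('k) a b"
  then obtain H :: "'k kmat" where nd: "nondeg {..<sum_list a} (pattern a b) H" by (auto simp: frob_def frob_pattern_def)
  let ?P = "{..<sum_list a}"
  let ?x = "mscalar {..<m} (1 :: 'k)"
  have side: "k < m \<longleftrightarrow> l < m" if "(k, l) \<in> pattern a b" for k l
    using that assms unfolding pattern_def separated_def by (metis (mono_tags, lifting) case_prodD mem_Collect_eq not_le)
  have "supported (pattern a b) ?x" using pattern_refl assms(4) by (auto simp: supported_def mscalar_def)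
  moreover have "mcomm ?P H ?x l k = 0" if kl: "(k, l) \<in> pattern a b" for k l
  proof -
    have "k \<in> ?P" "l \<in> ?P" using kl pattern_subset by blast+
    moreover have "(\<Sum>j\<in>?P. H l j * ?x j k) = (\<Sum>j\<in>?P. if j = k then (if k < m then H l k else 0) else 0)"
      by (intro sum.cong) (auto simp: mscalar_def)
    moreover have "(\<Sum>j\<in>?P. ?x l j * H j k) = (\<Sum>j\<in>?P. if j = l then (if l < m then H l k else 0) else 0)"
      by (intro sum.cong) (auto simp: mscalar_def)
    ultimately show ?thesis using side[OF kl] by (simp add: mcomm_def mmul_def)
  qed
  ultimately have "?x \<in> radical ?P (pattern a b) H" using radical_iff[OF finite_lessThan pattern_subset, of ?x a b H] by blast
  then obtain c where c: "?x = mscalar ?P c" using nd by (auto simp: nondeg_def)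
  have "c = 1" using fun_cong[OF fun_cong[OF c, of 0], of 0] assms by (simp add: mscalar_def)
  moreover have "c = 0" using fun_cong[OF fun_cong[OF c, of m], of m] assms by (simp add: mscalar_def)
  ultimately show False by simp
qed

text \<open>For the full matrix algebra, \<open>H\<close> commutes with itself and so lies in the radical. If \<open>H\<close> is a scalar
matrix, the form is zero.\<close>

lemma not_frob_full:
  assumes "2 \<le> n"
  shows "\<not> frob TYPE('k::field) [n] [n]"
proof
  assume "frob TYPE('k) [n] [n]"
  then obtain H :: "'k kmat" where nd: "nondeg {..<n} (pattern [n] [n]) H" by (auto simp: frob_def frob_pattern_def)
  let ?P = "{..<n}"
  have pattern: "pattern [n] [n] = ?P \<times> ?P" by (auto simp: pattern_def dest: separated_Cons_le)
  define x where "x i j = (if i < n \<and> j < n then H i j else 0)" for i j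
  have "mcomm ?P H x l k = 0" if "l \<in> ?P" "k \<in> ?P" for k l
    using that by (simp add: mcomm_def mmul_def x_def)
  moreover have "supported (?P \<times> ?P) x" by (auto simp: supported_def x_def)
  ultimately have "x \<in> radical ?P (?P \<times> ?P) H" using radical_iff[of ?P "?P \<times> ?P" x H] by blast
  then obtain c where c: "x = mscalar ?P c" using nd pattern by (auto simp: nondeg_def)
  have H: "H i j = (if i = j then c else 0)" if "i < n" "j < n" for i j
    using fun_cong[OF fun_cong[OF c, of i], of j] that by (auto simp: x_def mscalar_def)
  have "mcomm ?P H (munit 0 0) l k = 0" if "l < n" "k < n" for k l
  proof -
    have "(\<Sum>j<n. H l j * munit 0 0 j k) = (\<Sum>j<n. if j = l then (if l = 0 \<and> k = 0 then c else 0) else 0)"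
      using that by (intro sum.cong) (auto simp: H munit_def)
    moreover have "(\<Sum>j<n. munit 0 0 l j * H j k) = (\<Sum>j<n. if j = l then (if l = 0 \<and> k = 0 then c else 0) else 0)"
      using that by (intro sum.cong) (auto simp: H munit_def)
    ultimately show ?thesis by (simp add: mcomm_def mmul_def)
  qed
  moreover have "supported (?P \<times> ?P) (munit 0 0 :: 'k kmat)" using assms by (intro supported_munit) auto
  ultimately have "(munit 0 0 :: 'k kmat) \<in> radical ?P (?P \<times> ?P) H" using radical_iff[of ?P "?P \<times> ?P" "munit 0 0" H] by blast
  then obtain c' where c': "(munit 0 0 :: 'k kmat) = mscalar ?P c'" using nd pattern by (auto simp: nondeg_def)
  have "c' = 1" using fun_cong[OF fun_cong[OF c', of 0], of 0] assms by (simp add: mscalar_def munit_def)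
  moreover have "c' = 0" using fun_cong[OF fun_cong[OF c', of 1], of 1] assms by (simp add: mscalar_def munit_def)
  ultimately show False by simp
qed

lemma frob_one: "frob TYPE('k::field) [1] [1]"
proof -
  have "nondeg {..<1} (pattern [1] [1]) (0 :: 'k kmat)"
    unfolding nondeg_def
  proof
    fix x :: "'k kmat" assume "x \<in> radical {..<1} (pattern [1] [1]) 0"
    then have "supported (pattern [1] [1]) x" by (simp add: radical_def)
    then have "supported ({..<1} \<times> {..<1}) x" using supported_mono[OF _ pattern_subset, of "[1]" "[1]" x] by simp
    then have "x i j = mscalar {..<1} (x 0 0) i j" for i j
      by (cases "i = 0 \<and> j = 0") (auto simp: supported_def mscalar_def)
    then show "\<exists>c. x = mscalar {..<1} c" by (intro exI[of _ "x 0 0"] ext)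
  qed
  then show ?thesis by (auto simp: frob_def frob_pattern_def)
qed

text \<open>The case \<open>2 * a1 \<le> b1\<close> (with \<open>k = a1\<close>) and the case \<open>b1 < 2 * a1\<close> (with \<open>k = b1 - a1\<close>) are treated
together; in each of them one of the two new first parts is zero.\<close>

lemma frob_contract:
  assumes sums: "sum_list (a1 # a) = sum_list (b1 # b)" and ab: "0 < a1" "a1 < b1"
  defines "k \<equiv> min a1 (b1 - a1)"
  shows "frob TYPE('k::field_char_0) (a1 # a) (b1 # b) \<longleftrightarrow>
    frob TYPE('k) ((a1 - k) # a) ((b1 - a1 - k) # a1 # b)"
proof -
  let ?n = "sum_list (a1 # a)"
  let ?a = "a1 # a" and ?b = "b1 # b"
  let ?a' = "(a1 - k) # a" and ?b' = "(b1 - a1 - k) # a1 # b"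
  let ?V0 = "{..<a1 - k}" and ?V1 = "{a1 - k..<a1}" and ?W0 = "{a1..<b1 - k}" and ?W1 = "{b1 - k..<b1}"
    and ?Z = "{b1..<?n}"
  let ?R = "pattern ?a ?b"
  have k: "0 < k" "k \<le> a1" "k \<le> b1 - a1" "k = a1 \<or> k = b1 - a1" using ab by (auto simp: k_def)
  have bn: "b1 \<le> ?n" using sums by simp
  interpret ideal_contraction "{..<?n}" ?R ?V0 ?V1 ?W0 ?W1 ?Z "\<lambda>i. i + (b1 - a1)"
  proof
    show "{..<?n} = ?V0 \<union> ?V1 \<union> ?W0 \<union> ?W1 \<union> ?Z" using ab k bn by auto
    show "?R \<subseteq> {..<?n} \<times> {..<?n}" by (rule pattern_subset)
    show "\<forall>i\<in>{..<?n}. (i, i) \<in> ?R" by (rule pattern_refl)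
    show "trans ?R" by (rule pattern_trans)
    show "bij_betw (\<lambda>i. i + (b1 - a1)) ?V1 ?W1"
      by (rule bij_betwI[of _ _ _ "\<lambda>i. i - (b1 - a1)"]) (use ab k in auto)
    show "(?V0 \<union> ?V1) \<times> (?V0 \<union> ?V1) \<subseteq> ?R" "(?V0 \<union> ?V1) \<times> (?W0 \<union> ?W1) \<subseteq> ?R" "?W0 \<times> ?W1 \<subseteq> ?R"
      using ab k bn by (auto simp: pattern_def not_separated_first not_separated_ge)
    show "((?W0 \<union> ?W1 \<union> ?Z) \<times> (?V0 \<union> ?V1)) \<inter> ?R = {}"
      using ab k by (auto simp: pattern_def separated_ConsI)
    show "((?V0 \<union> ?V1) \<times> ?Z) \<inter> ?R = {}" "((?W0 \<union> ?W1) \<times> ?Z) \<inter> ?R = {}"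
      using ab k by (auto simp: pattern_def separated_ConsI)
    show "?V0 = {} \<or> ?W0 = {}" using k by auto
  qed (use ab k in auto)
  \<comment> \<open>The positions in \<open>V1\<close> disappear, and the later ones move down by \<open>k\<close>.\<close>
  let ?h = "\<lambda>i. if i < a1 - k then i else i - k"
  have P'e: "P' = {..<a1 - k} \<union> {a1..<?n}"
    unfolding P'_def using ab k bn by auto
  then have P'_mem: "i \<in> P' \<longleftrightarrow> i < a1 - k \<or> a1 \<le> i \<and> i < ?n" for i by auto
  have sn: "sum_list ?a' = ?n - k" using k by simp
  have h: "bij_betw ?h P' {..<?n - k}"
    by (rule bij_betwI[of _ _ _ "\<lambda>i. if i < a1 - k then i else i + k"])
      (unfold P'e, use ab k bn in auto)
  have lt: "?h i < s - k \<longleftrightarrow> i < s" if "i \<in> P'" "a1 \<le> s" for i s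
    using that k unfolding P'_mem by auto
  have sa: "separated ?a' (?h i) (?h j) \<longleftrightarrow> separated ?a i j" if i: "i \<in> P'" and j: "j \<in> P'" for i j
  proof
    assume "separated ?a i j"
    then obtain s where s: "prefix_sum ?a s" "i < s" "s \<le> j" by (auto simp: separated_def)
    then obtain t where t: "prefix_sum a t" "s = a1 + t" by (auto simp: prefix_sum_Cons)
    have "prefix_sum ?a' (s - k)" unfolding prefix_sum_Cons using t k by auto
    then show "separated ?a' (?h i) (?h j)" unfolding separated_def
      by (intro exI[of _ "s - k"]) (use lt[OF i, of s] lt[OF j, of s] s t in auto)
  next
    assume "separated ?a' (?h i) (?h j)"
    then obtain s where s: "prefix_sum ?a' s" "?h i < s" "s \<le> ?h j" by (auto simp: separated_def)
    then obtain t where t: "prefix_sum a t" "s = a1 - k + t" by (auto simp: prefix_sum_Cons)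
    have "prefix_sum ?a (s + k)" unfolding prefix_sum_Cons using t k by auto
    then show "separated ?a i j" unfolding separated_def
      by (intro exI[of _ "s + k"]) (use lt[OF i, of "s + k"] lt[OF j, of "s + k"] s t k in auto)
  qed
  \<comment> \<open>The contraction adds one boundary to the second composition, the one between \<open>W0\<close> and \<open>W1\<close>.\<close>
  have sb: "separated ?b' (?h i) (?h j) \<longleftrightarrow> separated ?b i j \<or> (i, j) \<in> ?W0 \<times> ?W1" if i: "i \<in> P'" and j: "j \<in> P'" for i j
  proof
    assume "separated ?b i j \<or> (i, j) \<in> ?W0 \<times> ?W1"
    then show "separated ?b' (?h i) (?h j)"
    proof
      assume "separated ?b i j"
      then obtain s where s: "prefix_sum ?b s" "i < s" "s \<le> j" by (auto simp: separated_def)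
      then obtain t where t: "prefix_sum b t" "s = b1 + t" by (auto simp: prefix_sum_Cons)
      have "s - k = (b1 - a1 - k) + (a1 + t)" using t k by simp
      then have "prefix_sum ?b' (s - k)" unfolding prefix_sum_Cons using t by blast
      then show "separated ?b' (?h i) (?h j)" unfolding separated_def
        by (intro exI[of _ "s - k"]) (use lt[OF i, of s] lt[OF j, of s] s t ab in auto)
    next
      assume w: "(i, j) \<in> ?W0 \<times> ?W1"
      then have "k = a1" using k by auto
      then show "separated ?b' (?h i) (?h j)" using w k by (intro separated_ConsI) auto
    qed
  next
    assume "separated ?b' (?h i) (?h j)"
    then obtain s where s: "prefix_sum ?b' s" "?h i < s" "s \<le> ?h j" by (auto simp: separated_def)
    then consider "s = b1 - a1 - k" | t where "prefix_sum b t" "s = b1 - k + t"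
      using k ab by (auto simp: prefix_sum_Cons)
    then show "separated ?b i j \<or> (i, j) \<in> ?W0 \<times> ?W1"
    proof cases
      case 1
      then have "k = a1" using s k by auto
      then have "a1 \<le> i" "i < b1 - k" "b1 - k \<le> j" using i j s 1 k ab unfolding P'_mem by auto
      then show ?thesis using separated_ConsI[of i b1 j b] by (cases "j < b1") auto
    next
      case 2
      have "prefix_sum ?b (s + k)" unfolding prefix_sum_Cons using 2 k by auto
      moreover have "i < s + k" "s + k \<le> j" using lt[OF i, of "s + k"] lt[OF j, of "s + k"] s 2 ab k by auto
      ultimately show ?thesis unfolding separated_def by blast
    qed
  qed
  have "frob_pattern TYPE('k) P' R' \<longleftrightarrow> frob_pattern TYPE('k) {..<?n - k} (pattern ?a' ?b')"
  proof (rule frob_pattern_iso[OF h])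
    show "finite P'" by (rule fin'(6))
    show "R' \<subseteq> P' \<times> P'" by (rule R'_P')
    show "pattern ?a' ?b' \<subseteq> {..<?n - k} \<times> {..<?n - k}" using pattern_subset[of ?a' ?b'] unfolding sn .
    fix i j assume ij: "i \<in> P'" "j \<in> P'"
    have lt': "?h i < ?n - k" "?h j < ?n - k" using bij_betwE[OF h] ij by blast+
    have "i < ?n" "j < ?n" using ij P'_P(1) by blast+
    then show "((i, j) \<in> R') = ((?h i, ?h j) \<in> pattern ?a' ?b')"
      unfolding R'_def using ij lt' sa[OF ij(2,1)] sb[OF ij] sn by (auto simp: pattern_def)
  qed
  then show ?thesis using frob_pattern_contract[where 'k = 'k] unfolding frob_def sn by simp
qed

section \<open>The index of a seaweed subalgebra\<close>

text \<open>Subspaces of matrix spaces are finitely generated, by induction on the set of positions where a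
nonzero entry is possible. Without a finite generating set, the dimension as it is defined would
be an unspecified number.\<close>

lemma matrix_subspace_finite_span:
  fixes W :: "'k::field mat set"
  assumes "finite S" and W: "W \<subseteq> carrier_mat n n" "0\<^sub>m n n \<in> W"
    and add: "\<And>A B. A \<in> W \<Longrightarrow> B \<in> W \<Longrightarrow> A + B \<in> W" and smult: "\<And>c A. A \<in> W \<Longrightarrow> c \<cdot>\<^sub>m A \<in> W"
    and S: "\<And>A i j. A \<in> W \<Longrightarrow> i < n \<Longrightarrow> j < n \<Longrightarrow> (i, j) \<notin> S \<Longrightarrow> A $$ (i, j) = 0"
  shows "\<exists>B. finite B \<and> B \<subseteq> W \<and> W \<subseteq> LinearCombinations.module.span class_ring (module_mat TYPE('k) n n) B"
  using assms
proof (induction S arbitrary: W rule: finite_induct)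
  case empty
  interpret V: vectorspace "class_ring :: 'k ring" "module_mat TYPE('k) n n" by (rule matrix_vs)
  have "A = 0\<^sub>m n n" if "A \<in> W" for A
  proof -
    have "A \<in> carrier_mat n n" using empty.prems(1) that by blast
    moreover have "A $$ (i, j) = 0" if "i < n" "j < n" for i j
      using empty.prems(5)[OF \<open>A \<in> W\<close> that] by simp
    ultimately show ?thesis by (intro eq_matI) simp_all
  qed
  moreover have "0\<^sub>m n n \<in> V.span {0\<^sub>m n n}"
    using V.in_own_span[of "{0\<^sub>m n n}"] by (simp add: module_mat_simps)
  ultimately show ?case using empty.prems(2) by (intro exI[of _ "{0\<^sub>m n n}"]) blast
next
  case (insert p S)
  interpret V: vectorspace "class_ring :: 'k ring" "module_mat TYPE('k) n n" by (rule matrix_vs)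
  obtain i j where p: "p = (i, j)" by (cases p)
  show ?case
  proof (cases "\<exists>A\<in>W. i < n \<and> j < n \<and> A $$ (i, j) \<noteq> 0")
    case False
    then show ?thesis
      by (intro insert.IH[OF insert.prems(1-4)]) (use insert.prems(5) p in auto)
  next
    case True
    then obtain A0 where A0: "A0 \<in> W" "i < n" "j < n" "A0 $$ (i, j) \<noteq> 0" by blast
    let ?W = "{A \<in> W. A $$ (i, j) = 0}"
    have c: "A \<in> carrier_mat n n" if "A \<in> W" for A using that insert.prems(1) by blast
    have "\<exists>B. finite B \<and> B \<subseteq> ?W \<and> ?W \<subseteq> V.span B"
    proof (rule insert.IH)
      show "?W \<subseteq> carrier_mat n n" using c by blast
      show "0\<^sub>m n n \<in> ?W" using insert.prems(2) A0 by simp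
      show "A + B \<in> ?W" if "A \<in> ?W" "B \<in> ?W" for A B
        using that insert.prems(3) A0 c[of A] c[of B] by simp
      show "c \<cdot>\<^sub>m A \<in> ?W" if "A \<in> ?W" for c' c A
        using that insert.prems(4) A0 c[of A] by simp
      show "A $$ (i', j') = 0" if "A \<in> ?W" "i' < n" "j' < n" "(i', j') \<notin> S" for A i' j'
        using that insert.prems(5)[of A i' j'] p by (cases "(i', j') = (i, j)") auto
    qed
    then obtain B where B: "finite B" "B \<subseteq> ?W" "?W \<subseteq> V.span B" by blast
    let ?B = "insert A0 B"
    have Bc: "?B \<subseteq> carrier (module_mat TYPE('k) n n)"
      using B A0 c by (auto simp: module_mat_simps)
    interpret sp: submodule "class_ring :: 'k ring" "V.span ?B" "module_mat TYPE('k) n n"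
      by (rule V.span_is_submodule[OF Bc])
    have "A \<in> V.span ?B" if A: "A \<in> W" for A
    proof -
      let ?c = "A $$ (i, j) / A0 $$ (i, j)"
      let ?A = "A + (- ?c) \<cdot>\<^sub>m A0"
      have "?A \<in> ?W" using A A0 insert.prems(3,4) c[OF A] c[OF A0(1)] by simp
      then have 1: "?A \<in> V.span ?B" using B(3) V.span_is_monotone[of B ?B] by blast
      have "A0 \<in> V.span ?B" using V.in_own_span[OF Bc] by blast
      then have 2: "?c \<cdot>\<^sub>m A0 \<in> V.span ?B" using sp.smult_closed[of ?c A0] by (simp add: module_mat_simps class_ring_simps)
      have "?A + ?c \<cdot>\<^sub>m A0 = A"
        by (rule eq_matI) (use c[OF A] c[OF A0(1)] in auto)
      moreover have "?A + ?c \<cdot>\<^sub>m A0 \<in> V.span ?B" using sp.m_closed[OF 1 2] by (simp add: module_mat_simps)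
      ultimately show ?thesis by simp
    qed
    then show ?thesis using B A0 by (intro exI[of _ ?B]) auto
  qed
qed

lemma sub_dim_eq_0_iff:
  fixes W :: "'k::field mat set"
  assumes W: "VectorSpace.subspace class_ring W (module_mat TYPE('k) n n)"
  shows "sub_dim n W = 0 \<longleftrightarrow> W = {0\<^sub>m n n}"
proof -
  interpret V: vectorspace "class_ring :: 'k ring" "module_mat TYPE('k) n n" by (rule matrix_vs)
  interpret S: submodule "class_ring :: 'k ring" W "module_mat TYPE('k) n n"
    using W by (rule VectorSpace.subspace.submod)
  have sm: "submodule class_ring W (module_mat TYPE('k) n n)" by (rule S.submodule_axioms)
  interpret W: vectorspace "class_ring :: 'k ring" "V.vs W" by (rule V.subspace_is_vs[OF W])
  have car: "W \<subseteq> carrier_mat n n" using S.subset by (simp add: module_mat_simps)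
  obtain B where B: "finite B" "B \<subseteq> W" "W \<subseteq> V.span B"
    using matrix_subspace_finite_span[of "{..<n} \<times> {..<n}" W n] car S.zero_closed S.m_closed S.smult_closed
    by (auto simp: module_mat_simps class_ring_simps)
  have gen: "W.span C = V.span C" if "C \<subseteq> W" for C
    by (rule V.span_li_not_depend(1)[OF that sm])
  have "W.gen_set B" using B gen[OF B(2)] V.span_is_subset[OF B(2) sm] by auto
  then have ex: "\<exists>m C. finite C \<and> card C = m \<and> C \<subseteq> carrier (V.vs W) \<and> W.gen_set C"
    using B by auto
  have empty: "W.span {} = {0\<^sub>m n n}" by (simp add: W.span_empty module_mat_simps)
  show ?thesis
  proof
    assume "sub_dim n W = 0"
    then have "W.dim = 0" by (simp add: sub_dim_def)
    then obtain C where "finite C" "card C = 0" "W.gen_set C"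
      using LeastI_ex[OF ex] unfolding W.dim_def by auto
    then show "W = {0\<^sub>m n n}" using empty by simp
  next
    assume "W = {0\<^sub>m n n}"
    then have "W.gen_set {}" using empty by simp
    then have "W.dim = 0" unfolding W.dim_def by (intro Least_eq_0 exI[of _ "{}"]) auto
    then show "sub_dim n W = 0" by (simp add: sub_dim_def)
  qed
qed

text \<open>The minimum that defines the index is attained, so it is zero iff some stabilizer is trivial.\<close>

lemma frobenius_iff:
  fixes g :: "'k::field mat set"
  assumes g: "VectorSpace.subspace class_ring g (module_mat TYPE('k) n n)"
    and br: "\<And>A B. A \<in> g \<Longrightarrow> B \<in> g \<Longrightarrow> lie_bracket A B \<in> g"
  shows "frobenius n g \<longleftrightarrow> (\<exists>f. linear_form g f \<and> form_stabilizer g f = {0\<^sub>m n n})"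
proof -
  have z: "sub_dim n (form_stabilizer g f) = 0 \<longleftrightarrow> form_stabilizer g f = {0\<^sub>m n n}" if "linear_form g f" for f
    by (rule sub_dim_eq_0_iff[OF subspace_form_stabilizer[OF g br that]])
  show ?thesis
  proof
    assume "frobenius n g"
    then show "\<exists>f. linear_form g f \<and> form_stabilizer g f = {0\<^sub>m n n}"
      using lie_index_attained[of g n] z unfolding frobenius_def by metis
  next
    assume "\<exists>f. linear_form g f \<and> form_stabilizer g f = {0\<^sub>m n n}"
    then show "frobenius n g"
      using lie_index_le[of g _ n] z unfolding frobenius_def by (metis le_zero_eq)
  qed
qed

text \<open>Block numbers are compared through the boundaries that separate two positions.\<close>

lemma block_of_less_iff:
  assumes "i < sum_list a" "j < sum_list a"
  shows "block_of a j < block_of a i \<longleftrightarrow> separated a j i"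
proof -
  have ex: "\<exists>k. l < sum_list (take (Suc k) a)" if "l < sum_list a" for l
    using that by (intro exI[of _ "length a"]) simp
  have mono: "sum_list (take k a) \<le> sum_list (take k' a)" if "k \<le> k'" for k k'
  proof -
    have "take k' a = take k a @ take (k' - k) (drop k a)" using that by (metis le_add_diff_inverse take_add)
    then show ?thesis by simp
  qed
  have b: "l < sum_list (take (Suc (block_of a l)) a)" if "l < sum_list a" for l
    unfolding block_of_def by (rule LeastI_ex[OF ex[OF that]])
  have b': "block_of a l \<le> k" if "l < sum_list (take (Suc k) a)" for l k
    unfolding block_of_def using that by (rule Least_le[where P = "\<lambda>k. l < sum_list (take (Suc k) a)"])
  show ?thesis
  proof
    assume lt: "block_of a j < block_of a i"
    let ?s = "sum_list (take (Suc (block_of a j)) a)"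
    have "prefix_sum a ?s" unfolding prefix_sum_def by (metis append_take_drop_id)
    moreover have "j < ?s" by (rule b[OF assms(2)])
    moreover have "?s \<le> i" using b'[of i "block_of a j"] lt by (meson not_le)
    ultimately show "separated a j i" unfolding separated_def by blast
  next
    assume "separated a j i"
    then obtain u v where uv: "a = u @ v" "j < sum_list u" "sum_list u \<le> i" by (auto simp: separated_def prefix_sum_def)
    then obtain k where k: "length u = Suc k" by (cases u) auto
    have u: "take (Suc k) a = u" using uv(1) k by simp
    have "block_of a j \<le> k" using b'[of j k] uv(2) by (simp only: u)
    moreover have "\<not> block_of a i \<le> k"
      
    proof
      assume "block_of a i \<le> k"
      then have "sum_list (take (Suc (block_of a i)) a) \<le> sum_list u" using mono[of "Suc (block_of a i)" "Suc k"] by (simp only: u Suc_le_mono)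
      then show False using b[OF assms(1)] uv(3) by simp
    qed
    ultimately show "block_of a j < block_of a i" by simp
  qed
qed

definition mat_of :: "nat \<Rightarrow> 'k::field kmat \<Rightarrow> 'k mat" where
  "mat_of n x = mat n n (\<lambda>(i, j). x i j)"

definition entries :: "nat \<Rightarrow> 'k::field mat \<Rightarrow> 'k kmat" where
  "entries n A = (\<lambda>i j. if i < n \<and> j < n then A $$ (i, j) else 0)"

lemma mem_seaweed_entries:
  fixes A :: "'k::field mat"
  assumes "sum_list a = n" "sum_list b = n"
  shows "A \<in> seaweed a b \<longleftrightarrow> A \<in> carrier_mat n n \<and> supported (pattern a b) (entries n A) \<and> mtrace {..<n} (entries n A) = 0"
proof -
  have t: "mtrace {..<n} (entries n A) = trace A" if "A \<in> carrier_mat n n"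
    using that by (auto simp: mtrace_def entries_def trace_def)
  have tt: "trace (transpose_mat A) = trace A" if "A \<in> carrier_mat n n"
    using that by (auto simp: trace_def)
  have s: "supported (pattern a b) (entries n A) \<longleftrightarrow>
    (\<forall>i<n. \<forall>j<n. separated a j i \<longrightarrow> A $$ (i, j) = 0) \<and> (\<forall>i<n. \<forall>j<n. separated b j i \<longrightarrow> A $$ (j, i) = 0)"
    using assms unfolding supported_def entries_def pattern_def by auto
  show ?thesis
    unfolding mem_seaweed_iff parabolic_def sl_def
    using assms t tt s by (auto simp: block_of_less_iff)
qed

lemma entries_mat_of: "supported ({..<n} \<times> {..<n}) x \<Longrightarrow> entries n (mat_of n x) = x"
  by (auto simp: entries_def mat_of_def supported_def fun_eq_iff)

lemma mat_of_entries: "A \<in> carrier_mat n n \<Longrightarrow> mat_of n (entries n A) = A"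
  by (auto simp: entries_def mat_of_def)

lemma mat_of_carrier [simp]: "mat_of n x \<in> carrier_mat n n"
  by (simp add: mat_of_def)

lemma entries_mult:
  "A \<in> carrier_mat n n \<Longrightarrow> B \<in> carrier_mat n n \<Longrightarrow> entries n (A * B) = mmul {..<n} (entries n A) (entries n B)"
  by (auto simp: entries_def mmul_def fun_eq_iff scalar_prod_def atLeast0LessThan)

lemma entries_bracket:
  assumes "A \<in> carrier_mat n n" "B \<in> carrier_mat n n"
  shows "entries n (lie_bracket A B) = mcomm {..<n} (entries n A) (entries n B)"
proof -
  have "entries n (A * B - B * A) = entries n (A * B) - entries n (B * A)"
    using assms by (auto simp: entries_def fun_eq_iff)
  then show ?thesis using assms by (simp add: lie_bracket_def mcomm_def entries_mult)
qed

text \<open>The form is only assumed to be linear on a subspace, so the expansion in matrix units goes by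
induction on the support.\<close>

lemma linear_functional_sum:
  fixes \<phi> :: "'k::field kmat \<Rightarrow> 'k"
  assumes "finite S" and add: "\<And>x y. supported S x \<Longrightarrow> supported S y \<Longrightarrow> \<phi> (x + y) = \<phi> x + \<phi> y"
    and smult: "\<And>c x. supported S x \<Longrightarrow> \<phi> (\<lambda>i j. c * x i j) = c * \<phi> x"
    and x: "supported S x"
  shows "\<phi> x = (\<Sum>(i, j)\<in>S. x i j * \<phi> (munit i j))"
  using assms
proof (induction S arbitrary: x rule: finite_induct)
  case empty
  then have x: "x = 0" by (auto simp: supported_def fun_eq_iff)
  have "\<phi> (0 + 0) = \<phi> 0 + \<phi> 0" by (rule empty.prems(1)) (simp_all add: supported_def)
  then have "\<phi> 0 = 0" by (metis add.right_neutral add_left_imp_eq)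
  then show ?case by (simp only: x sum.empty)
next
  case (insert p S)
  obtain k l where p: "p = (k, l)" by (cases p)
  define y where "y i j = (if (i, j) = p then 0 else x i j)" for i j
  have sy: "supported S y" using insert.prems(3) by (auto simp: supported_def y_def)
  have m: "supported (insert p S) z" if "supported S z" for z :: "'k kmat"
    using supported_mono[OF that] by blast
  have se: "supported (insert p S) (munit k l :: 'k kmat)" using p by (intro supported_munit) auto
  have se': "supported (insert p S) (\<lambda>i j. x k l * munit k l i j)" using se by (simp add: supported_def)
  have xe: "x = y + (\<lambda>i j. x k l * munit k l i j)" by (auto simp: y_def p munit_def fun_eq_iff)
  have "\<phi> x = \<phi> y + \<phi> (\<lambda>i j. x k l * munit k l i j)"
    by (subst xe) (rule insert.prems(1)[OF m[OF sy] se'])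
  also have "\<phi> (\<lambda>i j. x k l * munit k l i j) = x k l * \<phi> (munit k l)"
    by (rule insert.prems(2)[OF se])
  also have "\<phi> y = (\<Sum>(i, j)\<in>S. y i j * \<phi> (munit i j))"
    by (rule insert.IH[OF insert.prems(1) insert.prems(2) sy]) (use m in auto)
  also have "\<dots> = (\<Sum>(i, j)\<in>S. x i j * \<phi> (munit i j))"
    by (intro sum.cong) (use insert.hyps in \<open>auto simp: y_def\<close>)
  finally show ?case using insert.hyps p by simp
qed

lemma mtrace_mcomm: "mtrace P (mcomm P x y) = 0"
  by (simp add: mcomm_def mtrace_diff mtrace_mmul_commute)

lemma mtrace_mscalar: "finite P \<Longrightarrow> mtrace P (mscalar P c) = of_nat (card P) * c"
  by (simp add: mtrace_def mscalar_def)

text \<open>In characteristic zero, \<open>A\<close> is the direct sum of the trace-zero part and the scalars, with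
projection \<open>\<pi>\<close> to the former. The scalars do not contribute to commutators, so the stabilizer of a
form on the trace-zero part is trivial iff the radical of an extension to \<open>A\<close> consists of the
scalars.\<close>

theorem frobenius_seaweed_iff:
  assumes a: "a \<in> compositions n" and b: "b \<in> compositions n"
  shows "frobenius n (seaweed a b :: 'k::field_char_0 mat set) \<longleftrightarrow> frob TYPE('k) a b"
proof -
  let ?g = "seaweed a b :: 'k mat set"
  let ?P = "{..<n}" and ?R = "pattern a b"
  have sa: "sum_list a = n" and sb: "sum_list b = n" using a b by (auto simp: compositions_def)
  have n: "0 < n" using a sa by (cases a) (auto simp: compositions_def)
  have R: "?R \<subseteq> ?P \<times> ?P" using pattern_subset[of a b] sa by simp
  have refl: "\<forall>i\<in>?P. (i, i) \<in> ?R" using pattern_refl[of a b] sa by simp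
  have PP: "supported (?P \<times> ?P) x" if "supported ?R x" for x :: "'k kmat" using supported_mono[OF that R] .
  have sc: "supported ?R (mscalar ?P c)" for c :: 'k using refl by (auto simp: supported_def mscalar_def)
  have mem: "A \<in> ?g \<longleftrightarrow> A \<in> carrier_mat n n \<and> supported ?R (entries n A) \<and> mtrace ?P (entries n A) = 0" for A
    by (rule mem_seaweed_entries[OF sa sb])
  define \<pi> where "\<pi> x = x + mscalar ?P (- mtrace ?P x / of_nat n)" for x :: "'k kmat"
  have mtrace\<pi>: "mtrace ?P (\<pi> x) = 0" for x using n by (simp add: \<pi>_def mtrace_add mtrace_mscalar)
  have s\<pi>: "supported ?R (\<pi> x)" if "supported ?R x" for x unfolding \<pi>_def by (intro supported_add that sc)
  have e\<pi>: "entries n (mat_of n (\<pi> x)) = \<pi> x" if "supported ?R x" for x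
    by (rule entries_mat_of[OF PP[OF s\<pi>[OF that]]])
  have g\<pi>: "mat_of n (\<pi> x) \<in> ?g" if "supported ?R x" for x
    unfolding mem using that e\<pi> mtrace\<pi> s\<pi> by simp
  have frob: "frobenius n ?g \<longleftrightarrow> (\<exists>f. linear_form ?g f \<and> form_stabilizer ?g f = {0\<^sub>m n n})"
    by (rule frobenius_iff[OF subspace_seaweed[OF a b] seaweed_bracket])
  have bsc: "bform ?P H (mscalar ?P c) y = 0" if "supported ?R y" for H y and c :: 'k
    using mscalar_in_radical[OF _ R refl, of c H] that by (simp add: radical_def)
  have bsc': "bform ?P H y (mscalar ?P c) = 0" if "supported ?R y" for H y and c :: 'k
    using bsc[OF that] by (simp add: bform_commute[of ?P H y "mscalar ?P c"])
  show ?thesis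
  proof
    assume "frobenius n ?g"
    then obtain f where f: "linear_form ?g f" and st: "form_stabilizer ?g f = {0\<^sub>m n n}" using frob by blast
    define \<phi> where "\<phi> x = f (mat_of n (\<pi> x))" for x
    have add: "\<phi> (x + y) = \<phi> x + \<phi> y" if "supported ?R x" "supported ?R y" for x y
    proof -
      have "mat_of n (\<pi> (x + y)) = mat_of n (\<pi> x) + mat_of n (\<pi> y)"
        by (auto simp: mat_of_def \<pi>_def mtrace_add mscalar_def field_simps)
      then show ?thesis using f g\<pi>[OF that(1)] g\<pi>[OF that(2)] by (simp add: \<phi>_def linear_form_def)
    qed
    have smult: "\<phi> (\<lambda>i j. c * x i j) = c * \<phi> x" if "supported ?R x" for c x
    proof -
      have "mtrace ?P (\<lambda>i j. c * x i j) = c * mtrace ?P x" by (simp add: mtrace_def sum_distrib_left)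
      then have "mat_of n (\<pi> (\<lambda>i j. c * x i j)) = c \<cdot>\<^sub>m mat_of n (\<pi> x)"
        by (auto simp: mat_of_def \<pi>_def mscalar_def field_simps)
      then show ?thesis using f g\<pi>[OF that] by (simp add: \<phi>_def linear_form_def)
    qed
    define H where "H j i = (if (i, j) \<in> ?R then \<phi> (munit i j) else 0)" for i j
    have fR: "finite ?R" using R finite_subset by blast
    have H: "\<phi> x = mtrace ?P (mmul ?P H x)" if "supported ?R x" for x
    proof -
      have "\<phi> x = (\<Sum>(i, j)\<in>?R. x i j * \<phi> (munit i j))"
        by (rule linear_functional_sum[OF fR add smult that])
      also have "\<dots> = (\<Sum>(i, j)\<in>?P \<times> ?P. H j i * x i j)"
      proof (rule sum.mono_neutral_cong_left)
        show "?R \<subseteq> ?P \<times> ?P" by (rule R)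
        show "\<forall>p\<in>?P \<times> ?P - ?R. (case p of (i, j) \<Rightarrow> H j i * x i j) = 0" unfolding H_def by fastforce
        show "(case p of (i, j) \<Rightarrow> x i j * \<phi> (munit i j)) = (case p of (i, j) \<Rightarrow> H j i * x i j)" if "p \<in> ?R" for p
          using that by (cases p) (simp add: H_def)
      qed simp
      also have "\<dots> = mtrace ?P (mmul ?P H x)"
        unfolding mtrace_def mmul_def sum.cartesian_product[symmetric] by (rule sum.swap)
      finally show ?thesis .
    qed
    have br: "f (lie_bracket A B) = bform ?P H (entries n A) (entries n B)" if "A \<in> ?g" "B \<in> ?g" for A B
    proof -
      have e: "entries n (lie_bracket A B) = mcomm ?P (entries n A) (entries n B)"
        using that mem by (intro entries_bracket) auto
      have AB: "lie_bracket A B \<in> ?g" by (rule seaweed_bracket[OF that])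
      have "\<pi> (mcomm ?P (entries n A) (entries n B)) = mcomm ?P (entries n A) (entries n B)"
        by (simp add: \<pi>_def mtrace_mcomm) (simp add: mscalar_def fun_eq_iff)
      then have "mat_of n (\<pi> (mcomm ?P (entries n A) (entries n B))) = lie_bracket A B"
        using mat_of_entries[of "lie_bracket A B" n] AB mem e by simp
      then have "f (lie_bracket A B) = \<phi> (mcomm ?P (entries n A) (entries n B))" by (simp add: \<phi>_def)
      also have "\<dots> = bform ?P H (entries n A) (entries n B)"
        using H[of "mcomm ?P (entries n A) (entries n B)"] AB mem e by (simp add: bform_def)
      finally show ?thesis .
    qed
    have "nondeg ?P ?R H" unfolding nondeg_def
    proof
      fix x assume x: "x \<in> radical ?P ?R H"
      then have sx: "supported ?R x" by (simp add: radical_def)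
      let ?X = "mat_of n (\<pi> x)"
      have "f (lie_bracket ?X B) = 0" if B: "B \<in> ?g" for B
      proof -
        have sB: "supported ?R (entries n B)" using B mem by blast
        have "f (lie_bracket ?X B) = bform ?P H (\<pi> x) (entries n B)"
          using br[OF g\<pi>[OF sx] B] e\<pi>[OF sx] by simp
        also have "\<dots> = 0" using x sB bsc[OF sB] by (simp add: \<pi>_def bform_add_left radical_def)
        finally show ?thesis .
      qed
      then have "?X \<in> form_stabilizer ?g f" using g\<pi>[OF sx] by (simp add: form_stabilizer_def)
      then have "?X = 0\<^sub>m n n" using st by blast
      then have "\<pi> x = entries n (0\<^sub>m n n)" using e\<pi>[OF sx] by simp
      then have z: "\<pi> x i j = 0" for i j by (simp add: entries_def)
      have "x i j = mscalar ?P (mtrace ?P x / of_nat n) i j" for i j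
        using z[of i j] by (auto simp: \<pi>_def mscalar_def split: if_splits)
      then show "\<exists>c. x = mscalar ?P c" by (intro exI[of _ "mtrace ?P x / of_nat n"] ext)
    qed
    then show "frob TYPE('k) a b" using sa by (auto simp: frob_def frob_pattern_def)
  next
    assume "frob TYPE('k) a b"
    then obtain H :: "'k kmat" where nd: "nondeg ?P ?R H" using sa by (auto simp: frob_def frob_pattern_def)
    define f where "f A = mtrace ?P (mmul ?P H (entries n A))" for A
    have f: "linear_form ?g f"
      unfolding linear_form_def
    proof (intro conjI ballI allI)
      fix A B assume "A \<in> ?g" "B \<in> ?g"
      then have "A \<in> carrier_mat n n" "B \<in> carrier_mat n n" using mem by blast+
      then have "entries n (A + B) = entries n A + entries n B" by (auto simp: entries_def fun_eq_iff)
      then show "f (A + B) = f A + f B" by (simp add: f_def mmul_add_right mtrace_add)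
    next
      fix c A assume "A \<in> ?g"
      then have "A \<in> carrier_mat n n" using mem by blast
      then have "entries n (c \<cdot>\<^sub>m A) = (\<lambda>i j. c * entries n A i j)" by (auto simp: entries_def fun_eq_iff)
      then show "f (c \<cdot>\<^sub>m A) = c * f A" by (simp add: f_def mmul_def mtrace_def sum_distrib_left mult.left_commute)
    qed
    have "form_stabilizer ?g f \<subseteq> {0\<^sub>m n n}"
    proof
      fix A assume A: "A \<in> form_stabilizer ?g f"
      then have Ag: "A \<in> ?g" by (simp add: form_stabilizer_def)
      then have Ac: "A \<in> carrier_mat n n" and sA: "supported ?R (entries n A)" and tA: "mtrace ?P (entries n A) = 0"
        using mem by blast+
      have "bform ?P H (entries n A) y = 0" if y: "supported ?R y" for y
      proof -
        have "f (lie_bracket A (mat_of n (\<pi> y))) = 0" using A g\<pi>[OF y] by (simp add: form_stabilizer_def)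
        then have "bform ?P H (entries n A) (\<pi> y) = 0"
          using e\<pi>[OF y] Ac by (simp add: f_def bform_def entries_bracket)
        then show ?thesis using bsc'[OF sA] by (simp add: \<pi>_def bform_add_right)
      qed
      then have "entries n A \<in> radical ?P ?R H" using sA by (simp add: radical_def)
      then obtain c where c: "entries n A = mscalar ?P c" using nd by (auto simp: nondeg_def)
      then have "c = 0" using tA n by (simp add: mtrace_mscalar)
      then have "A = mat_of n (mscalar ?P 0)" using c mat_of_entries[OF Ac] by simp
      then have "A = 0\<^sub>m n n" by (auto simp: mat_of_def mscalar_def)
      then show "A \<in> {0\<^sub>m n n}" by simp
    qed
    moreover have "0\<^sub>m n n \<in> form_stabilizer ?g f"
    proof -
      have e0: "entries n (0\<^sub>m n n) = (0 :: 'k kmat)" by (auto simp: entries_def fun_eq_iff)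
      have "0\<^sub>m n n \<in> ?g" unfolding mem e0 by (auto simp: supported_def mtrace_def)
      moreover have "f (lie_bracket (0\<^sub>m n n) B) = 0" if "B \<in> ?g" for B
      proof -
        have "B \<in> carrier_mat n n" using that mem by blast
        then show ?thesis by (simp add: f_def entries_bracket e0 mcomm_def mmul_def mtrace_def)
      qed
      ultimately show ?thesis by (simp add: form_stabilizer_def)
    qed
    ultimately show "frobenius n ?g" using frob f by blast
  qed
qed

section \<open>Combinatorics of Frobenius pairs\<close>

abbreviation pos :: "nat list \<Rightarrow> bool" where "pos l \<equiv> \<forall>x\<in>set l. 0 < x"

definition odds :: "nat list \<Rightarrow> nat" where "odds l = length (filter odd l)"

lemma odds_simps [simp]: "odds [] = 0" "odds (x # l) = (if odd x then 1 else 0) + odds l"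
  "odds (u @ v) = odds u + odds v" "odds (rev l) = odds l"
  by (auto simp: odds_def simp flip: rev_filter)

text \<open>The rules from which everything about Frobenius pairs of compositions is derived, mostly by induction
along \<open>contract\<close>, which decreases the sum.\<close>

locale frobenius_pairs =
  fixes Fr :: "nat list \<Rightarrow> nat list \<Rightarrow> bool"
  assumes swap: "sum_list a = sum_list b \<Longrightarrow> Fr a b \<longleftrightarrow> Fr b a"
    and rev: "sum_list a = sum_list b \<Longrightarrow> Fr (rev a) (rev b) \<longleftrightarrow> Fr a b"
    and zero_left: "Fr (0 # a) b \<longleftrightarrow> Fr a b"
    and zero_right: "Fr a (0 # b) \<longleftrightarrow> Fr a b"
    and boundary: "prefix_sum a m \<Longrightarrow> prefix_sum b m \<Longrightarrow> 0 < m \<Longrightarrow> m < sum_list a \<Longrightarrow> \<not> Fr a b"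
    and full: "2 \<le> n \<Longrightarrow> \<not> Fr [n] [n]"
    and one: "Fr [1] [1]"
    and contract: "sum_list (x # a) = sum_list (y # b) \<Longrightarrow> 0 < x \<Longrightarrow> x < y \<Longrightarrow>
      Fr (x # a) (y # b) \<longleftrightarrow> Fr ((x - min x (y - x)) # a) ((y - x - min x (y - x)) # x # b)"
begin

text \<open>On the meander graph of the pair, whose arcs join the positions mirrored in a common part, this
deletes the first \<open>x\<close> positions and joins the two arcs at each of them.\<close>

lemma contract1:
  assumes "x + sum_list a = y + sum_list b" "0 < x" "2 * x \<le> y"
  shows "Fr (x # a) (y # b) \<longleftrightarrow> Fr a ((y - 2 * x) # x # b)"
proof -
  have "min x (y - x) = x" "y - x - x = y - 2 * x" using assms by auto
  then show ?thesis using contract[of x a y b] assms by (simp add: zero_left)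
qed

lemma contract2:
  assumes "x + sum_list a = y + sum_list b" "x < y" "y < 2 * x"
  shows "Fr (x # a) (y # b) \<longleftrightarrow> Fr ((2 * x - y) # a) (x # b)"
proof -
  have "min x (y - x) = y - x" "x - (y - x) = 2 * x - y" using assms by auto
  then show ?thesis using contract[of x a y b] assms by (simp add: zero_right)
qed

text \<open>Contraction may create a zero part; inductions over compositions need it to be dropped.\<close>

definition cons_nonzero :: "nat \<Rightarrow> nat list \<Rightarrow> nat list" where
  "cons_nonzero x l = (if x = 0 then l else x # l)"

lemma cons_nonzero_simps [simp]: "sum_list (cons_nonzero x l) = x + sum_list l" "odds (cons_nonzero x l) = odds (x # l)"
  "Fr a (cons_nonzero x l) = Fr a (x # l)" "y \<in> set (cons_nonzero x l) \<longleftrightarrow> x \<noteq> 0 \<and> y = x \<or> y \<in> set l" "cons_nonzero x l @ r = cons_nonzero x (l @ r)"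
  by (auto simp: cons_nonzero_def zero_right)

text \<open>A contraction step replaces \<open>y\<close> by \<open>y - 2 * x\<close> or by \<open>2 * x - y\<close>, which have the same parity. The
process ends at the pair \<open>([1], [1])\<close>.\<close>

lemma odds_eq_2:
  assumes "Fr a b" "pos a" "pos b" "sum_list a = sum_list b" "0 < sum_list a"
  shows "odds a + odds b = 2"
  using assms
proof (induction "sum_list a" arbitrary: a b rule: less_induct)
  case less
  have step: "odds a + odds b = 2" if eq: "a = x # a'" "b = y # b'" and lt: "x < y"
    and Fr: "Fr a b" and p: "pos a" "pos b" and s: "sum_list a = sum_list b"
    and IH: "\<And>c d. sum_list c < sum_list a \<Longrightarrow> Fr c d \<Longrightarrow> pos c \<Longrightarrow> pos d \<Longrightarrow>
      sum_list c = sum_list d \<Longrightarrow> 0 < sum_list c \<Longrightarrow> odds c + odds d = 2" for a b x y a' b'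
  proof (cases "2 * x \<le> y")
    case True
    have "Fr a' (cons_nonzero (y - 2 * x) (x # b'))" using Fr contract1[of x a' y b'] True p s eq by simp
    then have "odds a' + odds (cons_nonzero (y - 2 * x) (x # b')) = 2"
      by (intro IH) (use p s eq lt True in auto)
    moreover have "even (y - 2 * x) = even y" using True by simp
    ultimately show ?thesis using eq by auto
  next
    case False
    then have "Fr ((2 * x - y) # a') (x # b')" using Fr contract2[of x a' y b'] p s eq lt by simp
    then have "odds ((2 * x - y) # a') + odds (x # b') = 2"
      by (intro IH) (use p s eq lt False in auto)
    moreover have "even (2 * x - y) = even y" using False by simp
    ultimately show ?thesis using eq by auto
  qed
  obtain x a' where a: "a = x # a'" using less.prems by (cases a) auto
  have "0 < sum_list b" using less.prems(4,5) by linarith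
  then obtain y b' where b: "b = y # b'" by (cases b) auto
  consider "x < y" | "y < x" | "x = y" by linarith
  then show ?case
  proof cases
    case 1
    then show ?thesis using step[OF a b] less by blast
  next
    case 2
    have "odds b + odds a = 2"
    proof (rule step[OF b a 2])
      show "Fr b a" using swap less.prems by blast
      show "odds c + odds d = 2" if "sum_list c < sum_list b" "Fr c d" "pos c" "pos d"
        "sum_list c = sum_list d" "0 < sum_list c" for c d
        using less.hyps[of c d] that less.prems by simp
    qed (use less.prems in auto)
    then show ?thesis by simp
  next
    case 3
    have "prefix_sum a x" "prefix_sum b x" unfolding a b 3 prefix_sum_Cons by auto
    moreover have x: "0 < x" using less.prems(2) a by simp
    ultimately have "\<not> x < sum_list a" using boundary[of a x b] less.prems(1) by blast
    moreover have "x + sum_list a' = x + sum_list b'" using less.prems(4) a b 3 by simp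
    ultimately have s0: "sum_list a' = 0" "sum_list b' = 0" using a by simp_all
    have "a' = []" using s0(1) less.prems(2) a by (cases a') simp_all
    moreover have "b' = []" using s0(2) less.prems(3) b by (cases b') simp_all
    moreover have "\<not> 2 \<le> x" using full[of x] less.prems(1) a b 3 calculation by blast
    then have "x = 1" using x by linarith
    ultimately show ?thesis using a b 3 by simp
  qed
qed

text \<open>The part 2 is the only link between the two sides of the boundary at \<open>sum_list q\<close>. The
contraction steps for \<open>(p @ [1], q)\<close> are also those for the glued pair until the left side is used
up, so the proof is an induction along these steps.\<close>

lemma cut_pair:
  assumes "pos p" "pos q" "sum_list q = sum_list p + 1" "sum_list Y = sum_list X + 1"
  shows "Fr (p @ 2 # X) (q @ Y) \<longleftrightarrow> Fr (p @ [1]) q \<and> Fr (1 # X) Y"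
  using assms(1-3)
proof (induction "sum_list p" arbitrary: p q rule: less_induct)
  case less
  note sY = assms(4)
  show ?case
  proof (cases p)
    case Nil
    obtain y q' where q: "q = y # q'" using less.prems by (cases q) auto
    have "0 < y" "y + sum_list q' = 1" using less.prems Nil q by auto
    then have "y = 1" "sum_list q' = 0" by linarith+
    then have q: "q = [1]" using q less.prems by (cases q') auto
    have "Fr (2 # X) (1 # Y) = Fr (1 # Y) (2 # X)" using sY by (intro swap) simp
    also have "\<dots> = Fr Y (1 # X)" using contract1[of 1 Y 2 X] sY zero_right by simp
    also have "\<dots> = Fr (1 # X) Y" using sY by (intro swap) simp
    finally show ?thesis using Nil q one by simp
  next
    case (Cons x p')
    obtain y q' where q: "q = y # q'" using less.prems by (cases q) auto
    have xy: "0 < x" "0 < y" using Cons q less.prems by auto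
    have s: "y + sum_list q' = x + sum_list p' + 1" using Cons q less.prems by simp
    consider "x = y" | "x < y" "2 * x \<le> y" | "x < y" "y < 2 * x" | "y < x" "2 * y \<le> x" | "y < x" "x < 2 * y"
      by linarith
    then show ?thesis
    proof cases
      case 1
      have b: "prefix_sum (x # l) x" for l by (auto simp: prefix_sum_Cons)
      have "\<not> Fr (p @ 2 # X) (q @ Y)"
        by (rule boundary[of _ x]) (use b Cons q 1 xy in auto)
      moreover have "\<not> Fr (p @ [1]) q"
        by (rule boundary[of _ x]) (use b Cons q 1 xy in auto)
      ultimately show ?thesis by blast
    next
      case 2
      let ?q = "cons_nonzero (y - 2 * x) (x # q')"
      have "Fr (p @ 2 # X) (q @ Y) = Fr (p' @ 2 # X) (?q @ Y)"
        using contract1[of x "p' @ 2 # X" y "q' @ Y"] 2 s sY xy Cons q by simp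
      also have "\<dots> \<longleftrightarrow> Fr (p' @ [1]) ?q \<and> Fr (1 # X) Y"
        by (rule less.hyps) (use Cons q less.prems 2 in auto)
      also have "Fr (p' @ [1]) ?q = Fr (p @ [1]) q"
        using contract1[of x "p' @ [1]" y q'] 2 s xy Cons q by simp
      finally show ?thesis .
    next
      case 3
      let ?p = "(2 * x - y) # p'" and ?q = "x # q'"
      have "Fr (p @ 2 # X) (q @ Y) = Fr (?p @ 2 # X) (?q @ Y)"
        using contract2[of x "p' @ 2 # X" y "q' @ Y"] 3 s sY xy Cons q by simp
      also have "\<dots> \<longleftrightarrow> Fr (?p @ [1]) ?q \<and> Fr (1 # X) Y"
        by (rule less.hyps) (use Cons q less.prems 3 in auto)
      also have "Fr (?p @ [1]) ?q = Fr (p @ [1]) q"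
        using contract2[of x "p' @ [1]" y q'] 3 s xy Cons q by simp
      finally show ?thesis .
    next
      case 4
      let ?p = "cons_nonzero (x - 2 * y) (y # p')"
      have "Fr (p @ 2 # X) (q @ Y) = Fr (q @ Y) (p @ 2 # X)"
        by (rule swap) (use s sY Cons q in simp)
      also have "\<dots> = Fr (q' @ Y) (?p @ 2 # X)"
        using contract1[of y "q' @ Y" x "p' @ 2 # X"] 4 s sY xy Cons q by simp
      also have "\<dots> = Fr (?p @ 2 # X) (q' @ Y)"
        by (rule swap) (use s sY 4 in simp)
      also have "\<dots> \<longleftrightarrow> Fr (?p @ [1]) q' \<and> Fr (1 # X) Y"
        by (rule less.hyps) (use Cons q less.prems 4 in auto)
      also have "Fr (?p @ [1]) q' = Fr q' (?p @ [1])"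
        by (rule swap) (use s 4 in simp)
      also have "\<dots> = Fr q (p @ [1])"
        using contract1[of y q' x "p' @ [1]"] 4 s xy Cons q by simp
      also have "\<dots> = Fr (p @ [1]) q" by (rule swap) (use s Cons q in simp)
      finally show ?thesis .
    next
      case 5
      let ?p = "y # p'" and ?q = "(2 * y - x) # q'"
      have "Fr (p @ 2 # X) (q @ Y) = Fr (q @ Y) (p @ 2 # X)"
        by (rule swap) (use s sY Cons q in simp)
      also have "\<dots> = Fr (?q @ Y) (?p @ 2 # X)"
        using contract2[of y "q' @ Y" x "p' @ 2 # X"] 5 s sY xy Cons q by simp
      also have "\<dots> = Fr (?p @ 2 # X) (?q @ Y)"
        by (rule swap) (use s sY 5 in simp)
      also have "\<dots> \<longleftrightarrow> Fr (?p @ [1]) ?q \<and> Fr (1 # X) Y"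
        by (rule less.hyps) (use Cons q less.prems 5 in auto)
      also have "Fr (?p @ [1]) ?q = Fr ?q (?p @ [1])"
        by (rule swap) (use s 5 in simp)
      also have "\<dots> = Fr q (p @ [1])"
        using contract2[of y q' x "p' @ [1]"] 5 s xy Cons q by simp
      also have "\<dots> = Fr (p @ [1]) q" by (rule swap) (use s Cons q in simp)
      finally show ?thesis .
    qed
  qed
qed

text \<open>Parts that lie in the left half of the long part \<open>M\<close> are reflected to its right half one by one.\<close>

lemma unroll:
  assumes "pos u" "2 * sum_list u \<le> M" "sum_list u + sum_list v = M + sum_list c"
  shows "Fr (u @ v) (M # c) \<longleftrightarrow> Fr v ((M - 2 * sum_list u) # List.rev u @ c)"
  using assms
proof (induction u arbitrary: M c)
  case (Cons x u)
  have "Fr (x # (u @ v)) (M # c) = Fr (u @ v) ((M - 2 * x) # x # c)"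
    by (rule contract1) (use Cons.prems in auto)
  also have "\<dots> = Fr v ((M - 2 * x - 2 * sum_list u) # List.rev u @ x # c)"
    by (rule Cons.IH) (use Cons.prems in auto)
  finally show ?case by (simp add: algebra_simps)
qed simp

text \<open>Being Frobenius for the parabolic subalgebra of a composition, that is, against a single part.\<close>

definition Fr1 :: "nat list \<Rightarrow> bool" where "Fr1 a \<longleftrightarrow> Fr a [sum_list a]"

lemma Fr1_rev: "Fr1 (List.rev a) = Fr1 a"
  using rev[of a "[sum_list a]"] by (simp add: Fr1_def)

text \<open>Folding identifies pairs of compositions of \<open>n\<close> with single compositions of \<open>2 * n\<close> that have a boundary
in the middle.\<close>

lemma Fr1_fold:
  assumes "pos u" "sum_list u = sum_list v"
  shows "Fr1 (u @ v) = Fr u (List.rev v)"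
proof -
  have "Fr1 (u @ v) = Fr v (List.rev u)"
    using unroll[of u "sum_list (u @ v)" v "[]"] assms by (simp add: Fr1_def zero_right)
  also have "\<dots> = Fr (List.rev v) u" using rev[of v "List.rev u"] assms by simp
  also have "\<dots> = Fr u (List.rev v)" by (rule swap) (use assms in simp)
  finally show ?thesis .
qed

text \<open>The folded form of \<open>cut_pair\<close>. Here \<open>q\<close> is at the right end and as long as \<open>p\<close> with half of the part
2; the parts \<open>p\<close>, 1, \<open>q\<close> form the outer piece.\<close>

lemma cut_single:
  assumes "pos p" "pos q" "pos z" "sum_list q = sum_list p + 1"
  shows "Fr1 (p @ 2 # z @ q) \<longleftrightarrow> Fr1 (p @ 1 # q) \<and> Fr1 (1 # z)"
proof -
  have left: "Fr1 (p @ 1 # q) = Fr (p @ [1]) (List.rev q)"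
    using Fr1_fold[of "p @ [1]" q] assms by simp
  show ?thesis
  proof (cases "z = []")
    case True
    have "Fr1 (p @ 2 # q) = Fr (2 # q) (3 # List.rev p)"
      using unroll[of p "sum_list (p @ 2 # q)" "2 # q" "[]"] assms by (simp add: Fr1_def)
    also have "\<dots> = Fr (1 # q) (2 # List.rev p)"
      using contract2[of 2 q 3 "List.rev p"] assms by simp
    also have "\<dots> = Fr q (1 # List.rev p)"
      using contract1[of 1 q 2 "List.rev p"] assms by (simp add: zero_right)
    also have "\<dots> = Fr (List.rev q) (p @ [1])"
      using rev[of q "1 # List.rev p"] assms by simp
    also have "\<dots> = Fr (p @ [1]) (List.rev q)" by (rule swap) (use assms in simp)
    finally show ?thesis using True left one by (simp add: Fr1_def)
  next
    case False
    then have z: "0 < sum_list z" using assms(3) by (cases z) auto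
    have "Fr1 (p @ 2 # z @ q) = Fr (z @ q) ((sum_list z - 1) # 2 # List.rev p)"
      using unroll[of "p @ [2]" "sum_list (p @ 2 # z @ q)" "z @ q" "[]"] assms z by (simp add: Fr1_def)
    also have "\<dots> = Fr (List.rev q @ List.rev z) (p @ 2 # [sum_list z - 1])"
      using rev[of "z @ q" "(sum_list z - 1) # 2 # List.rev p"] assms z by simp
    also have "\<dots> = Fr (p @ 2 # [sum_list z - 1]) (List.rev q @ List.rev z)"
      by (rule swap) (use assms z in simp)
    also have "\<dots> \<longleftrightarrow> Fr (p @ [1]) (List.rev q) \<and> Fr [1, sum_list z - 1] (List.rev z)"
      by (rule cut_pair) (use assms z in auto)
    also have "Fr [1, sum_list z - 1] (List.rev z) = Fr (List.rev z) [1, sum_list z - 1]"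
      by (rule swap) (use z in simp)
    also have "\<dots> = Fr z [sum_list z - 1, 1]"
      using rev[of z "[sum_list z - 1, 1]"] z by simp
    also have "\<dots> = Fr1 (1 # z)"
      using unroll[of "[1]" "sum_list (1 # z)" z "[]"] z by (simp add: Fr1_def)
    finally show ?thesis using left by simp
  qed
qed

text \<open>After folding, two symmetric boundaries are a common boundary.\<close>

lemma Fr1_no_symmetric_boundaries:
  assumes "pos a" "prefix_sum a m" "prefix_sum a (sum_list a - m)" "0 < m" "2 * m < sum_list a"
  shows "\<not> Fr1 a"
proof -
  obtain u w where u: "a = u @ w" "sum_list u = m" using assms(2) by (auto simp: prefix_sum_def)
  obtain u' v where u': "a = u' @ v" "sum_list u' = sum_list a - m" using assms(3) by (auto simp: prefix_sum_def)
  \<comment> \<open>As \<open>2 * m < sum_list a\<close>, the boundaries cut \<open>a\<close> into \<open>u\<close>, \<open>z\<close> and \<open>v\<close>, in this order.\<close>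
  obtain z where z: "u' = u @ z"
  proof -
    from u u' consider z where "u' = u @ z" | z where "u = u' @ z"
      by (auto simp: append_eq_append_conv2)
    then show thesis
    proof cases
      case 2
      then have "sum_list u = sum_list u' + sum_list z" by (simp only: sum_list_append)
      then have False using u(2) u'(2) assms(5) by linarith
      then show ?thesis ..
    qed (rule that)
  qed
  have a: "a = u @ z @ v" using u' z by simp
  have sz: "sum_list z = sum_list a - 2 * m" "sum_list v = m" using a u u' z by auto
  have pu: "pos u" using u assms(1) by auto
  have "Fr1 a = Fr (u @ z @ v) [sum_list a]" using a by (simp add: Fr1_def)
  also have "\<dots> = Fr (z @ v) ((sum_list a - 2 * m) # List.rev u)"
    using unroll[OF pu, of "sum_list a" "z @ v" "[]"] a u assms by simp
  finally have "Fr1 a = Fr (z @ v) (sum_list z # List.rev u)" using sz by simp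
  moreover have "\<not> Fr (z @ v) (sum_list z # List.rev u)"
  proof (rule boundary)
    show "prefix_sum (z @ v) (sum_list z)" unfolding prefix_sum_append by (intro disjI1 prefix_sum_sum)
    show "prefix_sum (sum_list z # List.rev u) (sum_list z)" unfolding prefix_sum_Cons by (intro disjI2 exI[of _ 0]) simp
  qed (use sz assms in simp_all)
  ultimately show ?thesis by blast
qed

lemma odds_Fr1:
  assumes "Fr1 a" "pos a" "0 < sum_list a"
  shows "odds a = (if odd (sum_list a) then 1 else 2)"
  using odds_eq_2[of a "[sum_list a]"] assms by (auto simp: Fr1_def)

text \<open>The following examples and the counterexample are the compositions of small excess that decide
the degree and the positivity of the leading coefficients.\<close>

lemma Fr_11_2: "Fr [1, 1] [2]"
  using contract1[of 1 "[1]" 2 "[]"] one zero_right by simp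

lemma Fr1_1: "Fr1 [1]"
  using one by (simp add: Fr1_def)

lemma Fr1_11: "Fr1 [1, 1]"
  using Fr_11_2 by (simp add: Fr1_def numeral_2_eq_2)

lemma Fr_12_3: "Fr [1, 2] [3]"
proof -
  have "Fr [1, 2] [3] = Fr [2] [1, 1]" using contract1[of 1 "[2]" 3 "[]"] by simp
  also have "\<dots> = Fr [1, 1] [2]" by (rule swap) simp
  finally show ?thesis using Fr_11_2 by simp
qed

lemma Fr1_123: "Fr1 [1, 2, 3]"
  using Fr1_fold[of "[1, 2]" "[3]"] Fr_12_3 by simp

lemma Fr1_14: "Fr1 [1, 4]"
proof -
  have "Fr [1, 4] [5] = Fr [4] [3, 1]" using contract1[of 1 "[4]" 5 "[]"] by simp
  also have "\<dots> = Fr [3, 1] [4]" by (rule swap) simp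
  also have "\<dots> = Fr [2, 1] [3]" using contract2[of 3 "[1]" 4 "[]"] by simp
  also have "\<dots> = Fr [1, 1] [2]" using contract2[of 2 "[1]" 3 "[]"] by simp
  finally show ?thesis using Fr_11_2 by (simp add: Fr1_def)
qed

lemma Fr1_4141: "Fr1 [4, 1, 4, 1]"
proof -
  have "Fr1 [4, 1, 4, 1] = Fr [4, 1] [1, 4]" using Fr1_fold[of "[4, 1]" "[4, 1]"] by simp
  also have "\<dots> = Fr [1, 4] [4, 1]" by (rule swap) simp
  also have "\<dots> = Fr [4] [2, 1, 1]" using contract1[of 1 "[4]" 4 "[1]"] by simp
  also have "\<dots> = Fr [2, 1, 1] [4]" by (rule swap) simp
  also have "\<dots> = Fr [1, 1] [2]" using contract1[of 2 "[1, 1]" 4 "[]"] zero_right by simp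
  finally show ?thesis using Fr_11_2 by simp
qed

lemma not_Fr1_1214: "\<not> Fr1 [1, 2, 1, 4]"
proof -
  have "Fr1 [1, 2, 1, 4] = Fr [1, 2, 1] [4]" using Fr1_fold[of "[1, 2, 1]" "[4]"] by simp
  also have "\<dots> = Fr [2, 1] [2, 1]" using contract1[of 1 "[2, 1]" 4 "[]"] by simp
  finally show ?thesis using boundary[of "[2, 1]" 2 "[2, 1]"] by (simp add: prefix_sum_Cons)
qed

end

section \<open>Cuts, and the size of compositions without cuts\<close>

definition two_at :: "nat list \<Rightarrow> nat \<Rightarrow> bool" where
  "two_at a x \<longleftrightarrow> (\<exists>u v. a = u @ 2 # v \<and> sum_list u = x)"

lemma two_at_Nil [simp]: "\<not> two_at [] x"
  by (simp add: two_at_def)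

lemma two_at_Cons: "two_at (y # l) s \<longleftrightarrow> (y = 2 \<and> s = 0) \<or> (\<exists>t. two_at l t \<and> s = y + t)"
proof
  assume "two_at (y # l) s"
  then obtain u v where "y # l = u @ 2 # v" "sum_list u = s" by (auto simp: two_at_def)
  then show "(y = 2 \<and> s = 0) \<or> (\<exists>t. two_at l t \<and> s = y + t)" by (cases u) (auto simp: two_at_def)
next
  assume "(y = 2 \<and> s = 0) \<or> (\<exists>t. two_at l t \<and> s = y + t)"
  then consider "y = 2" "s = 0" | u v where "l = u @ 2 # v" "s = y + sum_list u" by (auto simp: two_at_def)
  then show "two_at (y # l) s"
  proof cases
    case 1
    then have "y # l = [] @ 2 # l" "sum_list [] = s" by auto
    then show ?thesis unfolding two_at_def by blast
  next
    case 2
    then have "y # l = (y # u) @ 2 # v" "sum_list (y # u) = s" by auto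
    then show ?thesis unfolding two_at_def by blast
  qed
qed

lemma two_at_append: "two_at (u @ v) s \<longleftrightarrow> two_at u s \<or> (\<exists>t. two_at v t \<and> s = sum_list u + t)"
  by (induction u arbitrary: s) (auto simp: two_at_Cons)

lemma two_at_prefix_sum: "two_at a x \<Longrightarrow> prefix_sum a x \<and> prefix_sum a (x + 2) \<and> x + 2 \<le> sum_list a"
  by (induction a arbitrary: x) (auto simp: two_at_Cons prefix_sum_Cons)

lemma two_at_center: "two_at a x \<Longrightarrow> \<not> prefix_sum a (x + 1)"
  by (induction a arbitrary: x) (auto simp: two_at_Cons prefix_sum_Cons)

lemma two_at_rev: "two_at (rev a) x \<longleftrightarrow> x + 2 \<le> sum_list a \<and> two_at a (sum_list a - 2 - x)"
proof -
  have "two_at (rev a) x \<Longrightarrow> x + 2 \<le> sum_list a \<and> two_at a (sum_list a - 2 - x)" for a x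
  proof -
    assume "two_at (rev a) x"
    then obtain u v where uv: "rev a = u @ 2 # v" "sum_list u = x" by (auto simp: two_at_def)
    then have a: "a = rev v @ 2 # rev u" by (metis append.assoc append_Cons append_Nil rev.simps(2) rev_append rev_rev_ident)
    then show ?thesis using uv(2) by (auto simp: two_at_append two_at_Cons)
  qed
  note imp = this
  show ?thesis
  proof
    assume r: "x + 2 \<le> sum_list a \<and> two_at a (sum_list a - 2 - x)"
    then have "two_at (rev (rev a)) (sum_list a - 2 - x)" by simp
    from imp[OF this] have "two_at (rev a) (sum_list a - 2 - (sum_list a - 2 - x))" by simp
    moreover have "sum_list a - 2 - (sum_list a - 2 - x) = x" using r by linarith
    ultimately show "two_at (rev a) x" by metis
  qed (rule imp)
qed

lemma split_unique:
  assumes "pos (u @ v)" "u @ v = u' @ v'" "sum_list u = sum_list u'"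
  shows "u = u'" "v = v'"
proof -
  have "u = u'"
    using assms
  proof (induction u arbitrary: u')
    case Nil
    then show ?case by (cases u') auto
  next
    case (Cons x u)
    then have "0 < sum_list u'" by auto
    then obtain y u'' where "u' = y # u''" by (cases u') auto
    then show ?case using Cons by auto
  qed
  then show "u = u'" "v = v'" using assms(2) by auto
qed

text \<open>A part 2 centred at \<open>m\<close>, with a boundary at distance \<open>m\<close> from the right end; for the mirror image
the predicate is applied to the reversed composition.\<close>

definition cut_at :: "nat list \<Rightarrow> nat \<Rightarrow> bool" where
  "cut_at a m \<longleftrightarrow> (\<exists>p z q. a = p @ 2 # z @ q \<and> sum_list p + 1 = m \<and> sum_list q = m)"

definition uncut :: "nat list \<Rightarrow> bool" where
  "uncut a \<longleftrightarrow> (\<forall>m. \<not> cut_at a m \<and> \<not> cut_at (rev a) m)"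

lemma uncut_rev [simp]: "uncut (rev a) = uncut a"
  by (auto simp: uncut_def)

lemma cut_at_iff:
  assumes "pos a"
  shows "cut_at a m \<longleftrightarrow> 0 < m \<and> 2 * m < sum_list a \<and> two_at a (m - 1) \<and> prefix_sum a (sum_list a - m)"
proof
  assume "cut_at a m"
  then obtain p z q where a: "a = p @ 2 # z @ q" "sum_list p + 1 = m" "sum_list q = m" by (auto simp: cut_at_def)
  have "two_at a (m - 1)" unfolding two_at_def using a(2) by (intro exI[of _ p] exI[of _ "z @ q"] conjI a(1)) linarith
  moreover have "prefix_sum a (sum_list a - m)" unfolding prefix_sum_def a(1) using a(3)
    by (intro exI[of _ "p @ 2 # z"] exI[of _ q]) simp
  moreover have "sum_list a = sum_list p + 2 + sum_list z + sum_list q" unfolding a(1) by simp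
  then have "0 < m" "2 * m < sum_list a" using a(2,3) by linarith+
  ultimately show "0 < m \<and> 2 * m < sum_list a \<and> two_at a (m - 1) \<and> prefix_sum a (sum_list a - m)" by blast
next
  assume *: "0 < m \<and> 2 * m < sum_list a \<and> two_at a (m - 1) \<and> prefix_sum a (sum_list a - m)"
  have "two_at a (m - 1)" using * by blast
  then obtain u w where "a = u @ 2 # w" and u2: "sum_list u = m - 1" unfolding two_at_def by blast
  then have u: "a = (u @ [2]) @ w" "sum_list u = m - 1" by simp_all
  have "prefix_sum a (sum_list a - m)" using * by blast
  then obtain x y where x: "a = x @ y" "sum_list x = sum_list a - m" unfolding prefix_sum_def by blast
  have "\<exists>z. x = (u @ [2]) @ z \<and> w = z @ y"
  proof -
    have "(u @ [2]) @ w = x @ y" using u(1) x(1) by (rule subst)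
    then consider z where "x = (u @ [2]) @ z" "w = z @ y" | z where "u @ [2] = x @ z" "y = z @ w"
      unfolding append_eq_append_conv2 by metis
    then show ?thesis
    proof cases
      case 2
      have "sum_list u + 2 = sum_list x + sum_list z" using arg_cong[OF 2(1), of sum_list] by simp
      then have "sum_list z = 0" using u x * by linarith
      moreover have "set z \<subseteq> set a" unfolding x(1) 2(2) by auto
      then have "pos z" using assms by blast
      ultimately have "z = []" by (cases z) auto
      then show ?thesis using 2 by (intro exI[of _ "[]"]) simp
    qed blast
  qed
  then obtain z where z: "w = z @ y" by blast
  have "sum_list a = sum_list x + sum_list y" using x(1) by simp
  then have "sum_list y = m" using x(2) * by linarith
  moreover have "a = u @ 2 # z @ y" using u(1) z by simp
  moreover have "sum_list u + 1 = m" using u(2) * by linarith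
  ultimately show "cut_at a m" unfolding cut_at_def by blast
qed

text \<open>Cuts near the ends do not see the middle \<open>c\<close>.\<close>

lemma cut_at_split:
  assumes "pos (p @ c @ q)" "0 < m" "m \<le> sum_list p" "m \<le> sum_list q" "2 * m < sum_list (p @ c @ q)"
  shows "cut_at (p @ c @ q) m \<longleftrightarrow> two_at p (m - 1) \<and> prefix_sum q (sum_list q - m)"
proof -
  have "two_at (p @ c @ q) (m - 1) = two_at p (m - 1)"
    unfolding two_at_append[of p] using assms by auto
  moreover have "prefix_sum (p @ c @ q) (sum_list (p @ c @ q) - m) = prefix_sum q (sum_list q - m)"
  proof -
    have "sum_list (p @ c @ q) - m = sum_list (p @ c) + (sum_list q - m)" using assms by simp
    moreover have "prefix_sum ((p @ c) @ q) (sum_list (p @ c) + s) = prefix_sum q s" for s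
      unfolding prefix_sum_append[of "p @ c"] using prefix_sum_le[of "p @ c" "sum_list (p @ c) + s"] by auto
    ultimately show ?thesis by simp
  qed
  ultimately show ?thesis using cut_at_iff[OF assms(1)] assms by simp
qed

text \<open>The gaps between adjacent positions that lie inside parts of size at least 3.\<close>

definition large_gaps :: "nat list \<Rightarrow> nat set" where
  "large_gaps a = {g. 0 < g \<and> g < sum_list a \<and> \<not> prefix_sum a g \<and> \<not> two_at a (g - 1)}"

definition gap_weight :: "nat \<Rightarrow> nat" where "gap_weight x = x - 1 - (if x = 2 then 1 else 0)"

lemma finite_large_gaps: "finite (large_gaps a)"
  by (rule finite_subset[of _ "{..<sum_list a}"]) (auto simp: large_gaps_def)

lemma card_large_gaps: "card (large_gaps a) \<le> sum_list (map gap_weight a)"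
proof (induction a)
  case (Cons x l)
  let ?A = "{1..<x} - (if x = 2 then {1} else {})"
  have "large_gaps (x # l) \<subseteq> ?A \<union> (\<lambda>g. x + g) ` large_gaps l"
  proof
    fix g assume g: "g \<in> large_gaps (x # l)"
    show "g \<in> ?A \<union> (\<lambda>g. x + g) ` large_gaps l"
    proof (cases "g < x")
      case True
      then show ?thesis using g by (auto simp: large_gaps_def two_at_Cons)
    next
      case False
      then obtain h where h: "g = x + h" by (metis le_iff_add not_less)
      have "h \<noteq> 0" using g h by (auto simp: large_gaps_def prefix_sum_Cons)
      then have "h \<in> large_gaps l" using g h by (auto simp: large_gaps_def prefix_sum_Cons two_at_Cons)
      then show ?thesis using h by blast
    qed
  qed
  then have "card (large_gaps (x # l)) \<le> card (?A \<union> (\<lambda>g. x + g) ` large_gaps l)"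
    by (intro card_mono) (auto simp: finite_large_gaps)
  also have "\<dots> \<le> card ?A + card ((\<lambda>g. x + g) ` large_gaps l)" by (rule card_Un_le)
  also have "\<dots> \<le> gap_weight x + card (large_gaps l)"
    by (intro add_mono card_image_le finite_large_gaps) (auto simp: gap_weight_def)
  finally show ?case using Cons by simp
qed (simp add: large_gaps_def)

lemma card_boundaries: "finite {g. 0 < g \<and> prefix_sum a g} \<and> card {g. 0 < g \<and> prefix_sum a g} \<le> length a"
proof (induction a)
  case Nil
  have "{g. 0 < g \<and> prefix_sum [] g} = {}" by auto
  then show ?case by simp
next
  case (Cons x l)
  have "{g. 0 < g \<and> prefix_sum (x # l) g} \<subseteq> insert x ((\<lambda>g. x + g) ` {g. 0 < g \<and> prefix_sum l g})"
    by (auto simp: prefix_sum_Cons)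
  moreover have "card (insert x ((\<lambda>g. x + g) ` {g. 0 < g \<and> prefix_sum l g})) \<le> Suc (length l)"
    using Cons card_image_le[of "{g. 0 < g \<and> prefix_sum l g}" "\<lambda>g. x + g"]
      card_insert_le_m1[of "Suc (length l)" "(\<lambda>g. x + g) ` {g. 0 < g \<and> prefix_sum l g}" x] by fastforce
  ultimately show ?case using Cons
    by (metis (no_types, lifting) card_mono dual_order.trans finite_imageI finite_insert finite_subset length_Cons)
qed

text \<open>Consider the gaps \<open>g\<close> with \<open>0 < g < N\<close>, where \<open>N\<close> is the sum. The mirror image \<open>N - g\<close> of the
centre \<open>g\<close> of a part 2 is not a boundary, as there would be a cut, and not the centre of another
part 2, as there would be symmetric boundaries. So it is inside a large part, unless \<open>2 * g = N\<close>.
Hence the number of parts 2 is at most one more than the number of gaps inside large parts, and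
every gap is a boundary, a centre of a part 2, or inside a large part.\<close>

lemma uncut_size_bound:
  assumes "pos a" "uncut a" "4 < sum_list a"
    and nosym: "\<And>m. 0 < m \<Longrightarrow> 2 * m < sum_list a \<Longrightarrow> \<not> (prefix_sum a m \<and> prefix_sum a (sum_list a - m))"
  shows "sum_list a \<le> length a + 2 * sum_list (map gap_weight a) + 1"
proof -
  let ?N = "sum_list a"
  let ?C = "{g. 0 < g \<and> two_at a (g - 1)}"
  let ?B = "{g. 0 < g \<and> prefix_sum a g} - {?N}"
  have C: "?C \<subseteq> (\<lambda>g. ?N - g) ` large_gaps a \<union> {?N div 2}"
  proof
    fix g assume g: "g \<in> ?C"
    have b: "prefix_sum a (g - 1)" "prefix_sum a (g + 1)" "g + 1 \<le> ?N"
      using two_at_prefix_sum[of a "g - 1"] g by auto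
    show "g \<in> (\<lambda>g. ?N - g) ` large_gaps a \<union> {?N div 2}"
    proof (cases "2 * g = ?N")
      case True
      then have "g = ?N div 2" by linarith
      then show ?thesis by blast
    next
      case False
      have "\<not> prefix_sum a (?N - g)"
      proof
        assume prefix_sum: "prefix_sum a (?N - g)"
        show False
        proof (cases "2 * g < ?N")
          case True
          then have "cut_at a g" using cut_at_iff[OF assms(1)] g prefix_sum by simp
          then show False using assms(2) by (simp add: uncut_def)
        next
          case F: False
          have "?N - 2 - (?N - g - 1) = g - 1" using b g by auto
          then have "two_at (rev a) (?N - g - 1)" using g b False F by (simp add: two_at_rev)
          moreover have "prefix_sum (rev a) (?N - (?N - g))" using prefix_sum b by (simp add: prefix_sum_rev)
          moreover have "0 < ?N - g" "2 * (?N - g) < ?N" using b False F by auto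
          ultimately have "cut_at (rev a) (?N - g)" using cut_at_iff[of "rev a" "?N - g"] assms(1) by simp
          then show False using assms(2) by (simp add: uncut_def)
        qed
      qed
      moreover have "\<not> two_at a (?N - g - 1)"
      proof
        assume tw: "two_at a (?N - g - 1)"
        have sym: False if h: "two_at a (h - 1)" "two_at a (?N - h - 1)" "0 < h" "2 * h < ?N" for h
        proof -
          have b: "prefix_sum a (h - 1)" "prefix_sum a (h + 1)" using two_at_prefix_sum[OF h(1)] h by auto
          have "?N - h - 1 + 2 = ?N - h + 1" using h(3,4) by linarith
          then have b': "prefix_sum a (?N - h - 1)" "prefix_sum a (?N - h + 1)" using two_at_prefix_sum[OF h(2)] by metis+
          have "2 * h + 1 \<noteq> ?N"
          proof
            assume "2 * h + 1 = ?N"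
            then have "?N - h - 1 = h" by linarith
            then have "prefix_sum a h" using b' by simp
            then show False using two_at_center[OF h(1)] h(3) by simp
          qed
          \<comment> \<open>Two facing parts 2 bring the symmetric boundaries \<open>h + 1\<close> and \<open>h - 1\<close>; the former degenerate
            when the two parts meet in the middle, the latter when they are at the ends.\<close>
          then have "2 * (h + 1) < ?N \<or> 2 * (h + 1) = ?N" using h(4) by presburger
          then consider "2 * (h + 1) < ?N" | "2 * (h + 1) = ?N" by blast
          then show False
          proof cases
            case 1
            have "?N - h - 1 = ?N - (h + 1)" by simp
            then show False using nosym[of "h + 1"] 1 b b' by simp
          next
            case 2
            then have "1 < h" using assms(3) by presburger
            moreover have "?N - h + 1 = ?N - (h - 1)" using calculation h(4) by simp
            ultimately show False using nosym[of "h - 1"] h(4) b b' by simp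
          qed
        qed
        show False
        proof (cases "2 * g < ?N")
          case True
          then show False using sym[of g] g tw by simp
        next
          case F: False
          have "?N - (?N - g) = g" using b by simp
          moreover have "2 * (?N - g) < ?N" "0 < ?N - g" using b(3) False F by presburger+
          ultimately show False using sym[of "?N - g"] g tw by (metis (mono_tags, lifting) mem_Collect_eq)
        qed
      qed
      moreover have "0 < ?N - g" "?N - g < ?N" using b g by auto
      ultimately have "?N - g \<in> large_gaps a" by (simp add: large_gaps_def)
      moreover have "g = ?N - (?N - g)" using b by simp
      ultimately show ?thesis by blast
    qed
  qed
  have fB: "finite ?B" and cB: "card ?B + 1 \<le> length a"
  proof -
    have N: "?N \<in> {g. 0 < g \<and> prefix_sum a g}" using assms(3) by simp
    show "finite ?B" using card_boundaries[of a] by simp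
    have "card {g. 0 < g \<and> prefix_sum a g} = card ?B + 1"
      using card_boundaries[of a] N by (metis (no_types, lifting) One_nat_def add.commute card.remove plus_1_eq_Suc)
    then show "card ?B + 1 \<le> length a" using card_boundaries[of a] by simp
  qed
  have fC: "finite ?C" using C finite_large_gaps finite_subset by blast
  have "card ?C \<le> card ((\<lambda>g. ?N - g) ` large_gaps a \<union> {?N div 2})" using C finite_large_gaps by (intro card_mono) auto
  also have "\<dots> \<le> card ((\<lambda>g. ?N - g) ` large_gaps a) + card {?N div 2}" by (rule card_Un_le)
  also have "\<dots> \<le> card (large_gaps a) + 1" using card_image_le[OF finite_large_gaps[of a], of "\<lambda>g. ?N - g"] by simp
  finally have cC: "card ?C \<le> card (large_gaps a) + 1" .
  have "{1..<?N} \<subseteq> ?B \<union> ?C \<union> large_gaps a" by (auto simp: large_gaps_def)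
  then have "card {1..<?N} \<le> card (?B \<union> ?C \<union> large_gaps a)" using fB fC finite_large_gaps by (intro card_mono) auto
  also have "\<dots> \<le> card ?B + card ?C + card (large_gaps a)"
    by (meson add_le_mono card_Un_le dual_order.trans order_refl)
  finally have "?N - 1 \<le> card ?B + card ?C + card (large_gaps a)" by simp
  then show ?thesis using cB cC card_large_gaps[of a] by linarith
qed

text \<open>By how much the parts exceed the sizes 1 and 2, in units of 2.\<close>

definition excess :: "nat list \<Rightarrow> nat" where "excess a = sum_list (map (\<lambda>x. (x - 1) div 2) a)"

lemma excess_odds: "pos a \<Longrightarrow> 2 * excess a + 2 * length a = sum_list a + odds a"
proof (induction a)
  case (Cons x a)
  have "2 * ((x - 1) div 2) + 2 = x + (if odd x then 1 else 0)"
    using Cons.prems by (cases x) (auto elim!: oddE evenE)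
  then show ?case using Cons by (simp add: excess_def)
qed (simp add: excess_def)

lemma gap_weight_excess: "pos a \<Longrightarrow> sum_list (map gap_weight a) \<le> 3 * excess a"
proof (induction a)
  case (Cons x a)
  have "gap_weight x \<le> 3 * ((x - 1) div 2)"
  proof (cases "x \<le> 2")
    case True
    then show ?thesis using Cons.prems by (cases "x = 1") (auto simp: gap_weight_def)
  next
    case False
    then show ?thesis unfolding gap_weight_def by (simp; presburger)
  qed
  then show ?case using Cons by (simp add: excess_def)
qed simp

section \<open>Recursion by cutting at the first cut\<close>

context frobenius_pairs
begin

text \<open>Folded Frobenius compositions of excess \<open>t\<close>: with \<open>sp\<close> those that come from seaweeds, without it
those of parabolic subalgebras. The number of parts is \<open>n + 1 - t\<close>; written with a sum, the equation
excludes truncated subtraction.\<close>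

definition comps :: "nat \<Rightarrow> bool \<Rightarrow> nat \<Rightarrow> nat \<Rightarrow> nat list set" where
  "comps e sp n t = {a. pos a \<and> sum_list a = 2 * n + e \<and> Fr1 a \<and> length a + t = n + 1 \<and> (sp \<longrightarrow> prefix_sum a n)}"

text \<open>What remains inside after a cut: the 1 is the inner half of the part 2.\<close>

definition tails :: "nat \<Rightarrow> bool \<Rightarrow> nat \<Rightarrow> nat \<Rightarrow> nat list set" where
  "tails e sp n t = {z. 1 # z \<in> comps e sp n t}"

text \<open>The outer pieces \<open>p @ 1 # q\<close> cut off at distance \<open>m\<close> from the ends. That they have no cut
themselves expresses that the cut was the first one.\<close>

definition pieces :: "nat \<Rightarrow> nat \<Rightarrow> (nat list \<times> nat list) set" where
  "pieces m s = {(p, q). pos p \<and> pos q \<and> sum_list p + 1 = m \<and> sum_list q = m \<and> Fr1 (p @ 1 # q) \<and>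
     uncut (p @ 1 # q) \<and> length p + length q + s = m}"

definition glue :: "(nat list \<times> nat list) \<Rightarrow> nat list \<Rightarrow> nat list" where
  "glue pq z = fst pq @ 2 # z @ snd pq"

definition glued :: "(nat list \<times> nat list \<Rightarrow> bool) \<Rightarrow> nat \<Rightarrow> bool \<Rightarrow> nat \<Rightarrow> nat \<Rightarrow> nat list set" where
  "glued Q e sp n t = (\<lambda>(k, pq, z). glue pq z) `
     (SIGMA k:{1..n} \<times> {..t}. {pq \<in> pieces (fst k) (snd k). Q pq} \<times> tails e sp (n - fst k) (t - snd k))"

text \<open>The number of odd parts is known, so excess and number of parts determine each other.\<close>

lemma excess_length:
  assumes "pos a" "sum_list a = 2 * n + e" "e \<le> 1" "Fr1 a" "0 < sum_list a"
  shows "excess a + length a = n + 1"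
proof -
  have "2 * excess a + 2 * length a = sum_list a + odds a" by (rule excess_odds[OF assms(1)])
  moreover have "odds a = 2 - e" using odds_Fr1[OF assms(4,1,5)] assms(2,3) by (cases "e = 0") auto
  ultimately show ?thesis using assms(2,3) by linarith
qed

lemma finite_comps: "finite (comps e sp n t)"
proof (rule finite_subset)
  show "comps e sp n t \<subseteq> {a. set a \<subseteq> {..2 * n + e} \<and> length a \<le> n + 1}"
    using member_le_sum_list by (fastforce simp: comps_def)
  show "finite {a. set a \<subseteq> {..2 * n + e} \<and> length a \<le> n + 1}" by (rule finite_lists_length_le) simp
qed

lemma finite_tails: "finite (tails e sp n t)"
  unfolding tails_def using finite_comps[of e sp n t] by (intro finite_vimageI[of _ "\<lambda>z. 1 # z", unfolded vimage_def]) auto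

lemma comps_excess:
  assumes "a \<in> comps e sp n t" "e \<le> 1" "0 < 2 * n + e"
  shows "excess a = t"
  using excess_length[of a n e] assms by (auto simp: comps_def)

lemma comps_no_symmetric_boundaries:
  "a \<in> comps e sp n t \<Longrightarrow> 0 < m \<Longrightarrow> 2 * m < sum_list a \<Longrightarrow> \<not> (prefix_sum a m \<and> prefix_sum a (sum_list a - m))"
  using Fr1_no_symmetric_boundaries[of a m] by (auto simp: comps_def)

text \<open>A unit of excess accounts for at most three gaps inside large parts, so \<open>uncut_size_bound\<close> gives
\<open>2 n + e \<le> (n + 1 - t) + 6 t + 1\<close>. Sums up to 4 are covered by the summand 2.\<close>

lemma uncut_comps_bound:
  assumes a: "a \<in> comps e sp n t" and e: "e \<le> 1" and "uncut a"
  shows "n \<le> 5 * t + 2"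
proof (cases "4 < 2 * n + e")
  case True
  have s: "sum_list a = 2 * n + e" "pos a" "length a + t = n + 1" using a by (auto simp: comps_def)
  have "sum_list a \<le> length a + 2 * sum_list (map gap_weight a) + 1"
    by (rule uncut_size_bound[OF s(2) assms(3) _ comps_no_symmetric_boundaries[OF a]]) (use True s in auto)
  moreover have "sum_list (map gap_weight a) \<le> 3 * t" 
  proof -
    have "0 < 2 * n + e" using True by linarith
    then show ?thesis using gap_weight_excess[OF s(2)] comps_excess[OF a e] by simp
  qed
  ultimately show ?thesis using s by linarith
qed simp

lemma comps_rev:
  assumes "sp \<longrightarrow> e = 0"
  shows "rev a \<in> comps e sp n t \<longleftrightarrow> a \<in> comps e sp n t"
  using assms Fr1_rev[of a] by (auto simp: comps_def prefix_sum_rev)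

lemma pieces_comps: "(p, q) \<in> pieces m s \<Longrightarrow> p @ 1 # q \<in> comps 0 True m s"
proof -
  assume pq: "(p, q) \<in> pieces m s"
  have "prefix_sum (p @ 1 # q) m" unfolding prefix_sum_def
    by (rule exI[of _ "p @ [1]"], rule exI[of _ q]) (use pq in \<open>auto simp: pieces_def\<close>)
  then show ?thesis using pq by (auto simp: pieces_def comps_def)
qed

lemma pieces_bound: "(p, q) \<in> pieces m s \<Longrightarrow> m \<le> 5 * s + 2"
  using uncut_comps_bound[OF pieces_comps] by (auto simp: pieces_def)

lemma finite_pieces: "finite (pieces m s)"
proof (rule finite_subset)
  let ?A = "{a. set a \<subseteq> {..m} \<and> length a \<le> m}"
  have sub: "set p \<subseteq> {..m}" if "sum_list p \<le> m" for p :: "nat list"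
    using member_le_sum_list[of _ p] that by fastforce
  show "pieces m s \<subseteq> ?A \<times> ?A"
  proof (rule subrelI)
    fix p q assume "(p, q) \<in> pieces m s"
    then have "sum_list p \<le> m" "sum_list q \<le> m" "length p \<le> m" "length q \<le> m" by (auto simp: pieces_def)
    then show "(p, q) \<in> ?A \<times> ?A" using sub by blast
  qed
  show "finite (?A \<times> ?A)" by (intro finite_cartesian_product finite_lists_length_le) auto
qed

lemma tails_iff:
  "z \<in> tails e sp n t \<longleftrightarrow> pos z \<and> 1 + sum_list z = 2 * n + e \<and> Fr1 (1 # z) \<and> length z + t = n \<and> (sp \<longrightarrow> prefix_sum (1 # z) n)"
  by (auto simp: tails_def comps_def)

text \<open>Gluing on an outer piece does not move the middle. The inner composition must not be empty if the
middle is to be a boundary.\<close>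

lemma prefix_sum_middle:
  assumes "sum_list (p :: nat list) + 1 = m" "m \<le> n" "0 < n - m \<or> \<not> sp" "sum_list z + 1 = 2 * (n - m) + e" "sum_list q = m" "sp \<longrightarrow> e = 0"
  shows "(sp \<longrightarrow> prefix_sum (p @ 2 # z @ q) n) \<longleftrightarrow> (sp \<longrightarrow> prefix_sum (1 # z) (n - m))"
proof (cases sp)
  case True
  then have nm: "0 < n - m" and e: "e = 0" using assms by auto
  have le: "n - m - 1 \<le> sum_list z" using assms(4) by linarith
  have "prefix_sum (p @ 2 # z @ q) n \<longleftrightarrow> prefix_sum z (n - m - 1)"
  proof -
    have "n = sum_list (p @ [2]) + (n - m - 1)" using assms(1) nm by simp
    then have "prefix_sum (p @ 2 # z @ q) n \<longleftrightarrow> prefix_sum ((p @ [2]) @ (z @ q)) (sum_list (p @ [2]) + (n - m - 1))" by simp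
    also have "\<dots> \<longleftrightarrow> prefix_sum (z @ q) (n - m - 1)"
      unfolding prefix_sum_append[of "p @ [2]"] using prefix_sum_le[of "p @ [2]" "sum_list (p @ [2]) + (n - m - 1)"] by auto
    also have "\<dots> \<longleftrightarrow> prefix_sum z (n - m - 1)"
      unfolding prefix_sum_append using le by auto
    finally show ?thesis .
  qed
  moreover have "prefix_sum (1 # z) (n - m) \<longleftrightarrow> prefix_sum z (n - m - 1)" 
  proof -
    obtain k where "n - m = Suc k" using nm by (metis Suc_pred')
    then show ?thesis by (auto simp: prefix_sum_Cons)
  qed
  ultimately show ?thesis by blast
qed simp

lemma cut_transfer:
  assumes "pos p" "pos q" "pos z" "sum_list p + 1 = m" "sum_list q = m" "0 < k" "k < m"
  shows "cut_at (p @ 2 # z @ q) k \<longleftrightarrow> cut_at (p @ 1 # q) k"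
    "cut_at (rev (p @ 2 # z @ q)) k \<longleftrightarrow> cut_at (rev (p @ 1 # q)) k"
proof -
  have pos: "\<forall>x\<in>set p \<union> (set z \<union> set q). 0 < x" "\<forall>x\<in>set p \<union> set q. 0 < x"
    "\<forall>x\<in>set q \<union> (set z \<union> set p). 0 < x" "\<forall>x\<in>set q \<union> set p. 0 < x"
    using assms by auto
  show "cut_at (p @ 2 # z @ q) k \<longleftrightarrow> cut_at (p @ 1 # q) k"
    using cut_at_split[of p "2 # z" q k] cut_at_split[of p "[1]" q k] assms pos by simp
  show "cut_at (rev (p @ 2 # z @ q)) k \<longleftrightarrow> cut_at (rev (p @ 1 # q)) k"
    using cut_at_split[of "rev q" "rev (2 # z)" "rev p" k] cut_at_split[of "rev q" "[1]" "rev p" k] assms pos by simp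
qed

lemma cut_at_bounds: "cut_at a k \<Longrightarrow> 0 < k \<and> 2 * k < sum_list a"
  by (auto simp: cut_at_def)

text \<open>The cuts of the glued composition at distance less than \<open>m\<close> are the cuts of the outer piece.\<close>

lemma uncut_piece_iff:
  assumes "pos p" "pos q" "pos z" "sum_list p + 1 = m" "sum_list q = m"
  shows "uncut (p @ 1 # q) \<longleftrightarrow> (\<forall>k<m. \<not> cut_at (p @ 2 # z @ q) k \<and> \<not> cut_at (rev (p @ 2 # z @ q)) k)"
proof
  assume i: "uncut (p @ 1 # q)"
  show "\<forall>k<m. \<not> cut_at (p @ 2 # z @ q) k \<and> \<not> cut_at (rev (p @ 2 # z @ q)) k"
  proof (intro allI impI)
    fix k assume "k < m"
    show "\<not> cut_at (p @ 2 # z @ q) k \<and> \<not> cut_at (rev (p @ 2 # z @ q)) k"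
    proof (cases "k = 0")
      case True
      then show ?thesis using cut_at_bounds by blast
    next
      case False
      then show ?thesis using i cut_transfer[OF assms _ \<open>k < m\<close>] by (simp add: uncut_def)
    qed
  qed
next
  assume h: "\<forall>k<m. \<not> cut_at (p @ 2 # z @ q) k \<and> \<not> cut_at (rev (p @ 2 # z @ q)) k"
  have "\<not> cut_at (p @ 1 # q) k \<and> \<not> cut_at (rev (p @ 1 # q)) k" for k
  proof (cases "0 < k \<and> k < m")
    case True
    then show ?thesis using h cut_transfer[OF assms, of k] by blast
  next
    case False
    have "sum_list (p @ 1 # q) = 2 * m" using assms by simp
    then show ?thesis using False cut_at_bounds[of "p @ 1 # q" k] cut_at_bounds[of "rev (p @ 1 # q)" k] by auto
  qed
  then show "uncut (p @ 1 # q)" by (simp add: uncut_def)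
qed

text \<open>Outer pieces that start with 1, counted in both orientations.\<close>

definition mid :: "nat \<Rightarrow> nat \<Rightarrow> nat" where
  "mid m s = card {pq \<in> pieces m s. \<exists>p. fst pq = 1 # p} + card {pq \<in> pieces m s. \<exists>q. snd pq = q @ [1]}"

context
  fixes e :: nat and sp :: bool
  assumes e1: "e \<le> 1" and spe: "sp \<longrightarrow> e = 0"
begin

lemma glue_comps:
  assumes pq: "(p, q) \<in> pieces m s" and z: "z \<in> tails e sp (n - m) (t - s)" and "m \<le> n" "s \<le> t"
  shows "p @ 2 # z @ q \<in> comps e sp n t"
proof -
  have p: "pos p" "pos q" "sum_list p + 1 = m" "sum_list q = m" "Fr1 (p @ 1 # q)" "length p + length q + s = m"
    using pq by (auto simp: pieces_def)
  have z': "pos z" "1 + sum_list z = 2 * (n - m) + e" "Fr1 (1 # z)" "length z + (t - s) = n - m" "sp \<longrightarrow> prefix_sum (1 # z) (n - m)"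
    using z by (auto simp: tails_iff)
  have nm: "0 < n - m \<or> \<not> sp" using z'(2) spe by auto
  have "sp \<longrightarrow> prefix_sum (p @ 2 # z @ q) n"
    using prefix_sum_middle[OF p(3) assms(3) nm _ p(4) spe, of z] z'(2,5) by simp
  moreover have "Fr1 (p @ 2 # z @ q)" using cut_single[OF p(1,2) z'(1)] p z' by simp
  ultimately show ?thesis using p z' assms(3,4) by (auto simp: comps_def)
qed

text \<open>Gluing and cutting at the first cut are inverse to each other.\<close>

lemma glued_iff:
  "a \<in> glued Q e sp n t \<longleftrightarrow> a \<in> comps e sp n t \<and> (\<exists>p z q m. a = p @ 2 # z @ q \<and> sum_list p + 1 = m \<and>
     sum_list q = m \<and> Q (p, q) \<and> (\<forall>k<m. \<not> cut_at a k \<and> \<not> cut_at (rev a) k))"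
proof
  assume "a \<in> glued Q e sp n t"
  then obtain m s p q z where h: "m \<le> n" "s \<le> t" "(p, q) \<in> pieces m s" "Q (p, q)" "z \<in> tails e sp (n - m) (t - s)"
    and a: "a = p @ 2 # z @ q"
    by (auto simp: glued_def glue_def)
  have p: "pos p" "pos q" "sum_list p + 1 = m" "sum_list q = m" "uncut (p @ 1 # q)"
    using h by (auto simp: pieces_def)
  have "pos z" using h by (simp add: tails_iff)
  then have "\<forall>k<m. \<not> cut_at a k \<and> \<not> cut_at (rev a) k"
    using uncut_piece_iff[OF p(1,2) _ p(3,4)] p(5) a by blast
  then show "a \<in> comps e sp n t \<and> (\<exists>p z q m. a = p @ 2 # z @ q \<and> sum_list p + 1 = m \<and>
     sum_list q = m \<and> Q (p, q) \<and> (\<forall>k<m. \<not> cut_at a k \<and> \<not> cut_at (rev a) k))"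
    using glue_comps[OF h(3,5,1,2)] a p h by blast
next
  assume "a \<in> comps e sp n t \<and> (\<exists>p z q m. a = p @ 2 # z @ q \<and> sum_list p + 1 = m \<and>
     sum_list q = m \<and> Q (p, q) \<and> (\<forall>k<m. \<not> cut_at a k \<and> \<not> cut_at (rev a) k))"
  then obtain p z q m where ac: "a \<in> comps e sp n t" and a: "a = p @ 2 # z @ q" and p: "sum_list p + 1 = m" "sum_list q = m"
    and Q: "Q (p, q)" and cuts: "\<forall>k<m. \<not> cut_at a k \<and> \<not> cut_at (rev a) k" by blast
  have c: "pos a" "sum_list a = 2 * n + e" "Fr1 a" "length a + t = n + 1" "sp \<longrightarrow> prefix_sum a n"
    using ac by (auto simp: comps_def)
  have ps: "pos p" "pos q" "pos z" using c(1) a by auto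
  have fr: "Fr1 (p @ 1 # q)" "Fr1 (1 # z)" using cut_single[OF ps(1,2,3)] c(3) a p by auto
  have i: "uncut (p @ 1 # q)" using uncut_piece_iff[OF ps p] cuts a by blast
  have sum: "2 * m + 1 + sum_list z = 2 * n + e" using c(2) a p by simp
  then have mn: "m \<le> n" using e1 by linarith
  have sz: "1 + sum_list z = 2 * (n - m) + e" using sum mn by simp
  have "excess (p @ 1 # q) + length (p @ 1 # q) = m + 1"
    by (rule excess_length[of _ _ 0]) (use ps p fr in auto)
  then have l1: "length p + length q \<le> m" by simp
  have "excess (1 # z) + length (1 # z) = (n - m) + 1"
    by (rule excess_length[of _ _ e]) (use ps sz fr e1 in auto)
  then have l2: "length z \<le> n - m" by simp
  define s where "s = m - (length p + length q)"
  have len: "length p + length z + length q + t = n" using c(4) a by simp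
  have st: "s \<le> t" using len l1 l2 mn unfolding s_def by linarith
  have nm: "0 < n - m \<or> \<not> sp" using sz spe by auto
  have "(p, q) \<in> pieces m s" using ps p fr i l1 by (auto simp: pieces_def s_def)
  moreover have "z \<in> tails e sp (n - m) (t - s)"
    unfolding tails_iff
  proof (intro conjI)
    show "length z + (t - s) = n - m" using len l1 l2 mn st unfolding s_def by linarith
    show "sp \<longrightarrow> prefix_sum (1 # z) (n - m)" using prefix_sum_middle[OF p(1) mn nm _ p(2) spe, of z] sz c(5) a by simp
  qed (use ps sz fr in auto)
  moreover have "1 \<le> m" using p by simp
  ultimately show "a \<in> glued Q e sp n t"
    unfolding glued_def using mn st Q a
    by (intro image_eqI[of _ _ "((m, s), (p, q), z)"]) (auto simp: glue_def)
qed

lemma card_glued: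
  "card (glued Q e sp n t) = (\<Sum>m=1..n. \<Sum>s\<le>t. card {pq \<in> pieces m s. Q pq} * card (tails e sp (n - m) (t - s)))"
proof -
  let ?I = "SIGMA k:{1..n} \<times> {..t}. {pq \<in> pieces (fst k) (snd k). Q pq} \<times> tails e sp (n - fst k) (t - snd k)"
  have inj: "inj_on (\<lambda>(k, pq, z). glue pq z) ?I"
  proof (rule inj_onI)
    fix x y assume x: "x \<in> ?I" and y: "y \<in> ?I" and eq: "(\<lambda>(k, pq, z). glue pq z) x = (\<lambda>(k, pq, z). glue pq z) y"
    obtain m s p q z where xe: "x = ((m, s), (p, q), z)" by (metis surj_pair)
    obtain m' s' p' q' z' where ye: "y = ((m', s'), (p', q'), z')" by (metis surj_pair)
    have px: "pos p" "pos q" "sum_list p + 1 = m" "sum_list q = m" "uncut (p @ 1 # q)" "length p + length q + s = m" "pos z"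
      using x by (auto simp: xe pieces_def tails_iff)
    have py: "pos p'" "pos q'" "sum_list p' + 1 = m'" "sum_list q' = m'" "uncut (p' @ 1 # q')" "length p' + length q' + s' = m'" "pos z'"
      using y by (auto simp: ye pieces_def tails_iff)
    have e: "p @ 2 # z @ q = p' @ 2 # z' @ q'" using eq by (simp add: xe ye glue_def)
    have "cut_at (p @ 2 # z @ q) m" unfolding cut_at_def using px by blast
    then have 1: "\<not> m < m'" using uncut_piece_iff[OF py(1,2,7,3,4)] py(5) e by metis
    have "cut_at (p' @ 2 # z' @ q') m'" unfolding cut_at_def using py by blast
    then have 2: "\<not> m' < m" using uncut_piece_iff[OF px(1,2,7,3,4)] px(5) e by metis
    have mmul: "m = m'" using 1 2 by simp
    have "pos (p @ 2 # z @ q)" using px by auto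
    then have pp: "p = p'" "2 # z @ q = 2 # z' @ q'"
      using split_unique[of p "2 # z @ q" p' "2 # z' @ q'"] e px(3) py(3) mmul by auto
    then have zq: "z @ q = z' @ q'" by simp
    then have "sum_list z = sum_list z'" using px(4) py(4) mmul by (metis add_right_cancel sum_list_append)
    moreover have "pos (z @ q)" using px by auto
    ultimately have "z = z'" "q = q'" using split_unique[of z q z' q'] zq by auto
    then show "x = y" using xe ye mmul pp px(6) py(6) by simp
  qed
  have "card (glued Q e sp n t) = card ?I" unfolding glued_def by (rule card_image[OF inj])
  also have "\<dots> = (\<Sum>k\<in>{1..n} \<times> {..t}. card ({pq \<in> pieces (fst k) (snd k). Q pq} \<times> tails e sp (n - fst k) (t - snd k)))"
    by (rule card_SigmaI) (auto simp: finite_tails finite_pieces)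
  also have "\<dots> = (\<Sum>m=1..n. \<Sum>s\<le>t. card {pq \<in> pieces m s. Q pq} * card (tails e sp (n - m) (t - s)))"
    by (simp add: card_cartesian_product sum.cartesian_product case_prod_unfold)
  finally show ?thesis .
qed

lemma first_cut_cases:
  assumes a: "a \<in> comps e sp n t" and "\<not> uncut a"
  shows "a \<in> glued (\<lambda>_. True) e sp n t \<or> rev a \<in> glued (\<lambda>_. True) e sp n t"
proof -
  let ?c = "\<lambda>m. cut_at a m \<or> cut_at (rev a) m"
  have "\<exists>m. ?c m" using assms(2) by (auto simp: uncut_def)
  then obtain m where m: "?c m" "\<forall>k<m. \<not> ?c k" using exists_least_iff[of ?c] by blast
  have ra: "rev a \<in> comps e sp n t" using comps_rev[OF spe] a by blast
  show ?thesis
  proof (cases "cut_at a m")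
    case True
    then obtain p z q where "a = p @ 2 # z @ q" "sum_list p + 1 = m" "sum_list q = m" by (auto simp: cut_at_def)
    then have "a \<in> glued (\<lambda>_. True) e sp n t"
      unfolding glued_iff using a m(2) by blast
    then show ?thesis by blast
  next
    case False
    then have "cut_at (rev a) m" using m by blast
    then obtain p z q where "rev a = p @ 2 # z @ q" "sum_list p + 1 = m" "sum_list q = m" by (auto simp: cut_at_def)
    then have "rev a \<in> glued (\<lambda>_. True) e sp n t"
      unfolding glued_iff using ra m(2) by (metis rev_rev_ident)
    then show ?thesis by blast
  qed
qed

text \<open>If the first cut were of both kinds, its position would be both the centre of a part and a boundary.\<close>

lemma glued_rev_disjoint:
  assumes "a \<in> glued Q e sp n t" "rev a \<in> glued Q' e sp n t"
  shows False
proof -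
  obtain p z q m where 1: "a = p @ 2 # z @ q" "sum_list p + 1 = m" "sum_list q = m" "\<forall>k<m. \<not> cut_at a k \<and> \<not> cut_at (rev a) k"
    using assms(1) unfolding glued_iff by blast
  obtain p' z' q' m' where 2: "rev a = p' @ 2 # z' @ q'" "sum_list p' + 1 = m'" "sum_list q' = m'"
    "\<forall>k<m'. \<not> cut_at (rev a) k \<and> \<not> cut_at (rev (rev a)) k"
    using assms(2) unfolding glued_iff by blast
  have "cut_at a m" "cut_at (rev a) m'" using 1 2 unfolding cut_at_def by blast+
  then have mmul: "m = m'" using 1(4) 2(4) by (metis linorder_neqE_nat rev_rev_ident)
  have "two_at a (m - 1)" unfolding two_at_def using 1 by (intro exI[of _ p] exI[of _ "z @ q"]) auto
  moreover have "a = rev q' @ rev (p' @ 2 # z')" using 2(1) by (metis append.assoc append_Cons rev_append rev_rev_ident)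
  then have "prefix_sum a m" unfolding prefix_sum_def using 2(3) mmul by (intro exI[of _ "rev q'"] exI[of _ "rev (p' @ 2 # z')"] conjI) (assumption, simp)
  moreover have "m - 1 + 1 = m" using 1 by simp
  ultimately show False using two_at_center[of a "m - 1"] by simp
qed

lemma glued_not_uncut: "a \<in> glued Q e sp n t \<Longrightarrow> \<not> uncut a"
  unfolding glued_iff uncut_def cut_at_def by blast

lemma finite_glued: "finite (glued Q e sp n t)"
  by (rule finite_subset[OF _ finite_comps[of e sp n t]]) (auto simp: glued_iff)

text \<open>A composition has no cut, or its first cut is as in \<open>cut_at\<close>, or this holds for its mirror image. The
property \<open>R\<close> of the composition must be visible on the outer piece.\<close>

lemma card_comps_partition:
  assumes R: "\<And>p z q. R (p @ 2 # z @ q) \<longleftrightarrow> Q1 (p, q)"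
    and R': "\<And>p z q. 0 < sum_list q \<Longrightarrow> R (rev (p @ 2 # z @ q)) \<longleftrightarrow> Q2 (p, q)"
  shows "card {a \<in> comps e sp n t. R a} =
    card {a \<in> comps e sp n t. R a \<and> uncut a} + card (glued Q1 e sp n t) + card (glued Q2 e sp n t)"
proof -
  let ?I = "{a \<in> comps e sp n t. R a \<and> uncut a}"
  have un: "{a \<in> comps e sp n t. R a} = (?I \<union> glued Q1 e sp n t) \<union> rev ` glued Q2 e sp n t"
  proof (intro equalityI subsetI)
    fix a assume a: "a \<in> {a \<in> comps e sp n t. R a}"
    show "a \<in> (?I \<union> glued Q1 e sp n t) \<union> rev ` glued Q2 e sp n t"
    proof (cases "uncut a")
      case False
      then consider "a \<in> glued (\<lambda>_. True) e sp n t" | "rev a \<in> glued (\<lambda>_. True) e sp n t"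
        using first_cut_cases a by blast
      then show ?thesis
      proof cases
        case 1
        then have "a \<in> glued Q1 e sp n t" using a R unfolding glued_iff by blast
        then show ?thesis by blast
      next
        case 2
        then obtain p z q m where h: "rev a = p @ 2 # z @ q" "sum_list p + 1 = m" "sum_list q = m"
          "\<forall>k<m. \<not> cut_at (rev a) k \<and> \<not> cut_at (rev (rev a)) k"
          unfolding glued_iff by blast
        have "a = rev (p @ 2 # z @ q)" using h(1) by (metis rev_rev_ident)
        then have "Q2 (p, q)" using a R'[of q p z] h(2,3) by simp
        then have "rev a \<in> glued Q2 e sp n t" using 2 h unfolding glued_iff by blast
        then have "rev (rev a) \<in> rev ` glued Q2 e sp n t" by (rule imageI)
        then show ?thesis by simp
      qed
    qed (use a in blast)
  next
    fix a assume "a \<in> (?I \<union> glued Q1 e sp n t) \<union> rev ` glued Q2 e sp n t"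
    then consider "a \<in> ?I" | "a \<in> glued Q1 e sp n t" | b where "b \<in> glued Q2 e sp n t" "a = rev b" by blast
    then show "a \<in> {a \<in> comps e sp n t. R a}"
    proof cases
      case 2
      then show ?thesis using R unfolding glued_iff by blast
    next
      case 3
      then obtain p z q m where h: "b \<in> comps e sp n t" "b = p @ 2 # z @ q" "sum_list p + 1 = m"
        "sum_list q = m" "Q2 (p, q)"
        unfolding glued_iff by blast
      then have "0 < sum_list q" by linarith
      then have "R a" using R'[of q p z] 3(2) h by blast
      then show ?thesis using h(1) comps_rev[OF spe, of b] 3 by simp
    qed blast
  qed
  have fI: "finite ?I" by (rule finite_subset[OF _ finite_comps[of e sp n t]]) auto
  have "card ((?I \<union> glued Q1 e sp n t) \<union> rev ` glued Q2 e sp n t) = card (?I \<union> glued Q1 e sp n t) + card (rev ` glued Q2 e sp n t)"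
  proof (rule card_Un_disjoint)
    show "(?I \<union> glued Q1 e sp n t) \<inter> rev ` glued Q2 e sp n t = {}"
      using glued_not_uncut glued_rev_disjoint uncut_rev by (fastforce simp: image_iff)
  qed (use fI finite_glued in auto)
  also have "card (?I \<union> glued Q1 e sp n t) = card ?I + card (glued Q1 e sp n t)"
    by (rule card_Un_disjoint) (use fI finite_glued glued_not_uncut in auto)
  also have "card (rev ` glued Q2 e sp n t) = card (glued Q2 e sp n t)"
    by (intro card_image) (auto simp: inj_on_def)
  finally show ?thesis unfolding un .
qed

lemma card_comps:
  "card (comps e sp n t) = card {a \<in> comps e sp n t. uncut a} +
     2 * (\<Sum>m=1..n. \<Sum>s\<le>t. card (pieces m s) * card (tails e sp (n - m) (t - s)))"
  using card_comps_partition[of "\<lambda>_. True" "\<lambda>_. True" "\<lambda>_. True" n t] by (simp add: card_glued)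

lemma card_tails:
  "card (tails e sp n t) = card {a \<in> comps e sp n t. (\<exists>z. a = 1 # z) \<and> uncut a} +
     (\<Sum>m=1..n. \<Sum>s\<le>t. mid m s * card (tails e sp (n - m) (t - s)))"
proof -
  have "card (tails e sp n t) = card ((\<lambda>z. 1 # z) ` tails e sp n t)"
    by (intro card_image[symmetric]) (auto simp: inj_on_def)
  also have "(\<lambda>z. 1 # z) ` tails e sp n t = {a \<in> comps e sp n t. \<exists>z. a = 1 # z}"
    by (auto simp: tails_def)
  also have "card \<dots> = card {a \<in> comps e sp n t. (\<exists>z. a = 1 # z) \<and> uncut a} +
      card (glued (\<lambda>pq. \<exists>p. fst pq = 1 # p) e sp n t) + card (glued (\<lambda>pq. \<exists>q. snd pq = q @ [1]) e sp n t)"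
  proof (rule card_comps_partition)
    show "(\<exists>z'. p @ 2 # z @ q = 1 # z') \<longleftrightarrow> (\<exists>p'. fst (p, q) = 1 # p')" for p z q :: "nat list"
      by (cases p) auto
    show "(\<exists>z'. rev (p @ 2 # z @ q) = 1 # z') \<longleftrightarrow> (\<exists>q'. snd (p, q) = q' @ [1])" if "0 < sum_list q" for p z q :: "nat list"
      using that by (cases q rule: rev_cases) auto
  qed
  finally show ?thesis by (simp add: card_glued mid_def sum.distrib distrib_right)
qed

end

end

section \<open>Eventually polynomial sequences\<close>

text \<open>The bound on the degree and the explicit coefficient make this closed under sums even if leading
coefficients vanish.\<close>

definition ev_poly :: "(nat \<Rightarrow> nat) \<Rightarrow> nat \<Rightarrow> rat \<Rightarrow> bool" where
  "ev_poly h d c \<longleftrightarrow> (\<exists>P :: rat poly. degree P \<le> d \<and> coeff P d = c \<and>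
     (\<forall>\<^sub>F n in sequentially. of_nat (h n) = poly P (of_nat n)))"

lemma ev_poly_zero: "\<forall>\<^sub>F n in sequentially. h n = 0 \<Longrightarrow> ev_poly h d 0"
  unfolding ev_poly_def by (rule exI[of _ 0]) (auto elim: eventually_mono)

lemma ev_poly_add: "ev_poly f d a \<Longrightarrow> ev_poly g d b \<Longrightarrow> ev_poly (\<lambda>n. f n + g n) d (a + b)"
proof -
  assume "ev_poly f d a" "ev_poly g d b"
  then obtain P Q :: "rat poly" where P: "degree P \<le> d" "coeff P d = a" "\<forall>\<^sub>F n in sequentially. of_nat (f n) = poly P (of_nat n)"
    and Q: "degree Q \<le> d" "coeff Q d = b" "\<forall>\<^sub>F n in sequentially. of_nat (g n) = poly Q (of_nat n)"
    by (auto simp: ev_poly_def)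
  have "\<forall>\<^sub>F n in sequentially. of_nat (f n + g n) = poly (P + Q) (of_nat n)"
    using P(3) Q(3) by eventually_elim simp
  then show ?thesis unfolding ev_poly_def using P Q by (intro exI[of _ "P + Q"]) (auto intro: degree_add_le)
qed

lemma ev_poly_const_mult: "ev_poly f d a \<Longrightarrow> ev_poly (\<lambda>n. k * f n) d (of_nat k * a)"
proof -
  assume "ev_poly f d a"
  then obtain P :: "rat poly" where P: "degree P \<le> d" "coeff P d = a" "\<forall>\<^sub>F n in sequentially. of_nat (f n) = poly P (of_nat n)"
    by (auto simp: ev_poly_def)
  have "\<forall>\<^sub>F n in sequentially. of_nat (k * f n) = poly (Polynomial.smult (of_nat k) P) (of_nat n)"
    using P(3) by eventually_elim simp
  then show ?thesis unfolding ev_poly_def using P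
    by (intro exI[of _ "Polynomial.smult (of_nat k) P"]) (auto intro: degree_smult_le[THEN order_trans])
qed

lemma ev_poly_sum:
  assumes "finite A" "\<And>i. i \<in> A \<Longrightarrow> ev_poly (f i) d (c i)"
  shows "ev_poly (\<lambda>n. \<Sum>i\<in>A. f i n) d (\<Sum>i\<in>A. c i)"
  using assms
proof (induction A rule: finite_induct)
  case empty
  show ?case by (simp add: ev_poly_zero)
next
  case (insert i A)
  then show ?case by (simp add: ev_poly_add)
qed

lemma ev_poly_mono:
  assumes "ev_poly h d c" "d < d'"
  shows "ev_poly h d' 0"
proof -
  obtain P :: "rat poly" where P: "degree P \<le> d" "\<forall>\<^sub>F n in sequentially. of_nat (h n) = poly P (of_nat n)"
    using assms(1) by (auto simp: ev_poly_def)
  then have "degree P \<le> d'" "coeff P d' = 0" using assms(2) by (auto intro: coeff_eq_0)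
  then show ?thesis unfolding ev_poly_def using P(2) by blast
qed

lemma ev_poly_shift:
  assumes "ev_poly h d c"
  shows "ev_poly (\<lambda>n. h (n - m)) d c"
proof -
  obtain P :: "rat poly" where P: "degree P \<le> d" "coeff P d = c" "\<forall>\<^sub>F n in sequentially. of_nat (h n) = poly P (of_nat n)"
    using assms by (auto simp: ev_poly_def)
  let ?Q = "pcompose P [:- of_nat m, 1:]"
  have deg: "degree ?Q = degree P" by (simp add: degree_pcompose)
  have "coeff ?Q d = c"
  proof (cases "degree P = d")
    case True
    have "lead_coeff ?Q = lead_coeff P * lead_coeff [:- of_nat m, 1:] ^ degree P"
      by (rule lead_coeff_comp) simp
    then show ?thesis using True P(2) deg by simp
  next
    case False
    then have "degree P < d" using P(1) by simp
    then show ?thesis using P(2) deg by (simp add: coeff_eq_0)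
  qed
  moreover have "\<forall>\<^sub>F n in sequentially. of_nat (h (n - m)) = poly ?Q (of_nat n)"
  proof -
    obtain N where N: "\<And>n. n \<ge> N \<Longrightarrow> of_nat (h n) = poly P (of_nat n)"
      using P(3) by (auto simp: eventually_sequentially)
    have "of_nat (h (n - m)) = poly ?Q (of_nat n)" if "n \<ge> N + m" for n
    proof -
      have "of_nat (h (n - m)) = poly P (of_nat (n - m))" using N that by simp
      also have "of_nat (n - m) = (of_nat n - of_nat m :: rat)" using that by (simp add: of_nat_diff)
      finally show ?thesis by (simp add: poly_pcompose)
    qed
    then show ?thesis by (auto simp: eventually_sequentially)
  qed
  ultimately show ?thesis unfolding ev_poly_def using deg P(1) by (intro exI[of _ ?Q]) simp
qed

text \<open>By induction on the degree, using that the difference of \<open>x^(k + 1)\<close> has leading term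
\<open>(k + 1) x^k\<close>.\<close>

lemma poly_antidifference:
  fixes P :: "rat poly"
  assumes "degree P \<le> d"
  shows "\<exists>Q. degree Q \<le> Suc d \<and> coeff Q (Suc d) = coeff P d / of_nat (Suc d) \<and>
    (\<forall>x. poly Q (x + 1) - poly Q x = poly P x)"
  using assms
proof (induction d arbitrary: P)
  case 0
  then obtain a where "P = [:a:]" by (metis degree_eq_zeroE le_zero_eq)
  then show ?case by (intro exI[of _ "[:0, a:]"]) (simp add: algebra_simps)
next
  case (Suc d)
  let ?n = "Suc (Suc d)"
  \<comment> \<open>Subtracting the difference of a multiple of \<open>x^(d + 2)\<close> removes the leading coefficient.\<close>
  let ?b = "coeff P (Suc d) / of_nat ?n"
  let ?D = "Polynomial.smult ?b ([:1, 1:] ^ ?n - monom 1 ?n)"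
  have cD: "coeff ?D k = ?b * (of_nat (?n choose k) - (if k = ?n then 1 else 0))" for k
  proof -
    have "coeff ([:1, 1 :: rat:] ^ N) k = of_nat (N choose k)" for N
    proof (cases "k \<le> N")
      case True
      then show ?thesis by (simp add: coeff_linear_poly_power)
    next
      case False
      then show ?thesis by (simp add: coeff_eq_0 degree_linear_power)
    qed
    then show ?thesis by (simp only: coeff_smult coeff_diff coeff_monom) (simp only: eq_commute[of ?n k])
  qed
  let ?P = "P - ?D"
  have "coeff ?P k = 0" if "k > d" for k
  proof -
    consider "k = Suc d" | "k = ?n" | "k > ?n" using \<open>k > d\<close> by linarith
    then show ?thesis
    proof cases
      case 1
      have "?n choose Suc d = ?n" using binomial_symmetric[of "Suc d" ?n] by simp
      moreover have "(of_nat ?n :: rat) \<noteq> 0" using of_nat_neq_0 by blast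
      ultimately show ?thesis unfolding coeff_diff cD using 1 by (simp del: of_nat_Suc binomial_Suc_Suc)
    next
      case 2
      have "coeff P ?n = 0" using Suc.prems by (intro coeff_eq_0) simp
      then show ?thesis unfolding coeff_diff cD using 2 by simp
    next
      case 3
      have "coeff P k = 0" using Suc.prems 3 by (intro coeff_eq_0) simp
      moreover have "?n choose k = 0" using 3 by (rule binomial_eq_0)
      ultimately show ?thesis unfolding coeff_diff cD using 3 by (simp del: binomial_Suc_Suc)
    qed
  qed
  then have "degree ?P \<le> d" by (intro degree_le) blast
  then obtain Q where Q: "degree Q \<le> Suc d" "\<forall>x. poly Q (x + 1) - poly Q x = poly ?P x"
    using Suc.IH by blast
  let ?Q = "Q + monom ?b ?n"
  have "degree ?Q \<le> ?n" using Q(1) by (intro degree_add_le) (auto intro: degree_monom_le)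
  moreover have "coeff ?Q ?n = ?b" using Q(1) by (simp add: coeff_eq_0)
  moreover have "poly ?Q (x + 1) - poly ?Q x = poly P x" for x
  proof -
    have D: "poly ?D x = ?b * ((x + 1) ^ ?n - x ^ ?n)"
      by (simp only: poly_smult poly_diff poly_power poly_monom poly_pCons poly_0 mult_1 mult_zero_right
        add_0_right mult_1_right add.commute[of 1 x])
    have "poly Q (x + 1) - poly Q x = poly P x - poly ?D x" using Q(2) by (simp only: poly_diff)
    moreover have "poly ?Q (x + 1) - poly ?Q x = (poly Q (x + 1) - poly Q x) + ?b * ((x + 1) ^ ?n - x ^ ?n)"
      unfolding poly_add poly_monom right_diff_distrib by (rule add_diff_add)
    ultimately show ?thesis unfolding D by (simp only: diff_add_cancel)
  qed
  ultimately show ?case by blast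
qed

lemma eventually_constant:
  assumes "\<forall>\<^sub>F n in sequentially. h (Suc n) = h n"
  obtains c where "\<forall>\<^sub>F n in sequentially. h n = c"
proof -
  obtain N where N: "\<And>n. n \<ge> N \<Longrightarrow> h (Suc n) = h n" using assms by (auto simp: eventually_sequentially)
  have "h n = h N" if "n \<ge> N" for n
    using that by (induction n rule: dec_induct) (use N in auto)
  then have "\<forall>\<^sub>F n in sequentially. h n = h N" unfolding eventually_sequentially by blast
  then show thesis by (rule that)
qed

lemma ev_poly_antidifference:
  assumes "\<forall>\<^sub>F n in sequentially. h (Suc n) = h n + g n" "ev_poly g d c"
  shows "ev_poly h (Suc d) (c / of_nat (Suc d))"
proof -
  obtain P :: "rat poly" where P: "degree P \<le> d" "coeff P d = c" "\<forall>\<^sub>F n in sequentially. of_nat (g n) = poly P (of_nat n)"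
    using assms(2) by (auto simp: ev_poly_def)
  obtain Q where Q: "degree Q \<le> Suc d" "coeff Q (Suc d) = c / of_nat (Suc d)" "\<forall>x. poly Q (x + 1) - poly Q x = poly P x"
    using poly_antidifference[OF P(1)] P(2) by blast
  have "\<forall>\<^sub>F n in sequentially. of_nat (h (Suc n)) - poly Q (of_nat (Suc n)) = of_nat (h n) - poly Q (of_nat n)"
    using assms(1) P(3)
  proof eventually_elim
    case (elim n)
    have "poly Q (of_nat n + 1) - poly Q (of_nat n) = poly P (of_nat n)" using Q(3) by blast
    then show ?case using elim by (simp add: algebra_simps)
  qed
  then obtain a where a: "\<forall>\<^sub>F n in sequentially. of_nat (h n) - poly Q (of_nat n) = a"
    by (rule eventually_constant)
  have "\<forall>\<^sub>F n in sequentially. of_nat (h n) = poly (Q + [:a:]) (of_nat n)"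
    using a by eventually_elim (simp add: algebra_simps)
  moreover have "degree (Q + [:a:]) \<le> Suc d" using Q(1) by (intro degree_add_le) auto
  moreover have "coeff (Q + [:a:]) (Suc d) = c / of_nat (Suc d)" using Q(2) by simp
  ultimately show ?thesis unfolding ev_poly_def by blast
qed

lemma ev_poly_imp_poly:
  assumes "ev_poly h d c" "0 < c"
  shows "\<exists>P :: rat poly. degree P = d \<and> lead_coeff P > 0 \<and>
    (\<forall>\<^sub>F n in sequentially. of_nat (h n) = poly P (of_nat n))"
proof -
  obtain P :: "rat poly" where P: "degree P \<le> d" "coeff P d = c" "\<forall>\<^sub>F n in sequentially. of_nat (h n) = poly P (of_nat n)"
    using assms by (auto simp: ev_poly_def)
  then have "degree P = d" using assms(2) le_degree[of P d] by auto
  then show ?thesis using P assms(2) by auto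
qed

lemma ev_poly_weaken:
  assumes "ev_poly h d c" "d \<le> d'" "0 \<le> c"
  obtains c' where "ev_poly h d' c'" "0 \<le> c'" "d = d' \<Longrightarrow> c' = c"
  using assms ev_poly_mono[OF assms(1), of d'] by (cases "d = d'") auto

section \<open>Pieces of small excess and the growth of the counts\<close>

context frobenius_pairs
begin

lemma excess_rev: "excess (rev l) = excess l"
  by (simp add: excess_def rev_map[symmetric])

text \<open>The composition starts with 1, so by symmetry of boundaries the last part is not 1, and it is not 2
because of the cut at 1. Hence it carries all the excess; it is even, so it is 4, and the remaining
parts are 2 except for a single 1. If there are two parts 2 after the first part, there is a cut
at 4; the assumption on the position of the second 1 leaves only \<open>[1, 2, 1, 4]\<close>.\<close>

lemma small_excess_not_uncut:
  assumes l: "l = 1 # l'" and p: "pos l" and fr: "Fr1 l" and i: "uncut l" and m: "sum_list l = 2 * m" "2 \<le> m"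
    and ex: "excess l \<le> 1" and uv: "l = u @ 1 # v" "u \<noteq> []" "sum_list u + 1 = m \<or> sum_list u = m"
  shows False
proof -
  let ?N = "sum_list l"
  note nosym = Fr1_no_symmetric_boundaries[OF p]
  have "l' \<noteq> []" using l m by auto
  then obtain w c where w: "l' = w @ [c]" by (metis rev_exhaust)
  have b1: "prefix_sum l 1" unfolding l prefix_sum_Cons by auto
  have lc: "l = (1 # w) @ [c]" using l w by simp
  have sl: "?N = 1 + sum_list w + c" using lc by simp
  have bc: "prefix_sum l (?N - c)" unfolding prefix_sum_def using lc sl by (intro exI[of _ "1 # w"] exI[of _ "[c]"]) simp
  have c0: "0 < c" using p lc by simp
  have "c \<noteq> 1" using nosym[OF b1] bc fr m by auto
  moreover have "c \<noteq> 2"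
  proof
    assume c: "c = 2"
    have "two_at (rev l) 0" using lc c by (simp add: two_at_Cons)
    moreover have "prefix_sum (rev l) (?N - 1)" using b1 m by (simp add: prefix_sum_rev)
    ultimately have "cut_at (rev l) 1" using cut_at_iff[of "rev l" 1] p m by simp
    then show False using i by (simp add: uncut_def)
  qed
  ultimately have c3: "3 \<le> c" using c0 by linarith
  have "excess l = excess w + (c - 1) div 2" using lc by (simp add: excess_def)
  moreover have "1 \<le> (c - 1) div 2" using c3 by linarith
  ultimately have ew: "excess w = 0" and cd: "(c - 1) div 2 = 1" using ex by linarith+
  obtain u' where u: "u = 1 # u'" using uv(1,2) l by (cases u) auto
  have "v \<noteq> []" using uv(1) lc \<open>c \<noteq> 1\<close> by auto
  then obtain v' c' where "v = v' @ [c']" by (metis rev_exhaust)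
  then have "c' = c" and v: "v = v' @ [c]" and wuv: "w = u' @ 1 # v'" using uv(1) lc u by auto
  have odl: "odds l = 2" using odds_Fr1[OF fr p] m by simp
  have "odds l = 2 + odds u' + odds v' + (if odd c then 1 else 0)" using lc wuv by simp
  then have "odds u' = 0" "odds v' = 0" "even c" using odl by (auto split: if_splits)
  then have c4: "c = 4" using cd c3 by presburger
  have two: "x = 2" if "x \<in> set u' \<union> set v'" for x
  proof -
    have "even x" using \<open>odds u' = 0\<close> \<open>odds v' = 0\<close> that by (auto simp: odds_def filter_empty_conv)
    moreover have "(x - 1) div 2 = 0" using ew that wuv by (auto simp: excess_def)
    moreover have "0 < x" using p that lc wuv by auto
    ultimately show ?thesis by presburger
  qed
  have ru: "u' = replicate (length u') 2" by (rule replicate_eqI) (use two in auto)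
  have rv: "v' = replicate (length v') 2" by (rule replicate_eqI) (use two in auto)
  have su: "sum_list u' = 2 * length u'" "sum_list v' = 2 * length v'"
    by (subst ru, simp add: sum_list_replicate) (subst rv, simp add: sum_list_replicate)
  have N: "?N = 6 + 2 * length u' + 2 * length v'" using sl wuv su c4 by simp
  have le: "length u' = 1 + length v' \<or> length u' = 2 + length v'"
    using uv(3) u su N m by auto
  show False
  proof (cases "length u' = 1")
    case True
    then have "v' = []" using le by auto
    moreover have "u' = [2]" using ru True by (metis One_nat_def replicate_0 replicate_Suc)
    ultimately have "l = [1, 2, 1, 4]" using lc wuv c4 by simp
    then show False using not_Fr1_1214 fr by simp
  next
    case False
    then have "2 \<le> length u'" using le by presburger
    then obtain k where k: "length u' = Suc (Suc k)" using le_Suc_ex[of 2 "length u'"] by auto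
    then have "u' = 2 # 2 # replicate k 2" using ru by simp
    then have "l = [1, 2] @ 2 # (replicate k 2 @ 1 # v' @ [c])" using lc wuv by simp
    then have "two_at l 3" unfolding two_at_def
      by (intro exI[of _ "[1, 2]"] exI[of _ "replicate k 2 @ 1 # v' @ [c]"] conjI) simp_all
    moreover have "prefix_sum l (?N - 4)" using bc c4 by simp
    moreover have "2 * 4 < ?N" using N k by simp
    ultimately have "cut_at l 4" using cut_at_iff[OF p, of 4] by simp
    then show False using i by (simp add: uncut_def)
  qed
qed

lemma pieces_1: "(p, q) \<in> pieces 1 s \<longleftrightarrow> p = [] \<and> q = [1] \<and> s = 0"
proof
  assume h: "(p, q) \<in> pieces 1 s"
  then have pq: "pos p" "pos q" "sum_list p = 0" "sum_list q = 1" "length p + length q + s = 1"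
    by (auto simp: pieces_def)
  have p: "p = []" using pq(1,3) by (cases p) auto
  obtain x q' where "q = x # q'" using pq(4) by (cases q) auto
  moreover have "q' = []" using pq calculation by (cases q') auto
  ultimately show "p = [] \<and> q = [1] \<and> s = 0" using p pq by auto
next
  assume h: "p = [] \<and> q = [1] \<and> s = 0"
  have "uncut [1, 1]" unfolding uncut_def cut_at_iff by (auto simp: cut_at_iff two_at_Cons)
  then show "(p, q) \<in> pieces 1 s" using h Fr1_11 by (simp add: pieces_def)
qed

lemma mid_1_0: "mid 1 0 = 1"
proof -
  have A: "{pq \<in> pieces 1 0. \<exists>p. fst pq = 1 # p} = {}" by (auto simp: pieces_1[simplified])
  have B: "{pq \<in> pieces 1 0. \<exists>q. snd pq = q @ [1]} = {([], [1])}" by (auto simp: pieces_1[simplified])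
  show ?thesis unfolding mid_def A B by simp
qed

text \<open>Pieces of excess 0 are trivial, and there are none of excess 1. This is why the degree is the half of
\<open>t\<close> and not \<open>t\<close>.\<close>

lemma mid_0: 
  assumes "s \<le> 1" "(m, s) \<noteq> (1, 0)"
  shows "mid m s = 0"
proof -
  have no: "(\<nexists>p'. p = 1 # p') \<and> (\<nexists>q'. q = q' @ [1])" if h: "(p, q) \<in> pieces m s" for p q
  proof -
    have "m \<noteq> 1" using pieces_1 h assms(2) by auto
    moreover have "0 < m" using h by (auto simp: pieces_def)
    ultimately have m: "2 \<le> m" by linarith
    have pq: "pos p" "pos q" "sum_list p + 1 = m" "sum_list q = m" "Fr1 (p @ 1 # q)" "uncut (p @ 1 # q)"
      using h by (auto simp: pieces_def)
    have ex: "excess (p @ 1 # q) = s" using comps_excess[OF pieces_comps[OF h]] m by simp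
    show ?thesis
    proof (intro conjI notI)
      assume "\<exists>p'. p = 1 # p'"
      then obtain p' where p: "p = 1 # p'" by blast
      show False
        by (rule small_excess_not_uncut[of "p @ 1 # q" "p' @ 1 # q" m p q]) (use p pq ex m assms in auto)
    next
      assume "\<exists>q'. q = q' @ [1]"
      then obtain q' where q: "q = q' @ [1]" by blast
      have "Fr1 (rev (p @ 1 # q))" "uncut (rev (p @ 1 # q))" "excess (rev (p @ 1 # q)) \<le> 1"
        using Fr1_rev uncut_rev excess_rev pq ex assms by metis+
      then show False
        by (intro small_excess_not_uncut[of "rev (p @ 1 # q)" "rev q' @ 1 # rev p" m "rev q" "rev p"])
          (use q pq m in auto)
    qed
  qed
  then have A: "{pq \<in> pieces m s. \<exists>p. fst pq = 1 # p} = {}" and B: "{pq \<in> pieces m s. \<exists>q. snd pq = q @ [1]} = {}"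
    by auto
  show ?thesis unfolding mid_def A B by simp
qed

text \<open>Two parts 4 facing each other with a shift by one, which let a single strand of the meander pass.\<close>

lemma mid_5_2: "0 < mid 5 2"
proof -
  have "uncut [4, 1, 4, 1]" unfolding uncut_def by (auto simp: cut_at_iff two_at_Cons)
  then have "([4], [4, 1]) \<in> pieces 5 2" using Fr1_4141 by (simp add: pieces_def)
  then have "([4], [4, 1]) \<in> {pq \<in> pieces 5 2. \<exists>q. snd pq = q @ [1]}" by simp
  then have "{pq \<in> pieces 5 2. \<exists>q. snd pq = q @ [1]} \<noteq> {}" by blast
  moreover have "finite {pq \<in> pieces 5 2. \<exists>q. snd pq = q @ [1]}"
    by (rule finite_subset[OF _ finite_pieces[of 5 2]]) blast
  ultimately have "0 < card {pq \<in> pieces 5 2. \<exists>q. snd pq = q @ [1]}" unfolding card_gt_0_iff by blast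
  then show ?thesis unfolding mid_def by linarith
qed

lemma mid_bound: "5 * s + 2 < m \<Longrightarrow> mid m s = 0" and card_pieces_bound: "5 * s + 2 < m \<Longrightarrow> pieces m s = {}"
proof -
  assume "5 * s + 2 < m"
  then show e: "pieces m s = {}" using pieces_bound by fastforce
  then show "mid m s = 0" by (simp add: mid_def)
qed

context
  fixes e :: nat and sp :: bool
  assumes e1: "e \<le> 1" and spe: "sp \<longrightarrow> e = 0"
begin

lemma tails_nonempty: "\<exists>n. tails e sp n 0 \<noteq> {}" "\<exists>n. tails e sp n 1 \<noteq> {}"
proof -
  have z: "tails 0 True n t \<subseteq> tails 0 False n t" for n t by (auto simp: tails_iff)
  have 1: "[1] \<in> tails 0 True 1 0" using Fr1_11 by (simp add: tails_iff prefix_sum_Cons)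
  have 2: "[2, 3] \<in> tails 0 True 3 1" using Fr1_123 by (simp add: tails_iff prefix_sum_Cons)
  have 3: "[] \<in> tails 1 False 0 0" using Fr1_1 by (simp add: tails_iff)
  have 4: "[4] \<in> tails 1 False 2 1" using Fr1_14 by (simp add: tails_iff)
  consider "e = 0" "sp" | "e = 0" "\<not> sp" | "e = 1" "\<not> sp" using e1 spe by linarith
  then show "\<exists>n. tails e sp n 0 \<noteq> {}" "\<exists>n. tails e sp n 1 \<noteq> {}"
    using 1 2 3 4 z by (cases; metis (full_types) empty_iff subsetD)+
qed

text \<open>Insertion of the trivial piece.\<close>

lemma tails_mono: "card (tails e sp n t) \<le> card (tails e sp (Suc n) t)"
proof -
  have "card (tails e sp n t) = mid 1 0 * card (tails e sp (Suc n - 1) (t - 0))" by (simp add: mid_1_0[simplified])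
  also have "\<dots> \<le> (\<Sum>s\<le>t. mid 1 s * card (tails e sp (Suc n - 1) (t - s)))"
    by (rule member_le_sum) auto
  also have "\<dots> \<le> (\<Sum>m=1..Suc n. \<Sum>s\<le>t. mid m s * card (tails e sp (Suc n - m) (t - s)))"
    by (rule member_le_sum[of 1 _ "\<lambda>m. \<Sum>s\<le>t. mid m s * card (tails e sp (Suc n - m) (t - s))"]) auto
  also have "\<dots> \<le> card (tails e sp (Suc n) t)" unfolding card_tails[OF e1 spe, of "Suc n"] by simp
  finally show ?thesis .
qed

lemma uncut_eventually_empty: "5 * t + 2 < n \<Longrightarrow> {a \<in> comps e sp n t. R a \<and> uncut a} = {}"
  using uncut_comps_bound[OF _ e1] by fastforce

text \<open>For large \<open>n\<close> every composition has a cut, the pieces have bounded size, and the trivial piece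
contributes the previous count.\<close>

lemma card_tails_step:
  assumes "5 * t + 2 < Suc n"
  shows "card (tails e sp (Suc n) t) = card (tails e sp n t) +
    (\<Sum>(m, s)\<in>{1..5 * t + 2} \<times> {2..t}. mid m s * card (tails e sp (n - (m - 1)) (t - s)))"
proof -
  let ?f = "\<lambda>(m, s). mid m s * card (tails e sp (Suc n - m) (t - s))"
  have "card (tails e sp (Suc n) t) = (\<Sum>k\<in>{1..Suc n} \<times> {..t}. ?f k)"
    unfolding card_tails[OF e1 spe, of "Suc n"] uncut_eventually_empty[OF assms]
    by (simp add: sum.cartesian_product)
  also have "\<dots> = (\<Sum>k\<in>insert (1, 0) ({1..5 * t + 2} \<times> {2..t}). ?f k)"
  proof (rule sum.mono_neutral_right)
    show "insert (1, 0) ({1..5 * t + 2} \<times> {2..t}) \<subseteq> {1..Suc n} \<times> {..t}" using assms by auto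
    show "\<forall>k\<in>{1..Suc n} \<times> {..t} - insert (1, 0) ({1..5 * t + 2} \<times> {2..t}). ?f k = 0"
    proof
      fix k assume k: "k \<in> {1..Suc n} \<times> {..t} - insert (1, 0) ({1..5 * t + 2} \<times> {2..t})"
      obtain m s where ms: "k = (m, s)" by (cases k)
      have "mid m s = 0"
      proof (cases "s \<le> 1")
        case True
        then show ?thesis using k ms by (intro mid_0) auto
      next
        case False
        then have "5 * t + 2 < m" "s \<le> t" using k ms by auto
        then show ?thesis by (intro mid_bound) linarith
      qed
      then show "?f k = 0" by (simp add: ms)
    qed
  qed simp
  also have "\<dots> = ?f (1, 0) + (\<Sum>k\<in>{1..5 * t + 2} \<times> {2..t}. ?f k)" by (rule sum.insert) auto
  also have "?f (1, 0) = card (tails e sp n t)" by (simp add: mid_1_0[simplified])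
  also have "(\<Sum>k\<in>{1..5 * t + 2} \<times> {2..t}. ?f k) =
      (\<Sum>(m, s)\<in>{1..5 * t + 2} \<times> {2..t}. mid m s * card (tails e sp (n - (m - 1)) (t - s)))"
  proof (rule sum.cong[OF refl])
    fix k assume "k \<in> {1..5 * t + 2} \<times> {2..t}"
    then obtain m s where k: "k = (m, s)" "1 \<le> m" by auto
    then have "Suc n - m = n - (m - 1)" by simp
    then show "?f k = (case k of (m, s) \<Rightarrow> mid m s * card (tails e sp (n - (m - 1)) (t - s)))"
      unfolding k(1) prod.case by metis
  qed
  finally show ?thesis .
qed

text \<open>Excess 0 and 1 give eventually constant counts, which are positive since they are positive once and
never decrease. For larger \<open>t\<close> the difference is a nonnegative combination in which the term for
the piece of size 5 and excess 2 has positive leading coefficient.\<close>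

lemma ev_poly_tails: "\<exists>c>0. ev_poly (\<lambda>n. card (tails e sp n t)) (t div 2) c"
proof (induction t rule: less_induct)
  case (less t)
  let ?h = "\<lambda>n. card (tails e sp n t)"
  let ?G = "\<lambda>n. \<Sum>(m, s)\<in>{1..5 * t + 2} \<times> {2..t}. mid m s * card (tails e sp (n - (m - 1)) (t - s))"
  have step: "\<forall>\<^sub>F n in sequentially. ?h (Suc n) = ?h n + ?G n"
    unfolding eventually_sequentially
  proof (intro exI[of _ "5 * t + 2"] allI impI)
    fix n assume "5 * t + 2 \<le> n"
    then show "?h (Suc n) = ?h n + ?G n" by (intro card_tails_step) simp
  qed
  show ?case
  proof (cases "t < 2")
    case True
    then have "{2..t} = {}" by simp
    then have "\<forall>\<^sub>F n in sequentially. ?h (Suc n) = ?h n" using step by (simp only: Sigma_empty2 sum.empty add_0_right)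
    then obtain c where c: "\<forall>\<^sub>F n in sequentially. ?h n = c" by (rule eventually_constant)
    obtain n0 where "tails e sp n0 t \<noteq> {}" using tails_nonempty True by (cases "t = 0") (auto simp: less_2_cases_iff)
    then have "0 < ?h n0" using finite_tails by (simp add: card_gt_0_iff)
    have pos: "0 < ?h n" if "n \<ge> n0" for n
      using that by (induction n rule: dec_induct) (use \<open>0 < ?h n0\<close> tails_mono order_less_le_trans in blast)+
    have "0 < c"
    proof -
      obtain N where "\<And>n. n \<ge> N \<Longrightarrow> ?h n = c" using c by (auto simp: eventually_sequentially)
      then have "?h (max N n0) = c" by simp
      then show ?thesis using pos[of "max N n0"] by simp
    qed
    moreover have "ev_poly ?h 0 (of_nat c)"
      unfolding ev_poly_def by (rule exI[of _ "[:of_nat c:]"]) (use c in \<open>auto elim: eventually_mono\<close>)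
    ultimately show ?thesis using True by (intro exI[of _ "of_nat c"]) simp
  next
    case False
    let ?A = "{1..5 * t + 2} \<times> {2..t}"
    let ?d = "t div 2 - 1"
    let ?f = "\<lambda>k n. mid (fst k) (snd k) * card (tails e sp (n - (fst k - 1)) (t - snd k))"
    have "\<exists>c\<ge>0. ev_poly (?f k) ?d c \<and> (k = (5, 2) \<longrightarrow> 0 < c)" if k: "k \<in> ?A" for k
    proof -
      have s: "2 \<le> snd k" "snd k \<le> t" using k by auto
      then obtain c where c: "0 < c" "ev_poly (\<lambda>n. card (tails e sp n (t - snd k))) ((t - snd k) div 2) c"
        using less.IH[of "t - snd k"] by auto
      have le: "(t - snd k) div 2 \<le> ?d" using s by linarith
      obtain c' where c': "ev_poly (\<lambda>n. card (tails e sp n (t - snd k))) ?d c'" "0 \<le> c'" "(t - snd k) div 2 = ?d \<Longrightarrow> c' = c"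
        by (rule ev_poly_weaken[OF c(2) le]) (use c(1) in auto)
      have "ev_poly (?f k) ?d (of_nat (mid (fst k) (snd k)) * c')"
        by (intro ev_poly_const_mult ev_poly_shift[where m = "fst k - 1"] c'(1))
      moreover have "0 < of_nat (mid (fst k) (snd k)) * c'" if "k = (5, 2)"
      proof -
        have "(t - 2) div 2 = t div 2 - 1" by presburger
        then have "c' = c" using that c'(3) by simp
        then show ?thesis using c(1) mid_5_2 that by simp
      qed
      ultimately show ?thesis using c'(2) by (intro exI[of _ "of_nat (mid (fst k) (snd k)) * c'"]) auto
    qed
    then obtain c where c: "\<And>k. k \<in> ?A \<Longrightarrow> 0 \<le> c k \<and> ev_poly (?f k) ?d (c k) \<and> (k = (5, 2) \<longrightarrow> 0 < c k)"
      by metis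
    have "ev_poly (\<lambda>n. \<Sum>k\<in>?A. ?f k n) ?d (\<Sum>k\<in>?A. c k)"
      by (rule ev_poly_sum) (use c in auto)
    then have G: "ev_poly ?G ?d (\<Sum>k\<in>?A. c k)" by (simp add: case_prod_unfold)
    have in_A: "(5, 2) \<in> ?A" using False by auto
    have "0 < c (5, 2)" using c[OF in_A] by blast
    then have "0 < (\<Sum>k\<in>?A. c k)"
      using c by (intro sum_pos2[OF _ in_A]) (simp_all only: finite_SigmaI finite_atLeastAtMost)
    moreover have "ev_poly ?h (Suc ?d) ((\<Sum>k\<in>?A. c k) / of_nat (Suc ?d))"
      by (rule ev_poly_antidifference[OF step G])
    moreover have "Suc ?d = t div 2" using False by simp
    ultimately show ?thesis by (intro exI[of _ "(\<Sum>k\<in>?A. c k) / of_nat (Suc ?d)"]) simp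
  qed
qed

theorem ev_poly_comps: "\<exists>c>0. ev_poly (\<lambda>n. card (comps e sp n t)) (t div 2) c"
proof -
  let ?A = "{1..5 * t + 2} \<times> {..t}"
  let ?f = "\<lambda>k n. card (pieces (fst k) (snd k)) * card (tails e sp (n - fst k) (t - snd k))"
  have "\<exists>c\<ge>0. ev_poly (?f k) (t div 2) c \<and> (k = (1, 0) \<longrightarrow> 0 < c)" if k: "k \<in> ?A" for k
  proof -
    obtain c where c: "0 < c" "ev_poly (\<lambda>n. card (tails e sp n (t - snd k))) ((t - snd k) div 2) c"
      using ev_poly_tails by blast
    have le: "(t - snd k) div 2 \<le> t div 2" by linarith
    obtain c' where c': "ev_poly (\<lambda>n. card (tails e sp n (t - snd k))) (t div 2) c'" "0 \<le> c'" "(t - snd k) div 2 = t div 2 \<Longrightarrow> c' = c"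
      by (rule ev_poly_weaken[OF c(2) le]) (use c(1) in auto)
    have "ev_poly (?f k) (t div 2) (of_nat (card (pieces (fst k) (snd k))) * c')"
      by (intro ev_poly_const_mult ev_poly_shift[where m = "fst k"] c'(1))
    moreover have "0 < of_nat (card (pieces (fst k) (snd k))) * c'" if "k = (1, 0)"
    proof -
      have "([], [1]) \<in> pieces 1 0" using pieces_1 by blast
      then have "0 < card (pieces 1 0)" using finite_pieces by (metis card_gt_0_iff empty_iff)
      then show ?thesis using c(1) c'(3) that by simp
    qed
    ultimately show ?thesis using c'(2) by (intro exI[of _ "of_nat (card (pieces (fst k) (snd k))) * c'"]) auto
  qed
  then obtain c where c: "\<And>k. k \<in> ?A \<Longrightarrow> 0 \<le> c k \<and> ev_poly (?f k) (t div 2) (c k) \<and> (k = (1, 0) \<longrightarrow> 0 < c k)"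
    by metis
  have "ev_poly (\<lambda>n. \<Sum>k\<in>?A. ?f k n) (t div 2) (\<Sum>k\<in>?A. c k)"
    by (rule ev_poly_sum) (use c in auto)
  then have "ev_poly (\<lambda>n. 2 * (\<Sum>k\<in>?A. ?f k n)) (t div 2) (of_nat 2 * (\<Sum>k\<in>?A. c k))"
    by (rule ev_poly_const_mult)
  then obtain P :: "rat poly" where P: "degree P \<le> t div 2" "coeff P (t div 2) = of_nat 2 * (\<Sum>k\<in>?A. c k)"
    "\<forall>\<^sub>F n in sequentially. of_nat (2 * (\<Sum>k\<in>?A. ?f k n)) = poly P (of_nat n)"
    unfolding ev_poly_def by blast
  have eq: "card (comps e sp n t) = 2 * (\<Sum>k\<in>?A. ?f k n)" if n: "5 * t + 2 < n" for n
  proof -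
    have "(\<Sum>m=1..n. \<Sum>s\<le>t. card (pieces m s) * card (tails e sp (n - m) (t - s))) = (\<Sum>k\<in>{1..n} \<times> {..t}. ?f k n)"
      by (simp add: sum.cartesian_product case_prod_unfold)
    also have "\<dots> = (\<Sum>k\<in>?A. ?f k n)"
    proof (rule sum.mono_neutral_right)
      show "\<forall>k\<in>{1..n} \<times> {..t} - ?A. ?f k n = 0"
      proof
        fix k assume k: "k \<in> {1..n} \<times> {..t} - ?A"
        then have "5 * snd k + 2 < fst k" by (cases k) auto
        then show "?f k n = 0" using card_pieces_bound by simp
      qed
    qed (use n in auto)
    finally have S: "(\<Sum>m=1..n. \<Sum>s\<le>t. card (pieces m s) * card (tails e sp (n - m) (t - s))) = (\<Sum>k\<in>?A. ?f k n)" .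
    have "{a \<in> comps e sp n t. uncut a} = {}" using uncut_eventually_empty[OF n, of "\<lambda>_. True"] by simp
    then show ?thesis unfolding card_comps[OF e1 spe] S by (simp only: card.empty add_0_left)
  qed
  have "\<forall>\<^sub>F n in sequentially. 5 * t + 2 < n" by (rule eventually_gt_at_top)
  then have "\<forall>\<^sub>F n in sequentially. of_nat (card (comps e sp n t)) = poly P (of_nat n)"
    using P(3) by eventually_elim (simp add: eq)
  moreover have "0 < of_nat 2 * (\<Sum>k\<in>?A. c k)"
    using sum_pos2[of ?A "(1, 0)" c] c by (auto simp: mem_Times_iff)
  ultimately show ?thesis unfolding ev_poly_def using P(1,2) by blast
qed

end

end

section \<open>Counting subalgebras\<close>

lemma frobenius_pairs_frob: "frobenius_pairs (frob TYPE('k::field_char_0))"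
proof
  show "sum_list a = sum_list b \<Longrightarrow> frob TYPE('k) a b = frob TYPE('k) b a" for a b by (rule frob_swap)
  show "sum_list a = sum_list b \<Longrightarrow> frob TYPE('k) (rev a) (rev b) = frob TYPE('k) a b" for a b by (rule frob_rev)
  show "prefix_sum a m \<Longrightarrow> prefix_sum b m \<Longrightarrow> 0 < m \<Longrightarrow> m < sum_list a \<Longrightarrow> \<not> frob TYPE('k) a b" for a b m
    by (rule not_frob_common_boundary)
  show "sum_list (x # a) = sum_list (y # b) \<Longrightarrow> 0 < x \<Longrightarrow> x < y \<Longrightarrow>
      frob TYPE('k) (x # a) (y # b) = frob TYPE('k) ((x - min x (y - x)) # a) ((y - x - min x (y - x)) # x # b)" for x a y b
    by (rule frob_contract)
qed (simp_all only: frob_zero frob_zero' not_frob_full frob_one not_False_eq_True)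

text \<open>A composition is determined by its boundaries.\<close>

lemma pos_eqI:
  assumes "pos a" "pos b" "\<And>s. prefix_sum a s \<longleftrightarrow> prefix_sum b s"
  shows "a = b"
  using assms
proof (induction a arbitrary: b)
  case Nil
  have "prefix_sum b (sum_list b)" by simp
  then have "sum_list b = 0" using Nil(3) by simp
  then show ?case using Nil(2) by (cases b) auto
next
  case (Cons x a)
  have "prefix_sum b (x + sum_list a)" using Cons.prems(3)[of "x + sum_list a"] prefix_sum_sum[of "x # a"] by simp
  moreover have "0 < x" using Cons.prems(1) by simp
  ultimately obtain y b' where b: "b = y # b'" by (cases b) auto
  have y: "0 < y" using Cons.prems(2) b by simp
  have "prefix_sum b y" "prefix_sum (x # a) x" unfolding b prefix_sum_Cons by auto
  then have "prefix_sum (x # a) y" "prefix_sum (y # b') x" using Cons.prems(3) b by auto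
  then have xy: "x = y" using \<open>0 < x\<close> y by (auto simp: prefix_sum_Cons)
  have "prefix_sum a s \<longleftrightarrow> prefix_sum b' s" for s
    using Cons.prems(3)[of "x + s"] \<open>0 < x\<close> xy unfolding b prefix_sum_Cons by auto
  then show ?case using Cons.IH[of b'] Cons.prems b xy by simp
qed

lemma prefix_sum_iff_separated:
  assumes "0 < s"
  shows "prefix_sum l s \<longleftrightarrow> separated l (s - 1) s"
proof -
  have "s - 1 < r \<and> r \<le> s \<longleftrightarrow> r = s" for r using assms by linarith
  then show ?thesis unfolding separated_def by simp
qed

lemma elementary_mem_seaweed:
  assumes "sum_list a = n" "sum_list b = n" "i < n" "j < n" "i \<noteq> j"
  shows "mat_of n (munit i j :: 'k::field kmat) \<in> seaweed a b \<longleftrightarrow> (i, j) \<in> pattern a b"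
proof -
  have "supported ({..<n} \<times> {..<n}) (munit i j :: 'k kmat)" using assms by (intro supported_munit) auto
  then have e: "entries n (mat_of n (munit i j :: 'k kmat)) = munit i j" by (rule entries_mat_of)
  have "mtrace {..<n} (munit i j :: 'k kmat) = 0" using assms(5) by (auto simp: mtrace_def munit_def intro!: sum.neutral)
  moreover have "supported (pattern a b) (munit i j :: 'k kmat) \<longleftrightarrow> (i, j) \<in> pattern a b"
    by (auto simp: supported_def munit_def)
  ultimately show ?thesis unfolding mem_seaweed_entries[OF assms(1,2)] e by simp
qed

text \<open>The off-diagonal matrix units in the algebra determine the pattern, and the entries next to the
diagonal in the pattern determine the boundaries. So counting subalgebras is counting pairs of
compositions.\<close>

lemma seaweed_inject:
  assumes ab: "a \<in> compositions n" "b \<in> compositions n" and ab': "a' \<in> compositions n" "b' \<in> compositions n"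
    and eq: "(seaweed a b :: 'k::field mat set) = seaweed a' b'"
  shows "a = a' \<and> b = b'"
proof -
  have s: "sum_list a = n" "sum_list b = n" "sum_list a' = n" "sum_list b' = n"
    and p: "pos a" "pos b" "pos a'" "pos b'"
    using ab ab' by (auto simp: compositions_def)
  have pattern: "(i, j) \<in> pattern a b \<longleftrightarrow> (i, j) \<in> pattern a' b'" if "i < n" "j < n" "i \<noteq> j" for i j
    using elementary_mem_seaweed[OF s(1,2) that, where 'k = 'k] elementary_mem_seaweed[OF s(3,4) that, where 'k = 'k] eq by simp
  have out: "prefix_sum l t \<longleftrightarrow> prefix_sum l' t" if "sum_list l = n" "sum_list l' = n" "t = 0 \<or> n \<le> t" for l l' t
    using that prefix_sum_le[of l t] prefix_sum_le[of l' t] by (metis prefix_sum_0 prefix_sum_sum le_antisym)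
  have "prefix_sum a t \<longleftrightarrow> prefix_sum a' t" for t
  proof (cases "0 < t \<and> t < n")
    case True
    moreover have "t - 1 < n" using True by linarith
    ultimately have "(t, t - 1) \<in> pattern l l' \<longleftrightarrow> \<not> prefix_sum l t" if "sum_list l = n" for l l'
      using that not_separated_ge[of "t - 1" t l'] by (simp add: pattern_def prefix_sum_iff_separated)
    then show ?thesis using pattern[of t "t - 1"] True s by auto
  next
    case False
    then have "t = 0 \<or> n \<le> t" by linarith
    then show ?thesis using out[OF s(1) s(3)] by blast
  qed
  moreover have "prefix_sum b t \<longleftrightarrow> prefix_sum b' t" for t
  proof (cases "0 < t \<and> t < n")
    case True
    moreover have "t - 1 < n" using True by linarith
    ultimately have "(t - 1, t) \<in> pattern l l' \<longleftrightarrow> \<not> prefix_sum l' t" if "sum_list l = n" for l l'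
      using that not_separated_ge[of "t - 1" t l] by (simp add: pattern_def prefix_sum_iff_separated)
    then show ?thesis using pattern[of "t - 1" t] True s by auto
  next
    case False
    then have "t = 0 \<or> n \<le> t" by linarith
    then show ?thesis using out[OF s(2) s(4)] by blast
  qed
  ultimately show ?thesis using pos_eqI p by blast
qed

lemma parabolic_eq_seaweed:
  assumes "sum_list a = n"
  shows "parabolic a = seaweed a [n]"
proof -
  have "transpose_mat A \<in> parabolic [n]" if "A \<in> parabolic a" for A :: "'k::comm_ring_1 mat"
  proof -
    have A: "A \<in> carrier_mat n n" "trace A = 0" using that assms by (auto simp: parabolic_def sl_def)
    then have "trace (transpose_mat A) = 0" by (auto simp: trace_def)
    then show ?thesis using A by (auto simp: parabolic_def sl_def block_of_less_iff not_separated_first)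
  qed
  then show ?thesis by (auto simp: mem_seaweed_iff)
qed

lemma F_seaweed_eq:
  "F_seaweed TYPE('k::field_char_0) n p = card {(a, b). a \<in> compositions n \<and> b \<in> compositions n \<and>
     length a + length b = p \<and> frob TYPE('k) a b}" (is "_ = card ?A")
proof -
  have "{g :: 'k mat set. frobenius n g \<and> (\<exists>a\<in>compositions n. \<exists>b\<in>compositions n.
       length a + length b = p \<and> g = seaweed a b)} = (\<lambda>(a, b). seaweed a b) ` ?A"
    by (auto simp: frobenius_seaweed_iff)
  moreover have "inj_on (\<lambda>(a, b). seaweed a b :: 'k mat set) ?A"
    by (rule inj_onI) (use seaweed_inject[where 'k = 'k] in fastforce)
  ultimately show ?thesis by (simp add: F_seaweed_def card_image)
qed

lemma F_parabolic_eq: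
  assumes "0 < n"
  shows "F_parabolic TYPE('k::field_char_0) n p = card {a \<in> compositions n. length a = p \<and> frob TYPE('k) a [n]}"
    (is "_ = card ?A")
proof -
  have n: "[n] \<in> compositions n" using assms by (simp add: compositions_def)
  have e: "parabolic a = seaweed a [n]" if "a \<in> compositions n" for a
    using that by (intro parabolic_eq_seaweed) (simp add: compositions_def)
  have "{g :: 'k mat set. frobenius n g \<and> (\<exists>a\<in>compositions n. length a = p \<and> g = parabolic a)}
      = (\<lambda>a. seaweed a [n]) ` ?A"
    using n by (auto simp: frobenius_seaweed_iff e)
  moreover have "inj_on (\<lambda>a. seaweed a [n] :: 'k mat set) ?A"
    by (rule inj_onI) (use seaweed_inject[OF _ n _ n, where 'k = 'k] in blast)
  ultimately show ?thesis by (simp add: F_parabolic_def card_image)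
qed

context frobenius_pairs
begin

lemma comps_parabolic:
  assumes "t \<le> n" "0 < 2 * n + e"
  shows "{a \<in> compositions (2 * n + e). length a = n + 1 - t \<and> Fr a [2 * n + e]} = comps e False n t"
  using assms by (auto simp: compositions_def comps_def Fr1_def)

lemma card_pairs:
  assumes "t \<le> n" "0 < n"
  shows "card {(a, b). a \<in> compositions n \<and> b \<in> compositions n \<and> length a + length b = n + 1 - t \<and> Fr a b}
    = card (comps 0 True n t)" (is "card ?A = _")
proof -
  let ?f = "\<lambda>(a, b). a @ List.rev b"
  have "inj_on ?f ?A"
  proof (rule inj_onI)
    fix x y assume x: "x \<in> ?A" and y: "y \<in> ?A" and eq: "?f x = ?f y"
    obtain a b a' b' where xy: "x = (a, b)" "y = (a', b')" by (metis surj_pair)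
    have "pos (a @ List.rev b)" "sum_list a = sum_list a'" using x y by (auto simp: xy compositions_def)
    moreover have "a @ List.rev b = a' @ List.rev b'" using eq xy by simp
    ultimately have "a = a'" "List.rev b = List.rev b'" using split_unique[of a "List.rev b" a' "List.rev b'"] by blast+
    then show "x = y" by (simp add: xy)
  qed
  then have "card ?A = card (?f ` ?A)" by (simp add: card_image)
  also have "?f ` ?A = comps 0 True n t"
  proof (intro equalityI subsetI)
    fix c assume "c \<in> ?f ` ?A"
    then obtain a b where ab: "c = a @ List.rev b" "pos a" "pos b" "sum_list a = n" "sum_list b = n"
      "length a + length b = n + 1 - t" "Fr a b" by (auto simp: compositions_def)
    have "prefix_sum c n" unfolding prefix_sum_def using ab by blast
    moreover have "Fr1 c" using Fr1_fold[of a "List.rev b"] ab by simp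
    ultimately show "c \<in> comps 0 True n t" using ab assms by (auto simp: comps_def)
  next
    fix c assume c: "c \<in> comps 0 True n t"
    then obtain u v where uv: "c = u @ v" "sum_list u = n" by (auto simp: comps_def prefix_sum_def)
    have p: "pos u" "pos v" "sum_list v = n" "length u + length v = n + 1 - t" "Fr1 (u @ v)"
      using c uv by (auto simp: comps_def)
    have "0 < sum_list u" "0 < sum_list v" using uv p assms by linarith+
    then have "u \<noteq> []" "v \<noteq> []" by auto
    moreover have "Fr u (List.rev v)" using Fr1_fold[of u v] p uv by simp
    ultimately have "(u, List.rev v) \<in> ?A" using p uv by (auto simp: compositions_def)
    then show "c \<in> ?f ` ?A" using uv(1) by (intro image_eqI[of _ _ "(u, List.rev v)"]) auto
  qed
  finally show ?thesis .
qed

end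

theorem theorem1p1:
  fixes \<epsilon> t :: nat
  assumes "\<epsilon> \<in> {0, 1}"
  shows
    "(\<exists>P :: rat poly. degree P = t div 2 \<and> lead_coeff P > 0 \<and>
        (\<forall>\<^sub>F n in sequentially.
           of_nat (F_parabolic TYPE('k::{alg_closed_field, field_char_0}) (2 * n + \<epsilon>) (n + 1 - t))
             = poly P (of_nat n))) \<and>
     (\<exists>P :: rat poly. degree P = t div 2 \<and> lead_coeff P > 0 \<and>
        (\<forall>\<^sub>F n in sequentially.
           of_nat (F_seaweed TYPE('k) n (n + 1 - t)) = poly P (of_nat n)))"
proof -
  interpret frobenius_pairs "frob TYPE('k)" by (rule frobenius_pairs_frob)
  \<comment> \<open>Then \<open>n + 1 - t\<close> is not truncated, and the sizes are positive.\<close>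
  have large: "\<forall>\<^sub>F n in sequentially. t < n" by (rule eventually_gt_at_top)
  have "\<epsilon> \<le> 1" using assms by auto
  then obtain c where "0 < c" "ev_poly (\<lambda>n. card (comps \<epsilon> False n t)) (t div 2) c"
    using ev_poly_comps[of \<epsilon> False t] by auto
  then obtain P :: "rat poly" where P: "degree P = t div 2" "lead_coeff P > 0"
      "\<forall>\<^sub>F n in sequentially. of_nat (card (comps \<epsilon> False n t)) = poly P (of_nat n)"
    using ev_poly_imp_poly by blast
  have "\<forall>\<^sub>F n in sequentially. of_nat (F_parabolic TYPE('k) (2 * n + \<epsilon>) (n + 1 - t)) = poly P (of_nat n)"
    using P(3) large
  proof eventually_elim
    case (elim n)
    then show ?case using F_parabolic_eq[of "2 * n + \<epsilon>", where 'k = 'k] comps_parabolic[of t n \<epsilon>] by simp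
  qed
  moreover obtain c' where "0 < c'" "ev_poly (\<lambda>n. card (comps 0 True n t)) (t div 2) c'"
    using ev_poly_comps[of 0 True t] by auto
  then obtain Q :: "rat poly" where Q: "degree Q = t div 2" "lead_coeff Q > 0"
      "\<forall>\<^sub>F n in sequentially. of_nat (card (comps 0 True n t)) = poly Q (of_nat n)"
    using ev_poly_imp_poly by blast
  have "\<forall>\<^sub>F n in sequentially. of_nat (F_seaweed TYPE('k) n (n + 1 - t)) = poly Q (of_nat n)"
    using Q(3) large
  proof eventually_elim
    case (elim n)
    then show ?case using F_seaweed_eq[where 'k = 'k, of n "n + 1 - t"] card_pairs[of t n] by simp
  qed
  ultimately show ?thesis using P(1,2) Q(1,2) by blast
qed

end
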